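(* Let $R,T>0$ and define $$\eta(T)=\max\left\{m\in\mathbb{N}\cup\{0\}:2m+1<\frac{2T}{\pi\sinh R}\right\}.$$ Consider $C_{R,+}^T$ as a capillary surface supported in the totally geodesic plane $\mathsf{S}_{\tau_0}$, $\tau_0=\sqrt{1+\sinh^2R}$. Then $\mathrm{index}(C_{R,+}^T)=\eta(T)$. Moreover, if $T>3\pi\sinh R/2$, then $C_{R,+}^T$ is not stable. In consequence, $C_{R,+}$ is not stable.
   Context: $\mathbb{H}^3$ is the upper half-space $\mathbb{R}^3_+=\{z>0\}$ with metric $\langle\cdot,\cdot\rangle=(dx^2+dy^2+dz^2)/z^2$. $\mathsf{S}_{\tau_0}=\{(x,y,z)\in\mathbb{R}^3_+:x^2+y^2+z^2=\tau_0^2\}$ is a totally geodesic plane and $W=\{x^2+y^2+z^2>\tau_0^2\}\cap\mathbb{R}^3_+$ is the part above it. For $R>0$, $r=\sinh R$, the Killing cylinder $C_R$ is parametrized by $\Psi(t,\theta)=e^t(r\cos\theta,r\sin\theta,1)$, $t\in\mathbb{R}$, $\theta\in[0,2\pi]$. $C_{R,+}=C_R\cap W$ (the part $t\ge0$, with boundary the circle $t=0$ on $\mathsf{S}_{\tau_0}$), and $C_{R,+}^T=\Psi([0,T]\times[0,2\pi])$. $D$ is the component of $W$ minus $C_{R,+}$ inside the cylinder. If the set defining $\eta(T)$ is empty, $\eta(T)=0$. With $\Sigma=C_{R,+}$: $\Omega=\partial D\cap\partial W$; $N$ is the unit normal of $\Sigma$ pointing into $D$, $\overline N$ the unit normal of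 $\Omega$ pointing out of $D$, $\nu,\overline\nu$ the exterior unit conormals of $\partial\Sigma$ in $\Sigma$ and in $\Omega$; $\gamma\in(0,\pi)$ is the constant contact angle, $\cos\gamma=\langle N,\overline N\rangle$. $A(X,Y)=-\langle\nabla_XN,Y\rangle$ is the second fundamental form of $\Sigma$, $\overline A$ that of $\partial W$ with respect to $-\overline N$, and along $\partial\Sigma$, $\mathbf{q}=\frac{1}{\sin\gamma}\overline A(\overline\nu,\overline\nu)+\cot\gamma A(\nu,\nu)$. Let $J=\Delta+|A|^2-2$. The (Morse) index of $C_{R,+}^T$ is the number of negative eigenvalues $\lambda$, counted with multiplicity, of $$Ju+\lambda u=0\ \text{in }C_{R,+}^T,\qquad \frac{\partial u}{\partial\nu}-\mathbf{q}u=0\ \text{on the circle } t=0\ (\text{on the support}),\qquad u=0\ \text{on the cut circle } t=T.$$ Let $Q[u]=\int_\Sigma(|\nabla u|^2-(|A|^2-2)u^2)-\int_{\partial\Sigma}\mathbf{q}u^2$. $C_{R,+}^T$ is stable if $Q[u]\ge0$ (integrals over $C_{R,+}^T$ and the circle $t=0$) for all smooth $u$ on $C_{R,+}^T$ vanishing on $t=T$ with $\int u=0$. The non-compact surface $C_{R,+}$ is stable if $Q[u]\ge0$ for all smooth compactly supported $u$ on $\Sigma$ (not required to vanish on $\partial\Sigma$) with $\int_\Sigma u=0$.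
   Formalization: η(T) is taken as max{m ≥ 0 : 2m−1 < 2T/(π sinh R)} instead of 2m+1, since the printed formula is one less than the index whenever T > π sinh R/2 (e.g. T = π sinh R has index 1 but printed η = 0). *)

theory Defs
  imports "HOL-Analysis.Analysis" "HOL-Library.Function_Algebras"
begin

section \<open>Calculus in coordinates\<close>

text \<open>Partial derivative in the i-th coordinate, one-sided at boundary points of \<open>D\<close>.\<close>

definition pd :: "(real^'n) set \<Rightarrow> 'n \<Rightarrow> (real^'n \<Rightarrow> 'b::real_normed_vector) \<Rightarrow> real^'n \<Rightarrow> 'b" where
  "pd D i F q = vector_derivative (\<lambda>s. F (q + s *\<^sub>R axis i 1))
                  (at 0 within {s. q + s *\<^sub>R axis i 1 \<in> D})"

primrec Ck_on :: "nat \<Rightarrow> ('a::real_normed_vector) set \<Rightarrow> ('a \<Rightarrow> real) \<Rightarrow> bool" where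
  "Ck_on 0 U f \<longleftrightarrow> continuous_on U f"
| "Ck_on (Suc k) U f \<longleftrightarrow>
     f differentiable_on U \<and> (\<forall>v. Ck_on k U (\<lambda>p. frechet_derivative f (at p) v))"

text \<open>Smoothness on a subset of \<open>\<real>\<^sup>3\<close> means having a smooth extension to an open neighbourhood. For
  the properly embedded surfaces with boundary below this is smoothness up to the boundary.\<close>

definition smooth_on_set :: "'a::real_normed_vector set \<Rightarrow> ('a \<Rightarrow> real) \<Rightarrow> bool" where
  "smooth_on_set M u \<longleftrightarrow>
     (\<exists>U f. open U \<and> M \<subseteq> U \<and> (\<forall>k. Ck_on k U f) \<and> (\<forall>p\<in>M. f p = u p))"

text \<open>Derivative of \<open>V\<close> along \<open>M\<close> in the direction \<open>X\<close>. A derivative \<open>L\<close> within \<open>M\<close> is not unique as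
  a linear map on the ambient space, but its values on vectors tangent to \<open>M\<close> are.\<close>

definition deriv_along ::
  "'a::real_normed_vector set \<Rightarrow> ('a \<Rightarrow> 'b::real_normed_vector) \<Rightarrow> 'a \<Rightarrow> 'a \<Rightarrow> 'b" where
  "deriv_along M V p X = (THE w. \<exists>L. (V has_derivative L) (at p within M) \<and> w = L X)"

text \<open>Initial velocities of curves in \<open>M\<close> issuing from \<open>p\<close>: the tangent space at an interior point of
  a surface, and the closed half-space of vectors pointing into \<open>M\<close> at a boundary point.\<close>

definition tangent_cone :: "'a::real_normed_vector set \<Rightarrow> 'a \<Rightarrow> 'a set" where
  "tangent_cone M p = {v. \<exists>c. c 0 = p \<and> (\<forall>s\<in>{0..1::real}. c s \<in> M) \<and>
                              (c has_vector_derivative v) (at 0 within {0..1})}"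


section \<open>The upper half-space model\<close>

definition H3 :: "(real^3) set" where
  "H3 = {p. p $ 3 > 0}"

definition hyp_inner :: "real^3 \<Rightarrow> real^3 \<Rightarrow> real^3 \<Rightarrow> real" where
  "hyp_inner p u v = (u \<bullet> v) / (p $ 3)\<^sup>2"

definition metric_matrix :: "real^3 \<Rightarrow> real^3^3" where
  "metric_matrix p = (\<chi> i j. hyp_inner p (axis i 1) (axis j 1))"

text \<open>\<open>christoffel p k i j\<close> is \<open>\<Gamma>\<^sup>k\<^sub>i\<^sub>j\<close>, the upper index coming first.\<close>

definition christoffel :: "real^3 \<Rightarrow> 3 \<Rightarrow> 3 \<Rightarrow> 3 \<Rightarrow> real" where
  "christoffel p k i j = 1/2 * (\<Sum>l\<in>UNIV. matrix_inv (metric_matrix p) $ k $ l *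
      (pd H3 i (\<lambda>x. metric_matrix x $ j $ l) p + pd H3 j (\<lambda>x. metric_matrix x $ i $ l) p
       - pd H3 l (\<lambda>x. metric_matrix x $ i $ j) p))"

text \<open>Levi-Civita derivative of a vector field \<open>V\<close> defined along \<open>M\<close>, in a direction \<open>X\<close> tangent
  to \<open>M\<close>.\<close>

definition cov_deriv :: "(real^3) set \<Rightarrow> (real^3 \<Rightarrow> real^3) \<Rightarrow> real^3 \<Rightarrow> real^3 \<Rightarrow> real^3" where
  "cov_deriv M V p X = deriv_along M V p X
     + (\<chi> k. \<Sum>i\<in>UNIV. \<Sum>j\<in>UNIV. christoffel p k i j * X $ i * V p $ j)"

definition second_form ::
  "(real^3) set \<Rightarrow> (real^3 \<Rightarrow> real^3) \<Rightarrow> real^3 \<Rightarrow> real^3 \<Rightarrow> real^3 \<Rightarrow> real" where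
  "second_form M V p X Y = - hyp_inner p (cov_deriv M V p X) Y"

definition is_unit_normal :: "(real^3) set \<Rightarrow> real^3 \<Rightarrow> real^3 \<Rightarrow> bool" where
  "is_unit_normal M p n \<longleftrightarrow> hyp_inner p n n = 1 \<and> (\<forall>v\<in>tangent_cone M p. hyp_inner p n v = 0)"

text \<open>Exterior unit conormal of the boundary curve \<open>B\<close> of the surface \<open>M\<close>.\<close>

definition exterior_conormal :: "(real^3) set \<Rightarrow> (real^3) set \<Rightarrow> real^3 \<Rightarrow> real^3" where
  "exterior_conormal M B p = (THE n. hyp_inner p n n = 1 \<and> - n \<in> tangent_cone M p \<and>
                                     (\<forall>v\<in>tangent_cone B p. hyp_inner p n v = 0))"


section \<open>The Killing cylinder as a capillary surface\<close>

definition tau0 :: "real \<Rightarrow> real" where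
  "tau0 R = sqrt (1 + (sinh R)\<^sup>2)"

definition region_W :: "real \<Rightarrow> (real^3) set" where
  "region_W R = {p\<in>H3. (p $ 1)\<^sup>2 + (p $ 2)\<^sup>2 + (p $ 3)\<^sup>2 > (tau0 R)\<^sup>2}"

text \<open>The coordinates are \<open>q = (t, \<theta>)\<close>.\<close>

definition Psi :: "real \<Rightarrow> real^2 \<Rightarrow> real^3" where
  "Psi R q = exp (q $ 1) *\<^sub>R vector [sinh R * cos (q $ 2), sinh R * sin (q $ 2), 1]"

definition strip :: "real set \<Rightarrow> (real^2) set" where
  "strip I = {q. q $ 1 \<in> I}"

text \<open>The piece of the cylinder over the parameters \<open>t \<in> I\<close>. The surfaces of interest are
  \<open>I = {0..}\<close> (the half-cylinder, including its boundary circle) and \<open>I = {0..T}\<close>; a circle is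
  \<open>I = {t}\<close>.\<close>

definition cyl :: "real \<Rightarrow> real set \<Rightarrow> (real^3) set" where
  "cyl R I = Psi R ` {q \<in> strip I. q $ 2 \<in> {0..2 * pi}}"

text \<open>The component of \<open>region_W R\<close> minus the half-cylinder containing points of the axis.\<close>

definition region_D :: "real \<Rightarrow> (real^3) set" where
  "region_D R = connected_component_set (region_W R - cyl R {0..}) (vector [0, 0, 2 * tau0 R])"

definition Omega :: "real \<Rightarrow> (real^3) set" where
  "Omega R = frontier (region_D R) \<inter> frontier (region_W R)"

definition normal_N :: "real \<Rightarrow> real^3 \<Rightarrow> real^3" where
  "normal_N R p = (THE n. is_unit_normal (cyl R {0..}) p n \<and> n \<in> tangent_cone (closure (region_D R)) p)"

definition normal_Nbar :: "real \<Rightarrow> real^3 \<Rightarrow> real^3" where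
  "normal_Nbar R p = (THE n. is_unit_normal (Omega R) p n \<and> - n \<in> tangent_cone (closure (region_D R)) p)"

definition nu :: "real \<Rightarrow> real^3 \<Rightarrow> real^3" where
  "nu R = exterior_conormal (cyl R {0..}) (cyl R {0})"

definition nubar :: "real \<Rightarrow> real^3 \<Rightarrow> real^3" where
  "nubar R = exterior_conormal (Omega R) (cyl R {0})"

definition contact_angle :: "real \<Rightarrow> real" where
  "contact_angle R = (THE \<gamma>. 0 < \<gamma> \<and> \<gamma> < pi \<and>
      (\<forall>p\<in>cyl R {0}. cos \<gamma> = hyp_inner p (normal_N R p) (normal_Nbar R p)))"

definition form_A :: "real \<Rightarrow> real^3 \<Rightarrow> real^3 \<Rightarrow> real^3 \<Rightarrow> real" where
  "form_A R = second_form (cyl R {0..}) (normal_N R)"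

text \<open>\<open>Omega R\<close> is the part of the boundary of \<open>region_W R\<close> on which \<open>normal_Nbar R\<close> is defined.\<close>

definition form_Abar :: "real \<Rightarrow> real^3 \<Rightarrow> real^3 \<Rightarrow> real^3 \<Rightarrow> real" where
  "form_Abar R = second_form (Omega R) (\<lambda>p. - normal_Nbar R p)"

definition qcoef :: "real \<Rightarrow> real^3 \<Rightarrow> real" where
  "qcoef R p = 1 / sin (contact_angle R) * form_Abar R p (nubar R p) (nubar R p)
               + cot (contact_angle R) * form_A R p (nu R p) (nu R p)"


section \<open>Intrinsic geometry of the cylinder\<close>

definition first_form :: "real \<Rightarrow> real^2 \<Rightarrow> real^2^2" where
  "first_form R q = (\<chi> i j. hyp_inner (Psi R q) (pd UNIV i (Psi R) q) (pd UNIV j (Psi R) q))"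

definition inv_form :: "real \<Rightarrow> real^2 \<Rightarrow> real^2^2" where
  "inv_form R q = matrix_inv (first_form R q)"

definition area_density :: "real \<Rightarrow> real^2 \<Rightarrow> real" where
  "area_density R q = sqrt (det (first_form R q))"

definition norm_A_sq :: "real \<Rightarrow> real^2 \<Rightarrow> real" where
  "norm_A_sq R q =
     (let a = (\<lambda>i j. form_A R (Psi R q) (pd UNIV i (Psi R) q) (pd UNIV j (Psi R) q)) in
      \<Sum>i\<in>UNIV. \<Sum>j\<in>UNIV. \<Sum>k\<in>UNIV. \<Sum>l\<in>UNIV.
        inv_form R q $ i $ k * inv_form R q $ j $ l * a i j * a k l)"

definition grad_sq :: "real \<Rightarrow> real set \<Rightarrow> (real^3 \<Rightarrow> real) \<Rightarrow> real^2 \<Rightarrow> real" where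
  "grad_sq R I u q = (\<Sum>i\<in>UNIV. \<Sum>j\<in>UNIV. inv_form R q $ i $ j *
      pd (strip I) i (u \<circ> Psi R) q * pd (strip I) j (u \<circ> Psi R) q)"

definition laplacian :: "real \<Rightarrow> real set \<Rightarrow> (real^3 \<Rightarrow> real) \<Rightarrow> real^2 \<Rightarrow> real" where
  "laplacian R I u q = 1 / area_density R q *
     (\<Sum>i\<in>UNIV. pd (strip I) i
        (\<lambda>x. area_density R x * (\<Sum>j\<in>UNIV. inv_form R x $ i $ j * pd (strip I) j (u \<circ> Psi R) x)) q)"

definition jacobi :: "real \<Rightarrow> real set \<Rightarrow> (real^3 \<Rightarrow> real) \<Rightarrow> real^2 \<Rightarrow> real" where
  "jacobi R I u q = laplacian R I u q + (norm_A_sq R q - 2) * u (Psi R q)"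

text \<open>Integrals over the surface and its boundary circle of a function given in the coordinates
  \<open>(t, \<theta>)\<close>. They are only applied to continuous functions, which vanish for large \<open>t\<close> if \<open>I\<close> is
  unbounded.\<close>

definition surface_integral :: "real \<Rightarrow> real set \<Rightarrow> (real^2 \<Rightarrow> real) \<Rightarrow> real" where
  "surface_integral R I f = integral I (\<lambda>t. integral {0..2 * pi}
      (\<lambda>\<theta>. f (vector [t, \<theta>]) * area_density R (vector [t, \<theta>])))"

definition boundary_integral :: "real \<Rightarrow> (real^2 \<Rightarrow> real) \<Rightarrow> real" where
  "boundary_integral R f = integral {0..2 * pi}
      (\<lambda>\<theta>. f (vector [0, \<theta>]) * sqrt (first_form R (vector [0, \<theta>]) $ 2 $ 2))"


section \<open>Index and stability\<close>

definition fun_scale :: "real \<Rightarrow> (real^3 \<Rightarrow> real) \<Rightarrow> (real^3 \<Rightarrow> real)" where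
  "fun_scale c u = (\<lambda>p. c * u p)"

interpretation fun_vs: vector_space fun_scale
  by unfold_locales (auto simp: fun_scale_def fun_eq_iff algebra_simps)

text \<open>A function on the compact surface is represented by its extension by zero to \<open>\<real>\<^sup>3\<close>, so that
  linear independence in the eigenspace is that of functions on the surface.\<close>

definition eigenspace :: "real \<Rightarrow> real \<Rightarrow> real \<Rightarrow> (real^3 \<Rightarrow> real) set" where
  "eigenspace R T ev = {u. (\<forall>p. p \<notin> cyl R {0..T} \<longrightarrow> u p = 0) \<and>
      smooth_on_set (cyl R {0..T}) u \<and>
      (\<forall>q\<in>strip {0..T}. jacobi R {0..T} u q + ev * u (Psi R q) = 0) \<and>
      (\<forall>p\<in>cyl R {0}. deriv_along (cyl R {0..T}) u p (nu R p) - qcoef R p * u p = 0) \<and>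
      (\<forall>p\<in>cyl R {T}. u p = 0)}"

definition negative_eigenvalues :: "real \<Rightarrow> real \<Rightarrow> real set" where
  "negative_eigenvalues R T = {ev. ev < 0 \<and> (\<exists>u\<in>eigenspace R T ev. \<exists>p. u p \<noteq> 0)}"

text \<open>A relation rather than a number, because \<open>dim\<close> and \<open>\<Sum>\<close> take the value 0 in infinite cases.\<close>

definition has_index :: "real \<Rightarrow> real \<Rightarrow> nat \<Rightarrow> bool" where
  "has_index R T n \<longleftrightarrow> finite (negative_eigenvalues R T) \<and>
     (\<forall>ev\<in>negative_eigenvalues R T. \<exists>B. finite B \<and> eigenspace R T ev \<subseteq> fun_vs.span B) \<and>
     n = (\<Sum>ev\<in>negative_eigenvalues R T. fun_vs.dim (eigenspace R T ev))"

definition form_Q :: "real \<Rightarrow> real set \<Rightarrow> (real^3 \<Rightarrow> real) \<Rightarrow> real" where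
  "form_Q R I u =
     surface_integral R I (\<lambda>q. grad_sq R I u q - (norm_A_sq R q - 2) * (u (Psi R q))\<^sup>2)
     - boundary_integral R (\<lambda>q. qcoef R (Psi R q) * (u (Psi R q))\<^sup>2)"

definition stable_compact :: "real \<Rightarrow> real \<Rightarrow> bool" where
  "stable_compact R T \<longleftrightarrow> (\<forall>u. smooth_on_set (cyl R {0..T}) u \<and> (\<forall>p\<in>cyl R {T}. u p = 0) \<and>
      surface_integral R {0..T} (u \<circ> Psi R) = 0 \<longrightarrow> form_Q R {0..T} u \<ge> 0)"

definition stable_noncompact :: "real \<Rightarrow> bool" where
  "stable_noncompact R \<longleftrightarrow> (\<forall>u. smooth_on_set (cyl R {0..}) u \<and>
      (\<exists>K. compact K \<and> K \<subseteq> cyl R {0..} \<and> (\<forall>p\<in>cyl R {0..} - K. u p = 0)) \<and>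
      surface_integral R {0..} (u \<circ> Psi R) = 0 \<longrightarrow> form_Q R {0..} u \<ge> 0)"

text \<open>The inequality is \<open>2m - 1 < \<dots>\<close>, not \<open>2m + 1 < \<dots>\<close> as printed in the source. With the printed
  sign the identity between index and \<open>\<eta>\<close> is false by one as soon as \<open>2T > \<pi> sinh R\<close>: the negative
  eigenvalues are
  \<open>((2k + 1)\<^sup>2 \<pi>\<^sup>2 / (4T\<^sup>2) - 1 / sinh\<^sup>2 R) / cosh\<^sup>2 R\<close>, with eigenfunction \<open>cos ((2k + 1) \<pi> t / (2T))\<close>,
  for \<open>k = 0, 1, 2, \<dots>\<close> with \<open>2k + 1 < 2T / (\<pi> sinh R)\<close>, so that \<open>k = 0\<close> must contribute 1. With the
  sign below, \<open>\<eta>\<close> is the number of such \<open>k\<close>; the set always contains 0, so no convention for the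
  empty set is needed.\<close>

definition eta :: "real \<Rightarrow> real \<Rightarrow> nat" where
  "eta R T = Max {m::nat. 2 * real m - 1 < 2 * T / (pi * sinh R)}"

end

theory Submission
  imports Defs "HOL-Computational_Algebra.Polynomial"
begin

text \<open>Write \<open>r = sinh R\<close> and \<open>c = cosh R\<close>. All the geometry is explicit. In the coordinates \<open>(t, \<theta>)\<close> the
  metric of the cylinder is the constant diagonal matrix with entries \<open>c\<^sup>2\<close> and \<open>r\<^sup>2\<close>; the principal
  curvatures are \<open>tanh R\<close> and \<open>coth R\<close>, so the potential \<open>\<bar>A\<bar>\<^sup>2 - 2\<close> is \<open>1 / (r\<^sup>2 c\<^sup>2)\<close>
  (\<open>norm_A_sq_eq\<close>); the cylinder meets the hemisphere at a right angle and the hemisphere is totally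
  geodesic, so the boundary coefficient vanishes (\<open>qcoef_eq_0\<close>). Normals and conormals are
  specified by tangent cones. They are identified by exhibiting curves in the surface or region,
  and by first-order conditions for functions that are minimal or constant there, which exclude the
  opposite sign.

  The eigenvalue problem is therefore \<open>u\<^sub>t\<^sub>t / c\<^sup>2 + u\<^sub>\<theta>\<^sub>\<theta> / r\<^sup>2 + (1 / (r\<^sup>2 c\<^sup>2) + \<lambda>) u = 0\<close> with a Neumann
  condition at \<open>t = 0\<close> and a Dirichlet condition at \<open>t = T\<close>. An eigenfunction with \<open>\<lambda> < 0\<close> does not
  depend on \<open>\<theta>\<close>. Instead of expanding in Fourier series, compare it with its reflection: the
  difference \<open>u(t, \<theta>) - u(t, 2\<alpha> - \<theta>)\<close> vanishes at \<open>\<theta> = \<alpha>\<close> and \<open>\<theta> = \<alpha> + \<pi>\<close>, and on this half-period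
  \<open>cos ((\<theta> - \<alpha> - \<pi>/2) / c)\<close> is a positive strict supersolution exactly because \<open>\<lambda> < 0\<close>. By the
  maximum principle the difference is zero for every \<open>\<alpha>\<close>
  (\<open>rotationally_invariant_solution\<close>). What is left is an ordinary differential equation whose
  solutions are multiples of \<open>cos ((2m + 1) \<pi> t / (2T))\<close>; negativity of the eigenvalue says that
  the frequency is below \<open>1 / r\<close>, and \<open>\<eta>(T)\<close> counts these frequencies (\<open>has_index_eta\<close>).

  On a function \<open>h\<close> of \<open>t\<close> alone, \<open>Q\<close> is a positive multiple of the integral of
  \<open>h'\<^sup>2 - h\<^sup>2 / r\<^sup>2\<close> (\<open>form_Q_height\<close>). If \<open>T > 3 \<pi> r / 2\<close>, the two lowest modes both have negative
  energy, and some combination of them has mean zero. On the unbounded cylinder a compactly supported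
  profile of mean zero, stretched by a large factor, has negative energy since stretching makes the
  Dirichlet integral negligible.\<close>

section \<open>Derivatives along subsets\<close>

text \<open>A curve that stays in \<open>M\<close> for a short time is enough: freezing it afterwards does not change its
  initial velocity.\<close>
lemma tangent_coneI:
  assumes "c 0 = p" and "\<epsilon> > 0" and in_M: "\<And>s. 0 \<le> s \<Longrightarrow> s \<le> \<epsilon> \<Longrightarrow> c s \<in> M"
    and deriv: "(c has_vector_derivative v) (at 0)"
  shows "v \<in> tangent_cone M p"
proof -
  have "((\<lambda>s. c (min s \<epsilon>)) has_vector_derivative v) (at 0)"
    by (rule has_vector_derivative_transform_within_open[OF deriv, where S = "{..<\<epsilon>}"])
       (use \<open>\<epsilon> > 0\<close> in auto)
  then have "((\<lambda>s. c (min s \<epsilon>)) has_vector_derivative v) (at 0 within {0..1})"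
    by (rule has_vector_derivative_at_within)
  moreover have "\<forall>s\<in>{0..1}. c (min s \<epsilon>) \<in> M"
    using in_M \<open>\<epsilon> > 0\<close> by (auto simp: min_def)
  ultimately show ?thesis
    unfolding tangent_cone_def using \<open>c 0 = p\<close> \<open>\<epsilon> > 0\<close>
    by (intro CollectI exI[of _ "\<lambda>s. c (min s \<epsilon>)"]) auto
qed

lemma tangent_cone_segmentI:
  assumes "\<epsilon> > 0" and "\<And>s. 0 \<le> s \<Longrightarrow> s \<le> \<epsilon> \<Longrightarrow> p + s *\<^sub>R v \<in> M"
  shows "v \<in> tangent_cone M p"
proof (rule tangent_coneI[where c = "\<lambda>s. p + s *\<^sub>R v"])
  show "((\<lambda>s. p + s *\<^sub>R v) has_vector_derivative v) (at 0)"
    by (auto intro!: derivative_eq_intros)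
qed (use assms in auto)

lemma tangent_cone_mono: "M \<subseteq> M' \<Longrightarrow> tangent_cone M p \<subseteq> tangent_cone M' p"
  unfolding tangent_cone_def by blast

lemma tangent_cone_chain:
  assumes "v \<in> tangent_cone M p" and "(\<phi> has_derivative L) (at p within M)"
  obtains c where "c 0 = p" and "\<forall>s\<in>{0..1::real}. c s \<in> M"
    and "((\<lambda>s. \<phi> (c s)) has_vector_derivative L v) (at 0 within {0..1})"
proof -
  obtain c where c: "c 0 = p" "\<forall>s\<in>{0..1::real}. c s \<in> M"
      "(c has_vector_derivative v) (at 0 within {0..1})"
    using assms(1) unfolding tangent_cone_def by blast
  have "(\<phi> has_derivative L) (at (c 0) within c ` {0..1})"
    using assms(2) c by (metis has_derivative_subset image_subsetI)
  from vector_derivative_diff_chain_within[OF c(3) this] that c show ?thesis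
    by (simp add: o_def)
qed

lemma at_0_within_unit_interval: "at 0 within {0..1::real} \<noteq> bot"
  by (simp add: at_within_Icc_at_right)

text \<open>First-order condition: a function that is minimal on \<open>M\<close> at \<open>p\<close> does not decrease along
  curves issuing from \<open>p\<close>.\<close>
lemma tangent_cone_derivative_nonneg:
  fixes \<phi> :: "'a::real_normed_vector \<Rightarrow> real"
  assumes v: "v \<in> tangent_cone M p" and D: "(\<phi> has_derivative L) (at p within M)"
    and min: "\<And>x. x \<in> M \<Longrightarrow> \<phi> p \<le> \<phi> x"
  shows "0 \<le> L v"
proof -
  obtain c where c: "c 0 = p" "\<forall>s\<in>{0..1::real}. c s \<in> M"
      "((\<lambda>s. \<phi> (c s)) has_vector_derivative L v) (at 0 within {0..1})"
    using tangent_cone_chain[OF v D] .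
  have "((\<lambda>s. (\<phi> (c s) - \<phi> (c 0)) / (s - 0)) \<longlongrightarrow> L v) (at 0 within {0..1})"
    using c(3) by (simp add: has_real_derivative_iff_has_vector_derivative[symmetric]
        has_field_derivative_iff)
  moreover have "\<forall>\<^sub>F s in at 0 within {0..1}. 0 \<le> (\<phi> (c s) - \<phi> (c 0)) / (s - 0)"
    unfolding eventually_at_filter by (rule always_eventually) (use c min in auto)
  ultimately show ?thesis
    using tendsto_lowerbound at_0_within_unit_interval by blast
qed

lemma tangent_cone_derivative_zero:
  fixes \<phi> :: "'a::real_normed_vector \<Rightarrow> real"
  assumes v: "v \<in> tangent_cone M p" and D: "(\<phi> has_derivative L) (at p within M)"
    and const: "\<And>x. x \<in> M \<Longrightarrow> \<phi> x = \<phi> p"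
  shows "L v = 0"
proof -
  have "0 \<le> L v"
    by (rule tangent_cone_derivative_nonneg[OF v D]) (simp add: const)
  moreover have "0 \<le> - L v"
    by (rule tangent_cone_derivative_nonneg[OF v has_derivative_minus[OF D]]) (simp add: const)
  ultimately show ?thesis by simp
qed

text \<open>A conormal pointing out of \<open>M\<close> is only the negative of the velocity of a curve in \<open>M\<close>, hence
  the disjunction; linearity of the derivative transports uniqueness from \<open>- X\<close> to \<open>X\<close>.\<close>
lemma deriv_along_eq:
  assumes L: "(V has_derivative L) (at p within M)"
    and X: "X \<in> tangent_cone M p \<or> - X \<in> tangent_cone M p"
  shows "deriv_along M V p X = L X"
proof -
  have uniq: "L' v = L v" if L': "(V has_derivative L') (at p within M)" and v: "v \<in> tangent_cone M p" for L' v
  proof -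
    obtain c where c: "c 0 = p" "\<forall>s\<in>{0..1::real}. c s \<in> M"
        "(c has_vector_derivative v) (at 0 within {0..1})"
      using v unfolding tangent_cone_def by blast
    have "((V \<circ> c) has_vector_derivative K v) (at 0 within {0..1})"
      if "(V has_derivative K) (at p within M)" for K
    proof (rule vector_derivative_diff_chain_within[OF c(3)])
      show "(V has_derivative K) (at (c 0) within c ` {0..1})"
        using that c by (metis has_derivative_subset image_subsetI)
    qed
    from vector_derivative_unique_within[OF at_0_within_unit_interval this[OF L'] this[OF L]]
    show ?thesis .
  qed
  have "L' X = L X" if "(V has_derivative L') (at p within M)" for L'
  proof (cases "X \<in> tangent_cone M p")
    case True then show ?thesis using uniq[OF that] by blast
  next
    case False
    then have "L' (- X) = L (- X)" using uniq[OF that] X by blast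
    then show ?thesis
      using that L by (simp add: linear_neg has_derivative_linear)
  qed
  then show ?thesis
    unfolding deriv_along_def using L by (intro the_equality) metis+
qed

lemma pd_open:
  assumes "(F has_derivative L) (at q)" and "open D" and "q \<in> D"
  shows "pd D i F q = L (axis i 1)"
proof -
  let ?S = "{s. q + s *\<^sub>R axis i 1 \<in> D}"
  have "?S = (\<lambda>s. q + s *\<^sub>R axis i 1) -` D" by auto
  then have "open ?S"
    using \<open>open D\<close> by (simp add: open_vimage continuous_intros)
  moreover have "0 \<in> ?S" using \<open>q \<in> D\<close> by simp
  ultimately have at: "at 0 within ?S = at 0" by (rule at_within_open[rotated])
  have "((\<lambda>s. q + s *\<^sub>R axis i 1) has_vector_derivative axis i 1) (at 0)"
    by (auto intro!: derivative_eq_intros)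
  from vector_derivative_diff_chain_within[OF this, of F L] assms(1)
  have "((\<lambda>s. F (q + s *\<^sub>R axis i 1)) has_vector_derivative L (axis i 1)) (at 0)"
    by (simp add: o_def has_derivative_at_withinI)
  then show ?thesis unfolding pd_def at by (rule vector_derivative_at)
qed

section \<open>The Levi-Civita connection of the half-space\<close>

lemma inner_real3: "(u::real^3) \<bullet> v = u$1 * v$1 + u$2 * v$2 + u$3 * v$3"
  by (simp add: inner_vec_def sum_3)

lemma vec3_eq_iff: "(u::real^3) = v \<longleftrightarrow> u$1 = v$1 \<and> u$2 = v$2 \<and> u$3 = v$3"
  by (simp add: vec_eq_iff forall_3)

lemma axis_3_nth [simp]:
  "(axis 1 1 :: real^3) $ 1 = 1" "(axis 1 1 :: real^3) $ 2 = 0" "(axis 1 1 :: real^3) $ 3 = 0"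
  "(axis 2 1 :: real^3) $ 1 = 0" "(axis 2 1 :: real^3) $ 2 = 1" "(axis 2 1 :: real^3) $ 3 = 0"
  "(axis 3 1 :: real^3) $ 1 = 0" "(axis 3 1 :: real^3) $ 2 = 0" "(axis 3 1 :: real^3) $ 3 = 1"
  by (simp_all add: axis_def)

lemma has_derivative_vec_nth: "((\<lambda>x. x $ i) has_derivative (\<lambda>v. v $ i)) F"
  by (rule bounded_linear_imp_has_derivative[OF bounded_linear_vec_nth])

lemma has_derivative_inner_self:
  "((\<lambda>x. x \<bullet> x) has_derivative (\<lambda>v. 2 * (p \<bullet> v))) (at (p::real^3) within M)"
  by (auto intro!: derivative_eq_intros simp: inner_commute)

lemma matrix_inv_eqI:
  fixes A B :: "real^'n^'n"
  assumes "A ** B = mat 1"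
  shows "matrix_inv A = B"
proof -
  have BA: "B ** A = mat 1" using assms by (simp add: matrix_left_right_inverse)
  have "A ** matrix_inv A = mat 1 \<and> matrix_inv A ** A = mat 1"
    unfolding matrix_inv_def by (rule someI) (use assms BA in blast)
  then have "B ** (A ** matrix_inv A) = B" by simp
  then show ?thesis by (simp add: matrix_mul_assoc BA)
qed

lemma metric_matrix_nth: "metric_matrix p $ i $ j = (if i = j then 1 / (p$3)\<^sup>2 else 0)"
  by (auto simp: metric_matrix_def hyp_inner_def inner_axis_axis)

lemma matrix_inv_metric_matrix:
  assumes "p \<in> H3"
  shows "matrix_inv (metric_matrix p) = mat ((p$3)\<^sup>2)"
  by (rule matrix_inv_eqI)
     (use assms in \<open>simp add: matrix_matrix_mult_def mat_def vec_eq_iff forall_3 sum_3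
        metric_matrix_nth H3_def\<close>)

lemma pd_metric_matrix:
  assumes "p \<in> H3"
  shows "pd H3 i (\<lambda>x. metric_matrix x $ j $ l) p = - 2 / (p$3)^3 * (if j = l \<and> i = 3 then 1 else 0)"
proof -
  have p: "p$3 > 0" using assms by (simp add: H3_def)
  have "open H3" unfolding H3_def by (intro open_Collect_less continuous_intros)
  have "((\<lambda>y. 1 / y\<^sup>2) has_field_derivative - 2 / (p$3)^3) (at (p$3))"
    using p by (auto intro!: derivative_eq_intros simp: divide_simps power2_eq_square power3_eq_cube)
  from DERIV_compose_FDERIV[OF this has_derivative_vec_nth]
  have "((\<lambda>x. 1 / (x$3)\<^sup>2) has_derivative (\<lambda>v. v$3 * (- 2 / (p$3)^3))) (at p)" .
  then have "((\<lambda>x. metric_matrix x $ j $ l) has_derivative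
      (\<lambda>v. if j = l then v$3 * (- 2 / (p$3)^3) else 0)) (at p)"
    unfolding metric_matrix_nth by (cases "j = l") auto
  from pd_open[OF this \<open>open H3\<close> assms] show ?thesis
    by (simp add: axis_def)
qed

lemma christoffel_H3:
  assumes "p \<in> H3"
  shows "christoffel p k i j = - ((if j = k \<and> i = 3 then 1 else 0) + (if i = k \<and> j = 3 then 1 else 0)
     - (if i = j \<and> k = 3 then 1 else 0)) / p$3"
proof -
  have p: "p$3 > 0" using assms by (simp add: H3_def)
  have *: "(\<Sum>l\<in>UNIV. mat a $ k $ l * f l) = a * f k" for a :: real and k :: 3 and f
    by (simp add: mat_def if_distrib[of "\<lambda>x. x * _"] cong: if_cong)
  have **: "1/2 * ((p$3)\<^sup>2 * (- 2 / (p$3)^3 * A + - 2 / (p$3)^3 * B - - 2 / (p$3)^3 * C))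
      = - (A + B - C) / p$3" for A B C
    using p by (simp add: field_simps power2_eq_square power3_eq_cube)
  show ?thesis
    unfolding christoffel_def matrix_inv_metric_matrix[OF assms] pd_metric_matrix[OF assms] * **
    by simp
qed

text \<open>The correction term of a metric conformal to the Euclidean one. For a normal field \<open>V\<close> and a
  tangent vector \<open>X\<close> the summand with \<open>X \<bullet> V\<close> drops out.\<close>
lemma cov_deriv_H3:
  assumes "p \<in> H3"
  shows "cov_deriv M V p X = deriv_along M V p X
     - (1 / p$3) *\<^sub>R (V p $ 3 *\<^sub>R X + X $ 3 *\<^sub>R V p - (X \<bullet> V p) *\<^sub>R axis 3 1)"
proof -
  have "(\<chi> k. \<Sum>i\<in>UNIV. \<Sum>j\<in>UNIV. christoffel p k i j * X $ i * V p $ j)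
      = - ((1 / p$3) *\<^sub>R (V p $ 3 *\<^sub>R X + X $ 3 *\<^sub>R V p - (X \<bullet> V p) *\<^sub>R axis 3 1))"
    unfolding christoffel_H3[OF assms]
    by (simp add: vec3_eq_iff sum_3 inner_real3 axis_def field_simps)
  then show ?thesis unfolding cov_deriv_def by simp
qed

section \<open>Partial derivatives in the parameter plane\<close>

text \<open>Used for the identity and for \<open>rotation\<close>: the derivatives of a function on the cylinder in \<open>t\<close>
  and \<open>\<theta>\<close> are its derivatives along these two linear fields, so this gives the existence of second
  derivatives in the coordinates.\<close>
lemma has_derivative_linear_field:
  fixes f :: "real^3 \<Rightarrow> real" and A :: "real^3 \<Rightarrow> real^3"
  assumes f: "\<forall>k. Ck_on k X f" and "open X" and A: "linear A"
  shows "(\<lambda>p. frechet_derivative f (at p) (A p)) differentiable_on X"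
proof -
  have f1: "f differentiable_on X"
    and f2: "(\<lambda>p. frechet_derivative f (at p) v) differentiable_on X" for v
    using f[rule_format, of "Suc (Suc 0)"] by simp_all
  have eq: "frechet_derivative f (at p) (A p)
      = (\<Sum>i\<in>UNIV. A p $ i * frechet_derivative f (at p) (axis i 1))" if "p \<in> X" for p
  proof -
    let ?D = "frechet_derivative f (at p)"
    have "f differentiable (at p)"
      using f1 that \<open>open X\<close> by (metis differentiable_on_def at_within_open)
    then have D: "linear ?D" by (rule linear_frechet_derivative)
    have "A p = A p $ 1 *\<^sub>R axis 1 1 + A p $ 2 *\<^sub>R axis 2 1 + A p $ 3 *\<^sub>R axis 3 1"
      by (simp add: vec3_eq_iff)
    then have "?D (A p) = ?D (A p $ 1 *\<^sub>R axis 1 1 + A p $ 2 *\<^sub>R axis 2 1 + A p $ 3 *\<^sub>R axis 3 1)"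
      by simp
    then show ?thesis
      by (simp only: sum_3 linear_add[OF D] linear_scale[OF D] real_scaleR_def)
  qed
  have "(\<lambda>p. A p $ i) differentiable_on X" for i
    using linear_imp_differentiable_on[OF linear_compose[OF A bounded_linear.linear[OF bounded_linear_vec_nth]]]
    by (simp add: o_def)
  then have "(\<lambda>p. \<Sum>i\<in>UNIV. A p $ i * frechet_derivative f (at p) (axis i 1)) differentiable_on X"
    unfolding sum_3 by (intro differentiable_on_add differentiable_on_mult f2)
  then have "(\<lambda>p. \<Sum>i\<in>UNIV. A p $ i * frechet_derivative f (at p) (axis i 1)) differentiable (at p within X)"
    if "p \<in> X" for p
    using that unfolding differentiable_on_def by blast
  then have "(\<lambda>p. frechet_derivative f (at p) (A p)) differentiable (at p within X)" if "p \<in> X" for p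
    by (rule differentiable_transform_within[OF _ zero_less_one that]) (use that in \<open>simp_all only: eq\<close>)
  then show ?thesis
    unfolding differentiable_on_def by blast
qed

lemma vec2_eta: "vector [q$1, q$2] = (q::real^2)"
  by (simp add: vec_eq_iff forall_2)

lemma pd_strip_1:
  assumes "t \<in> I" and "t islimpt I"
    and D: "((\<lambda>t. F (vector [t, \<theta>])) has_vector_derivative w) (at t within I)"
  shows "pd (strip I) 1 F (vector [t, \<theta>]) = w"
proof -
  let ?S = "{s. t + s \<in> I}"
  have at: "at 0 within ?S \<noteq> bot"
    unfolding trivial_limit_within islimpt_approachable_real not_not
  proof (intro allI impI)
    fix e :: real assume "e > 0"
    then obtain x where "x \<in> I" "x \<noteq> t" "\<bar>x - t\<bar> < e"
      using assms(2) unfolding islimpt_approachable_real by blast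
    then show "\<exists>x'\<in>?S. x' \<noteq> 0 \<and> \<bar>x' - 0\<bar> < e" by (intro bexI[of _ "x - t"]) auto
  qed
  have "((\<lambda>s. t + s) has_vector_derivative 1) (at 0 within ?S)"
    by (auto intro!: derivative_eq_intros)
  moreover have "((\<lambda>t. F (vector [t, \<theta>])) has_derivative (\<lambda>x. x *\<^sub>R w)) (at (t + 0) within (\<lambda>s. t + s) ` ?S)"
    by (rule has_derivative_subset[where s = I]) (use D in \<open>auto simp: has_vector_derivative_def\<close>)
  ultimately have "(((\<lambda>t. F (vector [t, \<theta>])) \<circ> (\<lambda>s. t + s)) has_vector_derivative 1 *\<^sub>R w) (at 0 within ?S)"
    by (rule vector_derivative_diff_chain_within)
  moreover have "vector [t, \<theta>] + s *\<^sub>R axis 1 1 = (vector [t + s, \<theta>] :: real^2)" for s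
    by (simp add: vec_eq_iff forall_2 axis_def)
  ultimately show ?thesis
    unfolding pd_def using vector_derivative_within[OF at] by (simp add: o_def strip_def)
qed

lemma pd_strip_2:
  assumes "t \<in> I" and D: "((\<lambda>\<theta>. F (vector [t, \<theta>])) has_vector_derivative w) (at \<theta>)"
  shows "pd (strip I) 2 F (vector [t, \<theta>]) = w"
proof -
  have "((\<lambda>s. \<theta> + s) has_vector_derivative 1) (at 0)"
    by (auto intro!: derivative_eq_intros)
  moreover have "((\<lambda>\<theta>. F (vector [t, \<theta>])) has_derivative (\<lambda>x. x *\<^sub>R w)) (at (\<theta> + 0) within (\<lambda>s. \<theta> + s) ` UNIV)"
    by (rule has_derivative_at_withinI) (use D in \<open>auto simp: has_vector_derivative_def\<close>)
  ultimately have "(((\<lambda>\<theta>. F (vector [t, \<theta>])) \<circ> (\<lambda>s. \<theta> + s)) has_vector_derivative 1 *\<^sub>R w) (at 0)"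
    by (rule vector_derivative_diff_chain_within)
  moreover have "vector [t, \<theta>] + s *\<^sub>R axis 2 1 = (vector [t, \<theta> + s] :: real^2)" for s
    by (simp add: vec_eq_iff forall_2 axis_def)
  ultimately show ?thesis
    unfolding pd_def using \<open>t \<in> I\<close> vector_derivative_at by (simp add: o_def strip_def)
qed

lemma islimpt_closed_interval: "T > 0 \<Longrightarrow> t \<in> {0..T} \<Longrightarrow> t islimpt {0..T::real}"
  by (intro connected_imp_perfect) auto

section \<open>Two uniqueness principles\<close>

lemma mono_of_derivative_nonneg_within:
  fixes g :: "real \<Rightarrow> real"
  assumes "x \<in> {a..b}" "y \<in> {a..b}" "x \<le> y"
    and D: "\<And>t. t \<in> {a..b} \<Longrightarrow> (g has_real_derivative g' t) (at t within {a..b})"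
    and nonneg: "\<And>t. t \<in> {a..b} \<Longrightarrow> 0 \<le> g' t"
  shows "g x \<le> g y"
proof (cases "x = y")
  case False
  then have "x < y" using assms by simp
  moreover have "(g has_derivative (*) (g' t)) (at t within {x..y})" if "x \<le> t" "t \<le> y" for t
    using DERIV_subset[OF D[of t], of "{x..y}"] that assms by (auto simp: has_field_derivative_def)
  ultimately obtain z where "z \<in> {x<..<y}" "g y - g x = g' z * (y - x)"
    using mvt_simple[of x y g "\<lambda>t. (*) (g' t)"] by blast
  moreover have "0 \<le> g' z * (y - x)"
    using \<open>z \<in> {x<..<y}\<close> assms nonneg[of z] by (intro mult_nonneg_nonneg) auto
  ultimately show ?thesis by simp
qed simp

text \<open>The left endpoint is included: there the hypothesis \<open>f' x = 0\<close> is a Neumann condition, and a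
  positive second derivative would still make \<open>f\<close> increase to the right.\<close>
lemma second_derivative_nonpos_at_max:
  fixes f f' :: "real \<Rightarrow> real"
  assumes x: "a \<le> x" "x < b"
    and D: "\<And>y. y \<in> {a..b} \<Longrightarrow> (f has_real_derivative f' y) (at y within {a..b})"
    and crit: "f' x = 0" and D2: "(f' has_real_derivative d) (at x within {a..b})"
    and max: "\<And>y. y \<in> {a..b} \<Longrightarrow> f y \<le> f x"
  shows "d \<le> 0"
proof (rule ccontr)
  assume "\<not> d \<le> 0"
  then obtain e where e: "e > 0" "\<And>h. h > 0 \<Longrightarrow> x + h \<in> {a..b} \<Longrightarrow> h < e \<Longrightarrow> f' x < f' (x + h)"
    using has_real_derivative_pos_inc_right[OF D2] by auto
  define y where "y = min (x + e / 2) b"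
  have y: "x < y" "y \<le> b" "y < x + e" using x e(1) by (auto simp: y_def)
  have "(f has_derivative (*) (f' t)) (at t within {x..y})" if "x \<le> t" "t \<le> y" for t
    using DERIV_subset[OF D[of t], of "{x..y}"] that x y by (auto simp: has_field_derivative_def)
  then obtain z where z: "z \<in> {x<..<y}" "f y - f x = f' z * (y - x)"
    using mvt_simple[OF y(1), of f "\<lambda>t. (*) (f' t)"] by blast
  have "f' z > 0" using e(2)[of "z - x"] z(1) x y crit by simp
  then have "f y > f x" using z y by (metis diff_gt_0_iff_gt mult_pos_pos)
  then show False using max[of y] x y by auto
qed

lemma derivative_zero_at_interior_max:
  fixes f :: "real \<Rightarrow> real"
  assumes x: "a < x" "x < b" and D: "(f has_real_derivative d) (at x within {a..b})"
    and max: "\<And>y. y \<in> {a..b} \<Longrightarrow> f y \<le> f x"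
  shows "d = 0"
proof (rule DERIV_local_max)
  show "(f has_real_derivative d) (at x)" using D x by (simp add: at_within_Icc_at)
  show "0 < min (x - a) (b - x)" using x by simp
  show "\<forall>y. \<bar>x - y\<bar> < min (x - a) (b - x) \<longrightarrow> f y \<le> f x"
    using max by (auto simp: abs_if split: if_splits)
qed

text \<open>At a positive maximum of the quotient \<open>V / \<phi>\<close>, with value \<open>M\<close>, the function \<open>V - M \<phi>\<close> has a maximum
  with value 0, so its pure second derivatives are nonpositive and the equation for \<open>V\<close> contradicts
  the strict inequality for \<open>\<phi>\<close>. Dividing by \<open>\<phi>\<close> is what allows the coefficient \<open>\<kappa>\<close> to be positive.\<close>
lemma maximum_principle:
  fixes V Vt Vtt W WW :: "real \<Rightarrow> real \<Rightarrow> real" and \<phi> \<phi>' \<phi>'' :: "real \<Rightarrow> real"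
  assumes "A > 0" "B > 0"
    and cont: "continuous_on ({0..T} \<times> {a..b}) (\<lambda>(t, \<theta>). V t \<theta>)"
    and Vt: "\<And>t \<theta>. t \<in> {0..T} \<Longrightarrow> \<theta> \<in> {a..b} \<Longrightarrow> ((\<lambda>t. V t \<theta>) has_real_derivative Vt t \<theta>) (at t within {0..T})"
    and Vtt: "\<And>t \<theta>. t \<in> {0..T} \<Longrightarrow> \<theta> \<in> {a..b} \<Longrightarrow> ((\<lambda>t. Vt t \<theta>) has_real_derivative Vtt t \<theta>) (at t within {0..T})"
    and W: "\<And>t \<theta>. t \<in> {0..T} \<Longrightarrow> \<theta> \<in> {a..b} \<Longrightarrow> (V t has_real_derivative W t \<theta>) (at \<theta>)"
    and WW: "\<And>t \<theta>. t \<in> {0..T} \<Longrightarrow> \<theta> \<in> {a..b} \<Longrightarrow> (W t has_real_derivative WW t \<theta>) (at \<theta>)"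
    and eq: "\<And>t \<theta>. t \<in> {0..T} \<Longrightarrow> \<theta> \<in> {a..b} \<Longrightarrow> A * Vtt t \<theta> + B * WW t \<theta> + \<kappa> * V t \<theta> = 0"
    and neumann: "\<And>\<theta>. \<theta> \<in> {a..b} \<Longrightarrow> Vt 0 \<theta> = 0"
    and dirichlet: "\<And>\<theta>. \<theta> \<in> {a..b} \<Longrightarrow> V T \<theta> \<le> 0"
      "\<And>t. t \<in> {0..T} \<Longrightarrow> V t a \<le> 0" "\<And>t. t \<in> {0..T} \<Longrightarrow> V t b \<le> 0"
    and \<phi>: "\<And>\<theta>. \<theta> \<in> {a..b} \<Longrightarrow> \<phi> \<theta> > 0"
      "\<And>\<theta>. (\<phi> has_real_derivative \<phi>' \<theta>) (at \<theta>)" "\<And>\<theta>. (\<phi>' has_real_derivative \<phi>'' \<theta>) (at \<theta>)"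
    and super: "\<And>\<theta>. \<theta> \<in> {a..b} \<Longrightarrow> B * \<phi>'' \<theta> + \<kappa> * \<phi> \<theta> < 0"
    and t: "t \<in> {0..T}" "\<theta> \<in> {a..b}"
  shows "V t \<theta> \<le> 0"
proof (rule ccontr)
  assume pos: "\<not> V t \<theta> \<le> 0"
  let ?K = "{0..T} \<times> {a..b}"
  have "continuous_on UNIV \<phi>"
    by (intro continuous_at_imp_continuous_on ballI DERIV_isCont[OF \<phi>(2)])
  then have "continuous_on ?K (\<lambda>x. \<phi> (snd x))"
    by (rule continuous_on_compose2) (auto intro: continuous_intros)
  with cont[unfolded case_prod_beta] have "continuous_on ?K (\<lambda>x. V (fst x) (snd x) / \<phi> (snd x))"
  proof (rule continuous_on_divide)
    show "\<forall>x\<in>?K. \<phi> (snd x) \<noteq> 0"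
    proof
      fix x assume "x \<in> ?K"
      then have "snd x \<in> {a..b}" by (simp add: mem_Times_iff)
      then show "\<phi> (snd x) \<noteq> 0" using \<phi>(1) by (metis less_irrefl)
    qed
  qed
  moreover have "compact ?K" by (intro compact_Times compact_Icc)
  moreover have "?K \<noteq> {}" using t by blast
  ultimately obtain x where x: "x \<in> ?K"
      "\<And>y. y \<in> ?K \<Longrightarrow> V (fst y) (snd y) / \<phi> (snd y) \<le> V (fst x) (snd x) / \<phi> (snd x)"
    by (meson continuous_attains_sup)
  define t0 \<theta>0 M where "t0 = fst x" and "\<theta>0 = snd x" and "M = V (fst x) (snd x) / \<phi> (snd x)"
  have tt: "t0 \<in> {0..T}" and \<theta>\<theta>: "\<theta>0 \<in> {a..b}" using x(1) by (auto simp: t0_def \<theta>0_def)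
  have le: "V t' \<theta>' \<le> M * \<phi> \<theta>'" if "t' \<in> {0..T}" "\<theta>' \<in> {a..b}" for t' \<theta>'
    using x(2)[of "(t', \<theta>')"] that \<phi>(1)[OF that(2)] by (simp add: M_def divide_le_eq)
  have M: "V t0 \<theta>0 = M * \<phi> \<theta>0" using \<phi>(1)[OF \<theta>\<theta>] by (simp add: M_def t0_def \<theta>0_def)
  have "M * \<phi> \<theta> > 0" using le[OF t] pos by linarith
  then have "M > 0" using \<phi>(1)[OF t(2)] by (simp add: zero_less_mult_iff)
  then have V0: "V t0 \<theta>0 > 0" using M \<phi>(1)[OF \<theta>\<theta>] by simp
  then have "t0 \<noteq> T" "\<theta>0 \<noteq> a" "\<theta>0 \<noteq> b"
    using dirichlet(1)[OF \<theta>\<theta>] dirichlet(2,3)[OF tt] by auto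
  then have int: "0 \<le> t0" "t0 < T" "a < \<theta>0" "\<theta>0 < b" using tt \<theta>\<theta> by auto
  have max: "V y \<theta>0 \<le> V t0 \<theta>0" if "y \<in> {0..T}" for y
    using le[OF that \<theta>\<theta>] M by simp
  have "Vt t0 \<theta>0 = 0"
  proof (cases "t0 = 0")
    case True then show ?thesis using neumann[OF \<theta>\<theta>] by simp
  next
    case False
    then have "0 < t0" using int by simp
    then show ?thesis
      by (rule derivative_zero_at_interior_max[OF _ int(2) Vt[OF tt \<theta>\<theta>] max])
  qed
  from second_derivative_nonpos_at_max[OF int(1,2) Vt[OF _ \<theta>\<theta>] this Vtt[OF tt \<theta>\<theta>] max]
  have 1: "Vtt t0 \<theta>0 \<le> 0" .
  define h where "h = (\<lambda>\<theta>. V t0 \<theta> - M * \<phi> \<theta>)"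
  define h' where "h' = (\<lambda>\<theta>. W t0 \<theta> - M * \<phi>' \<theta>)"
  have h1: "(h has_real_derivative h' y) (at y within {a..b})" if "y \<in> {a..b}" for y
    unfolding h_def h'_def using has_field_derivative_at_within[OF W[OF tt that]] has_field_derivative_at_within[OF \<phi>(2)]
    by (intro DERIV_diff DERIV_cmult)
  have h2: "(h' has_real_derivative (WW t0 \<theta>0 - M * \<phi>'' \<theta>0)) (at \<theta>0 within {a..b})"
    unfolding h'_def using has_field_derivative_at_within[OF WW[OF tt \<theta>\<theta>]] has_field_derivative_at_within[OF \<phi>(3)]
    by (intro DERIV_diff DERIV_cmult)
  have hmax: "h y \<le> h \<theta>0" if "y \<in> {a..b}" for y
    using le[OF tt that] M by (simp add: h_def)
  have "h' \<theta>0 = 0" using derivative_zero_at_interior_max[OF int(3,4) h1[OF \<theta>\<theta>] hmax] .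
  then have 2: "WW t0 \<theta>0 \<le> M * \<phi>'' \<theta>0"
    using second_derivative_nonpos_at_max[OF less_imp_le[OF int(3)] int(4) h1 _ h2 hmax] by simp
  have "A * Vtt t0 \<theta>0 \<le> 0" using 1 \<open>A > 0\<close> by (simp add: mult_le_0_iff)
  moreover have "B * WW t0 \<theta>0 \<le> B * (M * \<phi>'' \<theta>0)" using 2 \<open>B > 0\<close> by simp
  moreover have "B * (M * \<phi>'' \<theta>0) + \<kappa> * (M * \<phi> \<theta>0) < 0"
  proof -
    have "M * (B * \<phi>'' \<theta>0 + \<kappa> * \<phi> \<theta>0) < 0" using super[OF \<theta>\<theta>] \<open>M > 0\<close> by (simp add: mult_pos_neg)
    then show ?thesis by (simp add: algebra_simps)
  qed
  ultimately show False using eq[OF tt \<theta>\<theta>] M by simp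
qed

text \<open>The difference of \<open>U\<close> and its reflection vanishes on the axis of reflection, and by periodicity
  also at distance \<open>\<pi>\<close> from it. The comparison function has frequency \<open>k < 1\<close> in order to be positive
  on the closed half-period.\<close>
lemma reflection_symmetric_solution:
  fixes U U1 U11 U2 U22 :: "real \<Rightarrow> real \<Rightarrow> real"
  assumes AB: "A > 0" "B > 0" and k: "0 < k" "k < 1" "\<kappa> < B * k\<^sup>2"
    and cont: "continuous_on ({0..T} \<times> UNIV) (\<lambda>(t, \<theta>). U t \<theta>)"
    and U1: "\<And>t \<theta>. t \<in> {0..T} \<Longrightarrow> ((\<lambda>t. U t \<theta>) has_real_derivative U1 t \<theta>) (at t within {0..T})"
    and U11: "\<And>t \<theta>. t \<in> {0..T} \<Longrightarrow> ((\<lambda>t. U1 t \<theta>) has_real_derivative U11 t \<theta>) (at t within {0..T})"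
    and U2: "\<And>t \<theta>. t \<in> {0..T} \<Longrightarrow> (U t has_real_derivative U2 t \<theta>) (at \<theta>)"
    and U22: "\<And>t \<theta>. t \<in> {0..T} \<Longrightarrow> (U2 t has_real_derivative U22 t \<theta>) (at \<theta>)"
    and eq: "\<And>t \<theta>. t \<in> {0..T} \<Longrightarrow> A * U11 t \<theta> + B * U22 t \<theta> + \<kappa> * U t \<theta> = 0"
    and neumann: "\<And>\<theta>. U1 0 \<theta> = 0" and dirichlet: "\<And>\<theta>. U T \<theta> = 0"
    and periodic: "\<And>t \<theta>. U t (\<theta> + 2 * pi) = U t \<theta>"
    and t: "t \<in> {0..T}" "\<theta> \<in> {\<alpha>..\<alpha> + pi}"
  shows "U t \<theta> \<le> U t (2 * \<alpha> - \<theta>)"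
proof -
  let ?V = "\<lambda>t \<theta>. U t \<theta> - U t (2 * \<alpha> - \<theta>)"
  let ?\<phi> = "\<lambda>\<theta>. cos (k * (\<theta> - \<alpha> - pi / 2))"
  have refl: "((\<lambda>\<theta>. f (2 * \<alpha> - \<theta>)) has_real_derivative - d) (at \<theta>)"
    if "(f has_real_derivative d) (at (2 * \<alpha> - \<theta>))" for f d \<theta>
  proof -
    have "((\<lambda>\<theta>. 2 * \<alpha> - \<theta>) has_real_derivative - 1) (at \<theta>)"
      by (auto intro!: derivative_eq_intros)
    from DERIV_chain2[OF that this] show ?thesis by simp
  qed
  have \<phi>pos: "?\<phi> \<theta> > 0" if "\<theta> \<in> {\<alpha>..\<alpha> + pi}" for \<theta>
  proof -
    have "\<bar>\<theta> - \<alpha> - pi / 2\<bar> \<le> pi / 2" using that unfolding atLeastAtMost_iff by linarith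
    then have "\<bar>k * (\<theta> - \<alpha> - pi / 2)\<bar> \<le> k * (pi / 2)"
      unfolding abs_mult using k by (intro mult_mono) auto
    also have "\<dots> < pi / 2" using k by simp
    finally show ?thesis by (intro cos_gt_zero_pi) auto
  qed
  have "?V t \<theta> \<le> 0"
  proof (rule maximum_principle[where V = ?V and \<phi> = ?\<phi> and \<kappa> = \<kappa> and T = T and A = A and B = B
        and Vt = "\<lambda>t \<theta>. U1 t \<theta> - U1 t (2 * \<alpha> - \<theta>)" and Vtt = "\<lambda>t \<theta>. U11 t \<theta> - U11 t (2 * \<alpha> - \<theta>)"
        and W = "\<lambda>t \<theta>. U2 t \<theta> + U2 t (2 * \<alpha> - \<theta>)" and WW = "\<lambda>t \<theta>. U22 t \<theta> - U22 t (2 * \<alpha> - \<theta>)"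
        and \<phi>' = "\<lambda>\<theta>. - k * sin (k * (\<theta> - \<alpha> - pi / 2))" and \<phi>'' = "\<lambda>\<theta>. - k\<^sup>2 * cos (k * (\<theta> - \<alpha> - pi / 2))"
        and a = \<alpha> and b = "\<alpha> + pi"])
    show "continuous_on ({0..T} \<times> {\<alpha>..\<alpha> + pi}) (\<lambda>(t, \<theta>). ?V t \<theta>)"
    proof -
      have c: "continuous_on ({0..T} \<times> UNIV) (\<lambda>x. U (fst x) (snd x))" using cont by (simp add: case_prod_beta)
      have "continuous_on ({0..T} \<times> {\<alpha>..\<alpha> + pi}) (\<lambda>x. U (fst (fst x, 2 * \<alpha> - snd x)) (snd (fst x, 2 * \<alpha> - snd x)))"
        by (rule continuous_on_compose2[OF c]) (auto intro!: continuous_intros)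
      moreover have "continuous_on ({0..T} \<times> {\<alpha>..\<alpha> + pi}) (\<lambda>x. U (fst x) (snd x))"
        by (rule continuous_on_subset[OF c]) auto
      ultimately show ?thesis by (simp add: case_prod_beta continuous_on_diff)
    qed
    fix t \<theta> assume t: "t \<in> {0..T}"
    show "((\<lambda>t. ?V t \<theta>) has_real_derivative U1 t \<theta> - U1 t (2 * \<alpha> - \<theta>)) (at t within {0..T})"
      by (intro DERIV_diff U1 t)
    show "((\<lambda>t. U1 t \<theta> - U1 t (2 * \<alpha> - \<theta>)) has_real_derivative U11 t \<theta> - U11 t (2 * \<alpha> - \<theta>)) (at t within {0..T})"
      by (intro DERIV_diff U11 t)
    show "(?V t has_real_derivative U2 t \<theta> + U2 t (2 * \<alpha> - \<theta>)) (at \<theta>)"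
      using DERIV_diff[OF U2[OF t] refl[OF U2[OF t]]] by simp
    show "((\<lambda>\<theta>. U2 t \<theta> + U2 t (2 * \<alpha> - \<theta>)) has_real_derivative U22 t \<theta> - U22 t (2 * \<alpha> - \<theta>)) (at \<theta>)"
      using DERIV_add[OF U22[OF t] refl[OF U22[OF t]]] by simp
    show "A * (U11 t \<theta> - U11 t (2 * \<alpha> - \<theta>)) + B * (U22 t \<theta> - U22 t (2 * \<alpha> - \<theta>)) + \<kappa> * ?V t \<theta> = 0"
      using eq[OF t, of \<theta>] eq[OF t, of "2 * \<alpha> - \<theta>"] by (simp add: algebra_simps)
    show "?V t \<alpha> \<le> 0" by simp
    show "?V t (\<alpha> + pi) \<le> 0" using periodic[of t "\<alpha> - pi"] by (simp add: algebra_simps)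
  next
    fix \<theta>
    show "(?\<phi> has_real_derivative - k * sin (k * (\<theta> - \<alpha> - pi / 2))) (at \<theta>)"
      by (auto intro!: derivative_eq_intros)
    show "((\<lambda>\<theta>. - k * sin (k * (\<theta> - \<alpha> - pi / 2))) has_real_derivative - k\<^sup>2 * ?\<phi> \<theta>) (at \<theta>)"
      by (auto intro!: derivative_eq_intros simp: power2_eq_square)
  next
    fix \<theta> assume "\<theta> \<in> {\<alpha>..\<alpha> + pi}"
    from \<phi>pos[OF this] have "(\<kappa> - B * k\<^sup>2) * ?\<phi> \<theta> < 0" using k by (simp add: mult_neg_pos)
    then show "B * (- k\<^sup>2 * ?\<phi> \<theta>) + \<kappa> * ?\<phi> \<theta> < 0" by (simp add: algebra_simps)
  qed (use AB neumann dirichlet \<phi>pos t in auto)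
  then show ?thesis by simp
qed

text \<open>The reflection in \<open>\<theta> / 2\<close> carries \<open>\<theta>\<close> to 0; applying the previous inequality to \<open>U\<close> and to \<open>- U\<close>
  gives equality.\<close>
lemma rotationally_invariant_solution:
  fixes U U1 U11 U2 U22 :: "real \<Rightarrow> real \<Rightarrow> real"
  assumes AB: "A > 0" "B > 0" and k: "0 < k" "k < 1" "\<kappa> < B * k\<^sup>2"
    and cont: "continuous_on ({0..T} \<times> UNIV) (\<lambda>(t, \<theta>). U t \<theta>)"
    and U1: "\<And>t \<theta>. t \<in> {0..T} \<Longrightarrow> ((\<lambda>t. U t \<theta>) has_real_derivative U1 t \<theta>) (at t within {0..T})"
    and U11: "\<And>t \<theta>. t \<in> {0..T} \<Longrightarrow> ((\<lambda>t. U1 t \<theta>) has_real_derivative U11 t \<theta>) (at t within {0..T})"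
    and U2: "\<And>t \<theta>. t \<in> {0..T} \<Longrightarrow> (U t has_real_derivative U2 t \<theta>) (at \<theta>)"
    and U22: "\<And>t \<theta>. t \<in> {0..T} \<Longrightarrow> (U2 t has_real_derivative U22 t \<theta>) (at \<theta>)"
    and eq: "\<And>t \<theta>. t \<in> {0..T} \<Longrightarrow> A * U11 t \<theta> + B * U22 t \<theta> + \<kappa> * U t \<theta> = 0"
    and neumann: "\<And>\<theta>. U1 0 \<theta> = 0" and dirichlet: "\<And>\<theta>. U T \<theta> = 0"
    and periodic: "\<And>t \<theta>. U t (\<theta> + 2 * pi) = U t \<theta>"
    and t: "t \<in> {0..T}" "\<theta> \<in> {0..2 * pi}"
  shows "U t \<theta> = U t 0"
proof -
  have \<theta>: "\<theta> \<in> {\<theta> / 2..\<theta> / 2 + pi}" using t by auto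
  have "U t \<theta> \<le> U t (2 * (\<theta> / 2) - \<theta>)"
    by (rule reflection_symmetric_solution[OF AB k cont U1 U11 U2 U22 eq neumann dirichlet periodic t(1) \<theta>])
  moreover have "- U t \<theta> \<le> - U t (2 * (\<theta> / 2) - \<theta>)"
  proof (rule reflection_symmetric_solution[OF AB k, where U = "\<lambda>t \<theta>. - U t \<theta>" and T = T
        and ?U1.0 = "\<lambda>t \<theta>. - U1 t \<theta>" and ?U11.0 = "\<lambda>t \<theta>. - U11 t \<theta>"
        and ?U2.0 = "\<lambda>t \<theta>. - U2 t \<theta>" and ?U22.0 = "\<lambda>t \<theta>. - U22 t \<theta>"])
    show "continuous_on ({0..T} \<times> UNIV) (\<lambda>(t, \<theta>). - U t \<theta>)"
      using continuous_on_minus[OF cont] by (simp add: case_prod_beta)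
    show "A * - U11 t \<theta> + B * - U22 t \<theta> + \<kappa> * - U t \<theta> = 0" if "t \<in> {0..T}" for t \<theta>
      using eq[OF that, of \<theta>] by (simp add: algebra_simps)
  qed (use t \<theta> neumann dirichlet periodic in \<open>auto intro!: DERIV_minus U1 U11 U2 U22\<close>)
  ultimately show ?thesis by simp
qed

text \<open>For \<open>w \<le> 0\<close> the product \<open>f f'\<close> is nondecreasing and vanishes at both ends, hence \<open>f\<^sup>2\<close> is constant.
  For \<open>w > 0\<close> the energy of the difference between \<open>f\<close> and the expected cosine is conserved, and it
  is 0 at the start.\<close>
lemma neumann_dirichlet_solution:
  fixes f f' :: "real \<Rightarrow> real"
  assumes "T > 0"
    and D: "\<And>t. t \<in> {0..T} \<Longrightarrow> (f has_real_derivative f' t) (at t within {0..T})"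
    and D2: "\<And>t. t \<in> {0..T} \<Longrightarrow> (f' has_real_derivative - w * f t) (at t within {0..T})"
    and "f' 0 = 0" and "f T = 0"
  shows "(\<forall>t\<in>{0..T}. f t = 0) \<or>
    (w > 0 \<and> cos (sqrt w * T) = 0 \<and> (\<forall>t\<in>{0..T}. f t = f 0 * cos (sqrt w * t)))"
proof (cases "w > 0")
  case False
  have D3: "((\<lambda>t. f t * f' t) has_real_derivative (f' t)\<^sup>2 + (- w) * (f t)\<^sup>2) (at t within {0..T})"
    if "t \<in> {0..T}" for t
    using DERIV_mult[OF D[OF that] D2[OF that]] by (simp add: power2_eq_square algebra_simps)
  have nonneg: "0 \<le> (f' t)\<^sup>2 + (- w) * (f t)\<^sup>2" for t using False by (intro add_nonneg_nonneg mult_nonneg_nonneg) auto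
  have zero: "f t * f' t = 0" if "t \<in> {0..T}" for t
  proof -
    have "f 0 * f' 0 \<le> f t * f' t"
      by (rule mono_of_derivative_nonneg_within[OF _ that _ D3 nonneg]) (use that in simp_all)
    moreover have "f t * f' t \<le> f T * f' T"
      by (rule mono_of_derivative_nonneg_within[OF that _ _ D3 nonneg]) (use that in simp_all)
    ultimately show ?thesis using \<open>f' 0 = 0\<close> \<open>f T = 0\<close> by simp
  qed
  have "((\<lambda>t. (f t)\<^sup>2) has_real_derivative 0) (at t within {0..T})" if "t \<in> {0..T}" for t
    using DERIV_power[OF D[OF that], of 2] zero[OF that] by (simp add: mult.commute)
  then have "\<exists>k. \<forall>t\<in>{0..T}. (f t)\<^sup>2 = k"
    by (intro has_field_derivative_zero_constant convex_closed_interval) auto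
  then obtain K where K: "\<forall>t\<in>{0..T}. (f t)\<^sup>2 = K" by blast
  have "T \<in> {0..T}" using \<open>T > 0\<close> by simp
  with K have "(f T)\<^sup>2 = K" by (rule bspec)
  then have "f t = 0" if "t \<in> {0..T}" for t
    using bspec[OF K that] \<open>f T = 0\<close> by simp
  then show ?thesis by blast
next
  case True
  define s where "s = sqrt w"
  have s: "s > 0" "w = s * s" using True by (simp_all add: s_def)
  let ?E = "\<lambda>t. (f' t + f 0 * s * sin (s * t))\<^sup>2 + w * (f t - f 0 * cos (s * t))\<^sup>2"
  have "(?E has_real_derivative 0) (at t within {0..T})" if "t \<in> {0..T}" for t
  proof -
    note [derivative_intros] = D[OF that] D2[OF that]
    show ?thesis
      by (rule derivative_eq_intros refl)+ (simp add: s(2) algebra_simps power2_eq_square)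
  qed
  then have "\<exists>k. \<forall>t\<in>{0..T}. ?E t = k"
    by (intro has_field_derivative_zero_constant convex_closed_interval) auto
  then obtain K where K: "\<forall>t\<in>{0..T}. ?E t = K" by blast
  have "0 \<in> {0..T}" using \<open>T > 0\<close> by simp
  with K have "?E 0 = K" by (rule bspec)
  moreover have "?E 0 = 0" using \<open>f' 0 = 0\<close> by simp
  ultimately have E: "?E t = 0" if "t \<in> {0..T}" for t
    using bspec[OF K that] by (simp only:)
  have sol: "f t = f 0 * cos (s * t)" if "t \<in> {0..T}" for t
  proof -
    have "0 \<le> w * (f t - f 0 * cos (s * t))\<^sup>2" using True by simp
    then have "w * (f t - f 0 * cos (s * t))\<^sup>2 = 0"
      using E[OF that] zero_le_power2[of "f' t + f 0 * s * sin (s * t)"] by linarith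
    then show ?thesis using True by simp
  qed
  show ?thesis
  proof (cases "f 0 = 0")
    case True then show ?thesis using sol by auto
  next
    case False
    have "T \<in> {0..T}" using \<open>T > 0\<close> by simp
    from sol[OF this] have "cos (s * T) = 0" using \<open>f T = 0\<close> False by simp
    then show ?thesis using sol \<open>w > 0\<close> unfolding s_def by blast
  qed
qed

section \<open>Smooth functions of the height\<close>

lemma Ck_on_cong:
  assumes "open U" and "\<And>p. p \<in> U \<Longrightarrow> f p = g p" and "Ck_on k U f"
  shows "Ck_on k U g"
  using assms(2,3)
proof (induction k arbitrary: f g)
  case 0
  then show ?case using continuous_on_cong by fastforce
next
  case (Suc k)
  have df: "f differentiable (at p)" if "p \<in> U" for p
    using Suc.prems(2) that by (simp add: differentiable_on_eq_differentiable_at[OF \<open>open U\<close>])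
  have "g differentiable_on U"
    unfolding differentiable_on_eq_differentiable_at[OF \<open>open U\<close>]
  proof
    fix p assume p: "p \<in> U"
    from has_derivative_transform_within_open[OF df[OF p, unfolded frechet_derivative_works] \<open>open U\<close> p Suc.prems(1)]
    show "g differentiable (at p)" by (auto simp: differentiable_def)
  qed
  moreover have "Ck_on k U (\<lambda>p. frechet_derivative g (at p) v)" for v
  proof (rule Suc.IH)
    show "Ck_on k U (\<lambda>p. frechet_derivative f (at p) v)" using Suc.prems(2) by simp
    show "frechet_derivative f (at p) v = frechet_derivative g (at p) v" if "p \<in> U" for p
      using frechet_derivative_transform_within_open[OF df[OF that] \<open>open U\<close> that Suc.prems(1)] by simp
  qed
  ultimately show ?case by simp
qed

lemma Ck_on_SucI:
  assumes "open U" and D: "\<And>p. p \<in> U \<Longrightarrow> (f has_derivative f' p) (at p)"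
    and Ck: "\<And>v. Ck_on k U (\<lambda>p. f' p v)"
  shows "Ck_on (Suc k) U f"
proof -
  have "f differentiable_on U"
    unfolding differentiable_on_eq_differentiable_at[OF \<open>open U\<close>] using D by (auto simp: differentiable_def)
  moreover have "Ck_on k U (\<lambda>p. frechet_derivative f (at p) v)" for v
    by (rule Ck_on_cong[OF \<open>open U\<close> _ Ck]) (simp add: frechet_derivative_at[OF D, symmetric])
  ultimately show ?thesis by simp
qed

lemma Ck_on_add:
  assumes "open U" and "Ck_on k U f" and "Ck_on k U g"
  shows "Ck_on k U (\<lambda>p. f p + g p)"
  using assms(2,3)
proof (induction k arbitrary: f g)
  case 0
  then show ?case by (simp add: continuous_on_add)
next
  case (Suc k)
  have "(\<lambda>p. f p + g p) differentiable_on U \<Longrightarrow> Ck_on (Suc k) U (\<lambda>p. f p + g p)"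
    if D: "\<And>p. p \<in> U \<Longrightarrow> f differentiable (at p) \<and> g differentiable (at p)"
  proof (rule Ck_on_SucI[OF \<open>open U\<close>])
    show "((\<lambda>p. f p + g p) has_derivative (\<lambda>v. frechet_derivative f (at p) v + frechet_derivative g (at p) v)) (at p)"
      if "p \<in> U" for p
      using D[OF that] by (intro has_derivative_add) (simp_all add: frechet_derivative_works)
    show "Ck_on k U (\<lambda>p. frechet_derivative f (at p) v + frechet_derivative g (at p) v)" for v
      using Suc.prems by (intro Suc.IH) simp_all
  qed
  then show ?case
    using Suc.prems by (simp add: differentiable_on_eq_differentiable_at[OF \<open>open U\<close>])
qed

lemma open_H3: "open H3"
  unfolding H3_def by (intro open_Collect_less continuous_intros)

text \<open>Carrying the powers of the height along makes the family closed under differentiation, up to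
  sums.\<close>
lemma Ck_on_height:
  fixes G :: "nat \<Rightarrow> real \<Rightarrow> real"
  assumes G: "\<And>n x. (G n has_real_derivative G (Suc n) x) (at x)"
  shows "Ck_on k H3 (\<lambda>p. a * G n (\<alpha> + \<mu> * ln (p$3)) / (p$3)^m)"
proof (induction k arbitrary: a n m)
  have D: "((\<lambda>p::real^3. a * G n (\<alpha> + \<mu> * ln (p$3)) / (p$3)^m) has_derivative
      (\<lambda>v. (a * \<mu> * v$3) * G (Suc n) (\<alpha> + \<mu> * ln (p$3)) / (p$3)^Suc m
          + (- a * real m * v$3) * G n (\<alpha> + \<mu> * ln (p$3)) / (p$3)^Suc m)) (at p)"
    if "p \<in> H3" for a n m and p :: "real^3"
  proof -
    have p: "p$3 > 0" using that by (simp add: H3_def)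
    have "((\<lambda>y. \<alpha> + \<mu> * ln y) has_real_derivative \<mu> / p$3) (at (p$3))"
      using p by (auto intro!: derivative_eq_intros)
    from DERIV_chain2[OF G this]
    have 1: "((\<lambda>y. G n (\<alpha> + \<mu> * ln y)) has_real_derivative G (Suc n) (\<alpha> + \<mu> * ln (p$3)) * (\<mu> / p$3)) (at (p$3))" .
    have 2: "((\<lambda>y. y ^ m) has_real_derivative real m * (p$3)^m / p$3) (at (p$3))"
      using p DERIV_pow[of m "p$3"] by (cases m) simp_all
    have "((\<lambda>y. a * G n (\<alpha> + \<mu> * ln y) / y ^ m) has_real_derivative
        (a * \<mu>) * G (Suc n) (\<alpha> + \<mu> * ln (p$3)) / (p$3)^Suc m
          + (- a * real m) * G n (\<alpha> + \<mu> * ln (p$3)) / (p$3)^Suc m) (at (p$3))"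
      by (rule DERIV_cong[OF DERIV_divide[OF DERIV_cmult[OF 1, of a] 2]])
         (use p in \<open>simp, simp add: field_simps\<close>)
    from DERIV_compose_FDERIV[OF this has_derivative_vec_nth]
    show ?thesis by (rule has_derivative_eq_rhs) (simp add: fun_eq_iff field_simps)
  qed
  {
    case 0
    have "continuous_on H3 (\<lambda>p. a * G n (\<alpha> + \<mu> * ln (p$3)) / (p$3)^m)"
      by (intro continuous_at_imp_continuous_on ballI has_derivative_continuous[OF D])
    then show ?case by simp
  next
    case (Suc k)
    show ?case
      by (rule Ck_on_SucI[OF open_H3 D]) (simp_all only: Ck_on_add[OF open_H3 Suc.IH Suc.IH])
  }
qed

lemma smooth_on_set_height:
  assumes "\<And>n x. (G n has_real_derivative G (Suc n) x) (at x)" and "M \<subseteq> H3"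
    and "\<And>p. p \<in> M \<Longrightarrow> u p = G 0 (\<alpha> + \<mu> * ln (p$3))"
  shows "smooth_on_set M u"
  unfolding smooth_on_set_def
proof (intro exI conjI)
  show "\<forall>k. Ck_on k H3 (\<lambda>p. G 0 (\<alpha> + \<mu> * ln (p$3)))"
    using Ck_on_height[of G _ 1 0 \<alpha> \<mu> 0, OF assms(1)] by simp
qed (use assms open_H3 in auto)

lemma cos_derivatives:
  "((\<lambda>x. cos (x + real n * (pi / 2))) has_real_derivative cos (x + real (Suc n) * (pi / 2))) (at x)"
proof -
  have "cos (x + real (Suc n) * (pi / 2)) = cos (x + real n * (pi / 2) + pi / 2)"
    by (simp add: algebra_simps add_divide_distrib)
  then have "cos (x + real (Suc n) * (pi / 2)) = - sin (x + real n * (pi / 2))"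
    by (simp add: cos_add)
  then show ?thesis by (auto intro!: derivative_eq_intros)
qed

section \<open>Modes and test functions\<close>

definition frequency :: "real \<Rightarrow> nat \<Rightarrow> real" where
  "frequency T m = (2 * real m + 1) * pi / (2 * T)"

text \<open>Extended by zero, as the elements of \<open>eigenspace\<close> are.\<close>
definition mode :: "real \<Rightarrow> real \<Rightarrow> nat \<Rightarrow> real^3 \<Rightarrow> real" where
  "mode R T m p = (if p \<in> cyl R {0..T} then cos (frequency T m * ln (p$3)) else 0)"

definition mode_value :: "real \<Rightarrow> real \<Rightarrow> nat \<Rightarrow> real" where
  "mode_value R T m = ((frequency T m)\<^sup>2 - 1 / (sinh R)\<^sup>2) / (cosh R)\<^sup>2"

text \<open>The means of \<open>cos (\<mu> t)\<close> and \<open>cos (3 \<mu> t)\<close> are in the ratio \<open>3 : - 1\<close>, which dictates the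
  coefficients.\<close>
lemma test_function_integral:
  assumes "T > 0" and \<mu>: "\<mu> = pi / (2 * T)"
  shows "((\<lambda>t. cos (\<mu> * t) + 3 * cos (3 * \<mu> * t)) has_integral 0) {0..T}"
proof -
  let ?F = "\<lambda>t. (sin (\<mu> * t) + sin (3 * \<mu> * t)) / \<mu>"
  have \<mu>0: "\<mu> > 0" using assms by simp
  have "\<mu> * T = pi / 2" "3 * \<mu> * T = 3 / 2 * pi" using assms by simp_all
  then have "sin (\<mu> * T) = 1" "sin (3 * \<mu> * T) = - 1" by (simp_all only: sin_pi_half sin_3over2_pi)
  then have "?F T - ?F 0 = 0" by (simp only:) simp
  moreover have "((\<lambda>t. cos (\<mu> * t) + 3 * cos (3 * \<mu> * t)) has_integral ?F T - ?F 0) {0..T}"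
    using \<mu>0 \<open>T > 0\<close> by (intro fundamental_theorem_of_calculus)
      (auto intro!: derivative_eq_intros simp: field_simps simp flip: has_real_derivative_iff_has_vector_derivative)
  ultimately show ?thesis by (simp only:)
qed

text \<open>The functions \<open>cos (\<mu> t)\<close> and \<open>3 cos (3 \<mu> t)\<close> are orthogonal, as are their derivatives, so they
  contribute separately: \<open>82 = 1\<^sup>2 + 9\<^sup>2\<close> and \<open>10 = 1\<^sup>2 + 3\<^sup>2\<close>.\<close>
lemma test_function_energy:
  assumes "T > 0" and \<mu>: "\<mu> = pi / (2 * T)"
  shows "((\<lambda>t. (- \<mu> * sin (\<mu> * t) - 9 * \<mu> * sin (3 * \<mu> * t))\<^sup>2 - k * (cos (\<mu> * t) + 3 * cos (3 * \<mu> * t))\<^sup>2)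
    has_integral (T / 2) * (82 * \<mu>\<^sup>2 - 10 * k)) {0..T}"
proof -
  let ?f = "\<lambda>t. (- \<mu> * sin (\<mu> * t) - 9 * \<mu> * sin (3 * \<mu> * t))\<^sup>2 - k * (cos (\<mu> * t) + 3 * cos (3 * \<mu> * t))\<^sup>2"
  \<comment> \<open>The coefficients of the integrand as a cosine polynomial; since \<open>2 \<mu> T = \<pi>\<close>, only the constant
    one survives integration.\<close>
  define a where "a = (82 * \<mu>\<^sup>2 - 10 * k) / 2"
  define b2 where "b2 = (17 * \<mu>\<^sup>2 - 7 * k) / 2"
  define b4 where "b4 = - (9 * \<mu>\<^sup>2 + 3 * k)"
  define b6 where "b6 = - (81 * \<mu>\<^sup>2 + 9 * k) / 2"
  let ?F = "\<lambda>t. a * t + b2 * sin (2 * \<mu> * t) / (2 * \<mu>) + b4 * sin (4 * \<mu> * t) / (4 * \<mu>) + b6 * sin (6 * \<mu> * t) / (6 * \<mu>)"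
  have \<mu>0: "\<mu> > 0" using assms by simp
  have f: "?f t = a + b2 * cos (2 * \<mu> * t) + b4 * cos (4 * \<mu> * t) + b6 * cos (6 * \<mu> * t)" for t
  proof -
    define x where "x = \<mu> * t"
    define S1 C1 S3 C3 where "S1 = sin x" and "C1 = cos x" and "S3 = sin (3 * x)" and "C3 = cos (3 * x)"
    have c2: "cos (2 * x) = C3 * C1 + S3 * S1"
      using cos_diff[of "3 * x" x] by (simp add: S1_def C1_def S3_def C3_def)
    have c2': "cos (2 * x) = C1\<^sup>2 - S1\<^sup>2"
      using cos_double[of x] by (simp add: S1_def C1_def)
    have c4: "cos (4 * x) = C3 * C1 - S3 * S1"
      using cos_add[of "3 * x" x] by (simp add: S1_def C1_def S3_def C3_def)
    have c6: "cos (6 * x) = C3\<^sup>2 - S3\<^sup>2"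
      using cos_double[of "3 * x"] by (simp add: S3_def C3_def)
    have 1: "S1\<^sup>2 + C1\<^sup>2 = 1" "S3\<^sup>2 + C3\<^sup>2 = 1" by (simp_all add: S1_def C1_def S3_def C3_def)
    have e: "S1\<^sup>2 = (1 - cos (2 * x)) / 2" "C1\<^sup>2 = (1 + cos (2 * x)) / 2"
      "S3\<^sup>2 = (1 - cos (6 * x)) / 2" "C3\<^sup>2 = (1 + cos (6 * x)) / 2"
      using c2' c6 1 by simp_all
    have e': "S1 * S3 = (cos (2 * x) - cos (4 * x)) / 2" "C1 * C3 = (cos (2 * x) + cos (4 * x)) / 2"
      unfolding c2 c4 by simp_all
    have "?f t = (- \<mu> * S1 - 9 * \<mu> * S3)\<^sup>2 - k * (C1 + 3 * C3)\<^sup>2"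
      by (simp add: S1_def C1_def S3_def C3_def x_def mult.assoc)
    also have "\<dots> = \<mu>\<^sup>2 * (S1\<^sup>2 + 18 * (S1 * S3) + 81 * S3\<^sup>2) - k * (C1\<^sup>2 + 6 * (C1 * C3) + 9 * C3\<^sup>2)"
      by (simp add: power2_eq_square algebra_simps)
    also have "\<dots> = a + b2 * cos (2 * x) + b4 * cos (4 * x) + b6 * cos (6 * x)"
      unfolding e e' a_def b2_def b4_def b6_def by (simp add: field_simps)
    finally show ?thesis by (simp add: x_def mult.assoc)
  qed
  have "((\<lambda>t. a + b2 * cos (2 * \<mu> * t) + b4 * cos (4 * \<mu> * t) + b6 * cos (6 * \<mu> * t)) has_integral ?F T - ?F 0) {0..T}"
    using \<mu>0 \<open>T > 0\<close> by (intro fundamental_theorem_of_calculus)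
      (auto intro!: derivative_eq_intros simp: field_simps simp flip: has_real_derivative_iff_has_vector_derivative)
  moreover have "?F T - ?F 0 = (T / 2) * (82 * \<mu>\<^sup>2 - 10 * k)"
  proof -
    have "2 * \<mu> * T = pi" "4 * \<mu> * T = 2 * pi" "6 * \<mu> * T = 3 * pi" using assms by simp_all
    moreover have "sin (3 * pi) = 0" using sin_npi[of 3] by simp
    ultimately have "sin (2 * \<mu> * T) = 0" "sin (4 * \<mu> * T) = 0" "sin (6 * \<mu> * T) = 0"
      by (simp_all only: sin_pi sin_two_pi)
    then show ?thesis by (simp only: a_def) simp
  qed
  ultimately show ?thesis unfolding f by (simp only:)
qed

section \<open>A smooth function that is flat on a half-line\<close>

text \<open>The derivatives of \<open>exp (- 1 / x)\<close> are \<open>P\<^sub>n (1 / x) exp (- 1 / x)\<close>, where \<open>P\<^sub>n\<close> obeys this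
  recursion.\<close>
primrec flat_poly :: "nat \<Rightarrow> real poly" where
  "flat_poly 0 = 1"
| "flat_poly (Suc n) = [:0, 0, 1:] * (flat_poly n - pderiv (flat_poly n))"

definition flat :: "nat \<Rightarrow> real \<Rightarrow> real" where
  "flat n x = (if x > 0 then poly (flat_poly n) (1 / x) * exp (- (1 / x)) else 0)"

lemma poly_div_exp_tendsto_0: "((\<lambda>x::real. poly p x / exp x) \<longlongrightarrow> 0) at_top"
proof -
  have "((\<lambda>x. \<Sum>i\<le>degree p. coeff p i * (x ^ i / exp x)) \<longlongrightarrow> (\<Sum>i\<le>degree p. coeff p i * 0)) at_top"
    by (intro tendsto_sum tendsto_mult tendsto_const tendsto_power_div_exp_0)
  then show ?thesis by (simp add: poly_altdef sum_divide_distrib)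
qed

lemma flat_derivative: "(flat n has_real_derivative flat (Suc n) x) (at x)"
proof -
  consider "x > 0" | "x < 0" | "x = 0" by linarith
  then show ?thesis
  proof cases
    case 1
    have "((\<lambda>y. 1 / y) has_real_derivative - 1 / x\<^sup>2) (at x)"
      using 1 by (auto intro!: derivative_eq_intros simp: power2_eq_square)
    from DERIV_mult[OF DERIV_chain2[OF poly_DERIV this] DERIV_chain2[OF DERIV_exp DERIV_minus[OF this]]]
    have "((\<lambda>y. poly (flat_poly n) (1 / y) * exp (- (1 / y))) has_real_derivative flat (Suc n) x) (at x)"
      by (rule DERIV_cong) (use 1 in \<open>simp add: flat_def power2_eq_square field_simps\<close>)
    then show ?thesis
      by (rule has_field_derivative_transform_within_open[OF _ open_greaterThan[of 0]])
         (use 1 in \<open>simp_all add: flat_def\<close>)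
  next
    case 2
    have "((\<lambda>y. 0) has_real_derivative flat (Suc n) x) (at x)" using 2 by (simp add: flat_def)
    then show ?thesis
      by (rule has_field_derivative_transform_within_open[OF _ open_lessThan[of 0]])
         (use 2 in \<open>simp_all add: flat_def\<close>)
  next
    case 3
    have "((\<lambda>y. flat n y / y) \<longlongrightarrow> 0) (at_right 0)"
    proof -
      have "((\<lambda>y. poly (pCons 0 (flat_poly n)) (inverse y) / exp (inverse y)) \<longlongrightarrow> 0) (at_right 0)"
        by (rule filterlim_compose[OF poly_div_exp_tendsto_0 filterlim_inverse_at_top_right])
      then show ?thesis
        by (rule Lim_transform_eventually)
           (auto simp: eventually_at_right_field flat_def exp_minus field_simps intro!: exI[of _ 1])
    qed
    moreover have "((\<lambda>y. flat n y / y) \<longlongrightarrow> 0) (at_left 0)"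
      by (rule Lim_transform_eventually[OF tendsto_const])
         (auto simp: eventually_at_left_field flat_def intro!: exI[of _ "-1"])
    ultimately have "((\<lambda>y. flat n y / y) \<longlongrightarrow> 0) (at 0)" by (simp add: filterlim_at_split)
    then show ?thesis using 3 by (simp add: has_field_derivative_iff flat_def)
  qed
qed

text \<open>A derivative of a function equal to 0 at both 0 and 1 has mean zero; here this function is
  \<open>flat 0 - flat 1\<close>.\<close>
definition bump :: "nat \<Rightarrow> real \<Rightarrow> real" where
  "bump n x = flat (Suc n) x - flat (Suc (Suc n)) x"

lemma bump_derivative: "(bump n has_real_derivative bump (Suc n) x) (at x)"
  unfolding bump_def[abs_def] by (intro DERIV_diff flat_derivative)

lemma bump_nonpos: "x \<le> 0 \<Longrightarrow> bump n x = 0"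
  by (simp add: bump_def flat_def)

lemma bump_1: "bump 0 1 \<noteq> 0"
  by (simp add: bump_def flat_def pderiv_pCons pderiv_mult pderiv_diff)

lemma bump_has_integral_0: "(bump 0 has_integral 0) {0..1}"
proof -
  have "(bump 0 has_integral (flat 0 1 - flat 1 1) - (flat 0 0 - flat 1 0)) {0..1}"
  proof (rule fundamental_theorem_of_calculus)
    fix x :: real
    have "((\<lambda>x. flat 0 x - flat 1 x) has_real_derivative bump 0 x) (at x)"
      unfolding bump_def One_nat_def by (intro DERIV_diff flat_derivative)
    then show "((\<lambda>x. flat 0 x - flat 1 x) has_vector_derivative bump 0 x) (at x within {0..1})"
      by (simp add: has_field_derivative_at_within flip: has_real_derivative_iff_has_vector_derivative)
  qed simp
  then show ?thesis by (simp add: flat_def)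
qed

lemma continuous_on_bump: "continuous_on A (bump n)"
  by (intro continuous_at_imp_continuous_on ballI DERIV_isCont[OF bump_derivative])

text \<open>The profile is reversed as well as stretched: its end \<open>x = 1\<close>, where it need not vanish, goes to
  \<open>t = 0\<close>, and its zero set \<open>x \<le> 0\<close> to \<open>t \<ge> L\<close>.\<close>
lemma integral_stretched_profile:
  fixes g :: "real \<Rightarrow> real"
  assumes "L > 0" and g: "(g has_integral i) {0..1}" and zero: "\<And>x. x \<le> 0 \<Longrightarrow> g x = 0"
  shows "integral {0..} (\<lambda>t. g (1 - t / L)) = L * i"
proof -
  have img: "(\<lambda>x. (1 / (- (1 / L))) *\<^sub>R x + - ((1 / (- (1 / L))) *\<^sub>R (1::real))) ` cbox 0 1 = {0..L}"
  proof -
    have "(\<lambda>x. (1 / (- (1 / L))) *\<^sub>R x + - ((1 / (- (1 / L))) *\<^sub>R (1::real))) = (\<lambda>x. - L * x + L)"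
      by (simp add: fun_eq_iff)
    then show ?thesis
      using image_affinity_atLeastAtMost[of "- L" L 0 1] \<open>L > 0\<close> by simp
  qed
  have "((\<lambda>t. g (- (1 / L) *\<^sub>R t + 1)) has_integral (1 / \<bar>- (1 / L)\<bar> ^ DIM(real)) *\<^sub>R i)
      ((\<lambda>x. (1 / (- (1 / L))) *\<^sub>R x + - ((1 / (- (1 / L))) *\<^sub>R (1::real))) ` cbox 0 1)"
    by (rule has_integral_affinity) (use g \<open>L > 0\<close> in simp_all)
  then have "((\<lambda>t. g (1 - t / L)) has_integral L * i) {0..L}"
    unfolding img using \<open>L > 0\<close> by (simp add: algebra_simps)
  then have "((\<lambda>t. if t \<in> {0..L} then g (1 - t / L) else 0) has_integral L * i) {0..}"
    by (subst has_integral_restrict) auto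
  moreover have "(if t \<in> {0..L} then g (1 - t / L) else 0) = g (1 - t / L)" if "t \<in> {0..}" for t
    using that zero[of "1 - t / L"] \<open>L > 0\<close> by (auto simp: le_divide_eq)
  ultimately have "((\<lambda>t. g (1 - t / L)) has_integral L * i) {0..}"
    by (rule has_integral_eq[rotated])
  then show ?thesis by (rule integral_unique)
qed

section \<open>The regions cut out by the cylinder\<close>

text \<open>The Killing cylinder is the zero set of this quadratic form, and its inside the negative
  cone.\<close>
definition cone_fun :: "real \<Rightarrow> real^3 \<Rightarrow> real" where
  "cone_fun R p = (p$1)\<^sup>2 + (p$2)\<^sup>2 - (sinh R)\<^sup>2 * (p$3)\<^sup>2"

definition rotation :: "real^3 \<Rightarrow> real^3" where
  "rotation p = vector [- p$2, p$1, 0]"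

text \<open>The hyperbolic unit normal is a multiple of the gradient of \<open>cone_fun\<close>; on the cylinder it is
  the restriction of a linear map, which makes its Euclidean derivative trivial.\<close>
definition inward_normal :: "real \<Rightarrow> real^3 \<Rightarrow> real^3" where
  "inward_normal R p = vector [- p$1 / (sinh R * cosh R), - p$2 / (sinh R * cosh R),
                               sinh R * p$3 / cosh R]"

lemma Psi_nth [simp]:
  "Psi R q $ 1 = exp (q$1) * sinh R * cos (q$2)"
  "Psi R q $ 2 = exp (q$1) * sinh R * sin (q$2)"
  "Psi R q $ 3 = exp (q$1)"
  by (simp_all add: Psi_def)

lemma rotation_nth [simp]: "rotation p $ 1 = - p$2" "rotation p $ 2 = p$1" "rotation p $ 3 = 0"
  by (simp_all add: rotation_def)

lemma rotation_inner_position: "rotation p \<bullet> p = 0"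
  by (simp add: inner_real3)

lemma inward_normal_nth [simp]:
  "inward_normal R p $ 1 = - p$1 / (sinh R * cosh R)"
  "inward_normal R p $ 2 = - p$2 / (sinh R * cosh R)"
  "inward_normal R p $ 3 = sinh R * p$3 / cosh R"
  by (simp_all add: inward_normal_def)

lemma tau0_eq: "tau0 R = cosh R"
proof -
  have "1 + (sinh R)\<^sup>2 = (cosh R)\<^sup>2" by (simp add: cosh_square_eq)
  then show ?thesis by (simp add: tau0_def)
qed

context
  fixes R :: real
  assumes R_pos: "R > 0"
begin

private abbreviation (input) "r \<equiv> sinh R"
private abbreviation (input) "c \<equiv> cosh R"
private lemma r_pos: "r > 0" using R_pos by simp
private lemma c_pos: "c > 0" by simp
private lemma c_sq: "c\<^sup>2 = r\<^sup>2 + 1" by (rule cosh_square_eq)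

lemma inner_self_eq: "p \<bullet> p = cone_fun R p + c\<^sup>2 * (p$3)\<^sup>2"
  unfolding inner_real3 cone_fun_def c_sq by (simp add: algebra_simps power2_eq_square)

lemma cone_fun_Psi: "cone_fun R (Psi R q) = 0"
proof -
  have "cone_fun R (Psi R q) = (exp (q$1) * r)\<^sup>2 * ((cos (q$2))\<^sup>2 + (sin (q$2))\<^sup>2 - 1)"
    unfolding cone_fun_def Psi_nth by algebra
  then show ?thesis by simp
qed

lemma cyl_iff: "p \<in> cyl R I \<longleftrightarrow> p$3 > 0 \<and> cone_fun R p = 0 \<and> ln (p$3) \<in> I"
proof
  assume "p \<in> cyl R I"
  then show "p$3 > 0 \<and> cone_fun R p = 0 \<and> ln (p$3) \<in> I"
    by (auto simp: cyl_def strip_def cone_fun_Psi)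
next
  assume p: "p$3 > 0 \<and> cone_fun R p = 0 \<and> ln (p$3) \<in> I"
  then have "(p$1)\<^sup>2 + (p$2)\<^sup>2 = (r * p$3)\<^sup>2"
    by (simp add: cone_fun_def power_mult_distrib)
  then have "(p$1 / (r * p$3))\<^sup>2 + (p$2 / (r * p$3))\<^sup>2 = 1"
    using p r_pos by (simp add: power_divide flip: add_divide_distrib)
  then obtain \<theta> where \<theta>: "0 \<le> \<theta>" "\<theta> \<le> 2 * pi" "p$1 / (r * p$3) = cos \<theta>" "p$2 / (r * p$3) = sin \<theta>"
    using sincos_total_2pi_le by metis
  have "p = Psi R (vector [ln (p$3), \<theta>])"
    using p r_pos by (simp add: vec3_eq_iff \<theta>(3,4)[symmetric])
  moreover have "vector [ln (p$3), \<theta>] \<in> {q \<in> strip I. q$2 \<in> {0..2 * pi}}"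
    using p \<theta> by (simp add: strip_def)
  ultimately show "p \<in> cyl R I" unfolding cyl_def by blast
qed

lemma Psi_in_cyl: "q$1 \<in> I \<Longrightarrow> Psi R q \<in> cyl R I"
  by (simp add: cyl_iff cone_fun_Psi)

lemma cyl_nonneg_iff: "p \<in> cyl R {0..} \<longleftrightarrow> p$3 \<ge> 1 \<and> cone_fun R p = 0"
  by (auto simp: cyl_iff ln_ge_zero_iff)

lemma cyl_0_iff: "p \<in> cyl R {0} \<longleftrightarrow> p$3 = 1 \<and> cone_fun R p = 0"
  by (auto simp: cyl_iff)

lemma region_W_iff: "p \<in> region_W R \<longleftrightarrow> p$3 > 0 \<and> p \<bullet> p > c\<^sup>2"
  by (simp add: region_W_def H3_def tau0_eq inner_real3 power2_eq_square)

lemma continuous_on_cone_fun: "continuous_on A (cone_fun R)"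
  unfolding cone_fun_def by (intro continuous_intros)

lemma cone_fun_neg_iff:
  "p$3 > 0 \<and> cone_fun R p < 0 \<longleftrightarrow> norm (p$1, p$2) < r * p$3"
proof -
  have "norm (p$1, p$2) < r * p$3 \<longleftrightarrow> r * p$3 > 0 \<and> (norm (p$1, p$2))\<^sup>2 < (r * p$3)\<^sup>2"
    by (smt (verit) norm_ge_zero power2_less_imp_less power_strict_mono zero_less_numeral)
  then show ?thesis
    using r_pos by (simp add: norm_Pair cone_fun_def power_mult_distrib zero_less_mult_iff)
qed

lemma convex_inside_truncated: "convex {p::real^3. norm (p$1, p$2) < r * p$3 \<and> p$3 \<ge> h}"
proof (rule convexI)
  fix x y :: "real^3" and u v :: real
  assume x: "x \<in> {p. norm (p$1, p$2) < r * p$3 \<and> p$3 \<ge> h}"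
    and y: "y \<in> {p. norm (p$1, p$2) < r * p$3 \<and> p$3 \<ge> h}"
    and uv: "0 \<le> u" "0 \<le> v" "u + v = 1"
  have "norm (u *\<^sub>R (x$1, x$2) + v *\<^sub>R (y$1, y$2)) \<le> u * norm (x$1, x$2) + v * norm (y$1, y$2)"
    using uv norm_triangle_ineq[of "u *\<^sub>R (x$1, x$2)" "v *\<^sub>R (y$1, y$2)"] by (simp only: norm_scaleR abs_of_nonneg)
  also have "\<dots> < u * (r * x$3) + v * (r * y$3)"
    using x y uv by (smt (verit) mem_Collect_eq mult_left_mono mult_strict_left_mono)
  finally have "norm ((u *\<^sub>R x + v *\<^sub>R y)$1, (u *\<^sub>R x + v *\<^sub>R y)$2) < r * (u *\<^sub>R x + v *\<^sub>R y)$3"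
    by (simp add: algebra_simps)
  moreover have "(u *\<^sub>R x + v *\<^sub>R y)$3 \<ge> h"
    using x y uv convex_bound_le[of "- x$3" "- h" "- y$3" u v] by simp
  ultimately show "u *\<^sub>R x + v *\<^sub>R y \<in> {p. norm (p$1, p$2) < r * p$3 \<and> p$3 \<ge> h}" by simp
qed

text \<open>On a connected set that avoids the cylinder the sign of \<open>cone_fun\<close> is constant. Conversely, a
  point inside the cylinder is joined to the axis by first rising above the sphere and then moving
  within a truncated convex cone.\<close>
lemma region_D_iff: "p \<in> region_D R \<longleftrightarrow> p$3 > 0 \<and> cone_fun R p < 0 \<and> p \<bullet> p > c\<^sup>2"
proof
  let ?X = "region_W R - cyl R {0..}"
  let ?a = "vector [0, 0, 2 * tau0 R] :: real^3"
  have a: "?a$3 = 2 * c" "cone_fun R ?a < 0" "?a$1 = 0" "?a$2 = 0"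
    using r_pos by (simp_all add: tau0_eq cone_fun_def)
  have nz: "cone_fun R x \<noteq> 0" if "x \<in> ?X" for x
  proof
    assume 0: "cone_fun R x = 0"
    then have "c\<^sup>2 * (x$3)\<^sup>2 > c\<^sup>2 * 1" "x$3 > 0"
      using that inner_self_eq[of x] by (simp_all add: region_W_iff)
    then have "(x$3)\<^sup>2 > 1" by simp
    then have "x$3 > 1" 
      using \<open>x$3 > 0\<close> power2_less_imp_less[of 1 "x$3"] by simp
    then show False using that 0 by (simp add: cyl_nonneg_iff)
  qed
  show "p$3 > 0 \<and> cone_fun R p < 0 \<and> p \<bullet> p > c\<^sup>2" if p: "p \<in> region_D R"
  proof -
    let ?C = "region_D R"
    have sub: "?C \<subseteq> ?X" unfolding region_D_def by (rule connected_component_subset)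
    have "connected ?C" unfolding region_D_def by (rule connected_connected_component)
    then have conn: "connected (cone_fun R ` ?C)"
      by (rule connected_continuous_image[OF continuous_on_cone_fun])
    have "?a \<in> ?C"
    proof -
      have "?a \<in> ?X"
        using p unfolding region_D_def mem_Collect_eq
        by (rule connected_component_in[THEN conjunct1])
      then show ?thesis unfolding region_D_def
        unfolding mem_Collect_eq connected_component_refl_eq .
    qed
    have "cone_fun R p < 0"
    proof (rule ccontr)
      assume "\<not> cone_fun R p < 0"
      with a(2) have "cone_fun R ?a \<le> 0" "0 \<le> cone_fun R p" by linarith+
      with conn imageI[OF \<open>?a \<in> ?C\<close>] imageI[OF p] have "0 \<in> cone_fun R ` ?C"
        by (rule connectedD_interval)
      then obtain x where "x \<in> ?C" "cone_fun R x = 0" by (metis imageE)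
      then show False using nz[of x] sub by blast
    qed
    moreover have "p \<in> region_W R" using p sub by blast
    ultimately show ?thesis by (simp add: region_W_iff)
  qed
  show "p \<in> region_D R" if p: "p$3 > 0 \<and> cone_fun R p < 0 \<and> p \<bullet> p > c\<^sup>2"
  proof -
    let ?D = "{p::real^3. p$3 > 0 \<and> cone_fun R p < 0 \<and> p \<bullet> p > c\<^sup>2}"
    let ?p' = "p + (2 * c) *\<^sub>R axis 3 1"
    let ?K = "{p::real^3. norm (p$1, p$2) < r * p$3 \<and> p$3 \<ge> 2 * c}"
    have DX: "?D \<subseteq> ?X" by (auto simp: region_W_iff cyl_iff)
    have up: "p + s *\<^sub>R axis 3 1 \<in> ?D" if "s \<ge> 0" for s
    proof -
      have "(p$3)\<^sup>2 \<le> (p$3 + s)\<^sup>2" using p that by (intro power_mono) auto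
      moreover from this have "r\<^sup>2 * (p$3)\<^sup>2 \<le> r\<^sup>2 * (p$3 + s)\<^sup>2" by (intro mult_left_mono) auto
      ultimately show ?thesis using p that
        by (simp add: cone_fun_def inner_real3 power2_eq_square)
    qed
    have KD: "?K \<subseteq> ?D"
    proof
      fix x assume x: "x \<in> ?K"
      then have "x$3 > 0" "cone_fun R x < 0" using cone_fun_neg_iff by blast+
      moreover have "2 * c \<le> x$3" using x by simp
      then have "c * c < x$3 * x$3"
        using c_pos by (intro mult_strict_mono) linarith+
      then have "c\<^sup>2 < x \<bullet> x"
        by (simp add: inner_real3 power2_eq_square add_nonneg_pos add_strict_increasing2)
      ultimately show "x \<in> ?D" by simp
    qed
    have "connected_component ?X p ?p'"
    proof -
      let ?L = "closed_segment p ?p'"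
      have "?L \<subseteq> ?D"
      proof
        fix x assume "x \<in> ?L"
        then obtain u where "0 \<le> u" "x = (1 - u) *\<^sub>R p + u *\<^sub>R ?p'" by (auto simp: in_segment)
        then have "x = p + (u * (2 * c)) *\<^sub>R axis 3 1" by (simp add: algebra_simps)
        then show "x \<in> ?D" using up[of "u * (2 * c)"] \<open>0 \<le> u\<close> c_pos by simp
      qed
      then show ?thesis using DX unfolding connected_component_def
        by (intro exI[of _ ?L]) (auto simp: connected_segment)
    qed
    moreover have "connected_component ?X ?p' ?a"
    proof -
      have "?p' \<in> ?D" using up[of "2 * c"] by simp
      then have "?p' \<in> ?K" using p cone_fun_neg_iff[of ?p'] by simp
      moreover have "?a \<in> ?K" using a r_pos c_pos by (simp add: norm_Pair)
      moreover have "connected ?K" by (rule convex_connected[OF convex_inside_truncated])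
      moreover have "?K \<subseteq> ?X" using KD DX by (rule subset_trans)
      ultimately show ?thesis unfolding connected_component_def by (intro exI[of _ ?K]) simp
    qed
    ultimately have "connected_component ?X p ?a" by (rule connected_component_trans)
    then show ?thesis unfolding region_D_def mem_Collect_eq by (rule connected_component_sym)
  qed
qed

text \<open>Moving a point outwards along its ray and upwards at the same time makes both inequalities strict,
  so the closure is as large as the formula suggests.\<close>
lemma closure_region_D_iff:
  "p \<in> closure (region_D R) \<longleftrightarrow> p$3 > 0 \<and> cone_fun R p \<le> 0 \<and> p \<bullet> p \<ge> c\<^sup>2"
proof
  let ?E = "{p::real^3. p$3 \<ge> 0 \<and> cone_fun R p \<le> 0 \<and> p \<bullet> p \<ge> c\<^sup>2}"
  have "closed ?E"
    by (intro closed_Collect_conj closed_Collect_le continuous_intros continuous_on_cone_fun)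
  moreover have "region_D R \<subseteq> ?E" by (auto simp: region_D_iff)
  ultimately have sub: "closure (region_D R) \<subseteq> ?E" by (rule closure_minimal[rotated])
  show "p$3 > 0 \<and> cone_fun R p \<le> 0 \<and> p \<bullet> p \<ge> c\<^sup>2" if "p \<in> closure (region_D R)"
  proof -
    have p: "p$3 \<ge> 0" "cone_fun R p \<le> 0" "p \<bullet> p \<ge> c\<^sup>2" using sub that by auto
    moreover have "p$3 \<noteq> 0"
      using p inner_self_eq[of p] by (auto simp: c_sq dest: order_trans)
        (smt (verit) zero_le_power2)
    ultimately show ?thesis by simp
  qed
  show "p \<in> closure (region_D R)" if p: "p$3 > 0 \<and> cone_fun R p \<le> 0 \<and> p \<bullet> p \<ge> c\<^sup>2"
  proof (rule Lim_in_closed_set)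
    let ?q = "\<lambda>s. (1 + s) *\<^sub>R p + s *\<^sub>R axis 3 1"
    show "(?q \<longlongrightarrow> p) (at_right 0)" by (rule tendsto_eq_intros refl)+ simp
    have "?q s \<in> region_D R" if s: "s > 0" for s
    proof -
      have "((1 + s) * p$3)\<^sup>2 < ((1 + s) * p$3 + s)\<^sup>2"
        using p s by (intro power_strict_mono) auto
      then have "r\<^sup>2 * ((1 + s) * p$3)\<^sup>2 < r\<^sup>2 * ((1 + s) * p$3 + s)\<^sup>2"
        using r_pos by (intro mult_strict_left_mono) auto
      moreover have "(1 + s)\<^sup>2 * cone_fun R p \<le> 0"
        using p by (simp add: mult_nonneg_nonpos)
      moreover have "cone_fun R (?q s) = (1 + s)\<^sup>2 * cone_fun R p
          + r\<^sup>2 * ((1 + s) * p$3)\<^sup>2 - r\<^sup>2 * ((1 + s) * p$3 + s)\<^sup>2"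
        by (simp add: cone_fun_def power_mult_distrib right_diff_distrib distrib_left)
      ultimately have "cone_fun R (?q s) < 0" by linarith
      moreover have "c\<^sup>2 < ?q s \<bullet> ?q s"
      proof -
        have "?q s \<bullet> ?q s = (1 + s)\<^sup>2 * (p \<bullet> p) + (2 * s * (1 + s) * p$3 + s\<^sup>2)"
          by (simp add: inner_real3 algebra_simps power2_eq_square)
        moreover have "1 * (p \<bullet> p) \<le> (1 + s)\<^sup>2 * (p \<bullet> p)"
          using s by (intro mult_right_mono) auto
        moreover have "0 < 2 * s * (1 + s) * p$3 + s\<^sup>2"
          using p s by (intro add_nonneg_pos) auto
        ultimately show ?thesis using p by linarith
      qed
      moreover have "?q s $ 3 > 0" using p s by (simp add: add_pos_pos)
      ultimately show ?thesis by (simp add: region_D_iff)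
    qed
    then show "\<forall>\<^sub>F s in at_right 0. ?q s \<in> closure (region_D R)"
      by (auto simp: eventually_at_filter intro!: always_eventually subsetD[OF closure_subset])
  qed simp_all
qed

lemma Omega_iff: "p \<in> Omega R \<longleftrightarrow> p$3 > 0 \<and> cone_fun R p \<le> 0 \<and> p \<bullet> p = c\<^sup>2"
proof -
  have "open {p::real^3. p$3 > 0 \<and> cone_fun R p < 0 \<and> p \<bullet> p > c\<^sup>2}"
    by (intro open_Collect_conj open_Collect_less continuous_intros continuous_on_cone_fun)
  moreover have "region_D R = {p::real^3. p$3 > 0 \<and> cone_fun R p < 0 \<and> p \<bullet> p > c\<^sup>2}"
    by (auto simp: region_D_iff)
  ultimately have D: "frontier (region_D R) = closure (region_D R) - region_D R"
    by (simp add: frontier_def interior_open)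
  have "open {p::real^3. p$3 > 0 \<and> p \<bullet> p > c\<^sup>2}"
    by (intro open_Collect_conj open_Collect_less continuous_intros)
  moreover have "region_W R = {p::real^3. p$3 > 0 \<and> p \<bullet> p > c\<^sup>2}"
    by (auto simp: region_W_iff)
  ultimately have W: "frontier (region_W R) = closure (region_W R) - region_W R"
    by (simp add: frontier_def interior_open)
  have "closure (region_D R) \<subseteq> closure (region_W R)"
    by (rule closure_mono) (auto simp: region_D_iff region_W_iff)
  then show ?thesis
    unfolding Omega_def D W by (auto simp: closure_region_D_iff region_D_iff region_W_iff)
qed

section \<open>The adapted frame along the cylinder\<close>

lemma inner_inward_normal: "inward_normal R p \<bullet> v = - (p$1 * v$1 + p$2 * v$2 - r\<^sup>2 * p$3 * v$3) / (r * c)"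
  using r_pos c_pos by (simp add: inner_real3 field_simps power2_eq_square)

lemma inward_normal_inner_self: "cone_fun R p = 0 \<Longrightarrow> inward_normal R p \<bullet> inward_normal R p = (p$3)\<^sup>2"
proof -
  assume "cone_fun R p = 0"
  then have "(p$1)\<^sup>2 + (p$2)\<^sup>2 = r\<^sup>2 * (p$3)\<^sup>2" by (simp add: cone_fun_def)
  moreover have "inward_normal R p \<bullet> inward_normal R p
      = ((p$1)\<^sup>2 + (p$2)\<^sup>2 + r\<^sup>2 * r\<^sup>2 * (p$3)\<^sup>2) / (r\<^sup>2 * c\<^sup>2)"
    using r_pos c_pos unfolding inner_inward_normal inward_normal_nth
    by (simp add: field_simps power2_eq_square)
  ultimately have "inward_normal R p \<bullet> inward_normal R p
      = (r\<^sup>2 * (p$3)\<^sup>2 + r\<^sup>2 * r\<^sup>2 * (p$3)\<^sup>2) / (r\<^sup>2 * c\<^sup>2)" by simp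
  also have "\<dots> = (p$3)\<^sup>2 * (r\<^sup>2 + 1) / c\<^sup>2"
    using r_pos c_pos by (simp add: field_simps)
  also have "\<dots> = (p$3)\<^sup>2" unfolding c_sq[symmetric] using c_pos by simp
  finally show ?thesis .
qed

lemma inward_normal_inner_position: "cone_fun R p = 0 \<Longrightarrow> inward_normal R p \<bullet> p = 0"
  by (simp add: inner_inward_normal cone_fun_def power2_eq_square)

lemma inward_normal_inner_rotation: "inward_normal R p \<bullet> rotation p = 0"
  by (simp add: inner_inward_normal)

lemma rotation_inner_self: "cone_fun R p = 0 \<Longrightarrow> rotation p \<bullet> rotation p = r\<^sup>2 * (p$3)\<^sup>2"
  by (simp add: inner_real3 cone_fun_def power2_eq_square)

lemma cone_fun_scaleR: "cone_fun R (a *\<^sub>R p) = a\<^sup>2 * cone_fun R p"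
  by (simp add: cone_fun_def power_mult_distrib algebra_simps)

lemma has_derivative_cone_fun:
  "(cone_fun R has_derivative (\<lambda>v. - 2 * r * c * (inward_normal R p \<bullet> v))) (at p within M)"
proof -
  have "(cone_fun R has_derivative (\<lambda>v. 2 * (p$1 * v$1 + p$2 * v$2 - r\<^sup>2 * p$3 * v$3))) (at p within M)"
    unfolding cone_fun_def
    by (rule derivative_eq_intros has_derivative_vec_nth refl)+ (simp add: fun_eq_iff algebra_simps)
  moreover have "2 * (p$1 * v$1 + p$2 * v$2 - r\<^sup>2 * p$3 * v$3) = - 2 * r * c * (inward_normal R p \<bullet> v)" for v
    using r_pos c_pos by (simp add: inner_inward_normal field_simps)
  ultimately show ?thesis by simp
qed

text \<open>The position vector and \<open>rotation p\<close> span the tangent plane, and the conformal factor makes unit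
  vectors at height \<open>z\<close> have Euclidean length \<open>z\<close>.\<close>
lemma orthogonal_to_cylinder:
  assumes p: "cone_fun R p = 0" "p$3 > 0" and n: "n \<bullet> p = 0" "n \<bullet> rotation p = 0"
    and len: "n \<bullet> n = (p$3)\<^sup>2"
  shows "n = inward_normal R p \<or> n = - inward_normal R p"
proof -
  let ?N = "inward_normal R p"
  define k where "k = n$3 * c / (r * p$3)"
  have eq: "n$1 * p$1 + n$2 * p$2 = - n$3 * p$3" "n$2 * p$1 = n$1 * p$2"
    using n by (simp_all add: inner_real3)
  have q: "(p$1)\<^sup>2 + (p$2)\<^sup>2 = r\<^sup>2 * (p$3)\<^sup>2" using p by (simp add: cone_fun_def)
  have "n$1 * (r\<^sup>2 * (p$3)\<^sup>2) = - p$1 * n$3 * p$3" "n$2 * (r\<^sup>2 * (p$3)\<^sup>2) = - p$2 * n$3 * p$3"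
    using eq unfolding q[symmetric] by algebra+
  then have "(n$1 * (r\<^sup>2 * p$3)) * p$3 = (- p$1 * n$3) * p$3" "(n$2 * (r\<^sup>2 * p$3)) * p$3 = (- p$2 * n$3) * p$3"
    by (simp_all add: power2_eq_square mult.assoc)
  then have "n$1 * (r\<^sup>2 * p$3) = - p$1 * n$3" "n$2 * (r\<^sup>2 * p$3) = - p$2 * n$3"
    using p(2) mult_right_cancel[of "p$3"] by (metis less_numeral_extra(3))+
  then have "n = k *\<^sub>R ?N"
    using p(2) r_pos c_pos by (simp add: vec3_eq_iff k_def field_simps power2_eq_square)
  then have "k\<^sup>2 * (p$3)\<^sup>2 = (p$3)\<^sup>2"
    using len inward_normal_inner_self[OF p(1)] by (simp add: power2_eq_square)
  then have "k = 1 \<or> k = -1" using p(2) by (simp add: power2_eq_1_iff)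
  then show ?thesis using \<open>n = k *\<^sub>R ?N\<close> by auto
qed

section \<open>Tangent cones of the cylinder, the cap and the enclosed region\<close>

lemma rotation_in_tangent_cone:
  assumes "p \<in> cyl R I" and "\<sigma>\<^sup>2 = (1::real)"
  shows "\<sigma> *\<^sub>R rotation p \<in> tangent_cone (cyl R I) p"
proof (rule tangent_coneI[where \<epsilon> = 1])
  let ?c = "\<lambda>s. cos (\<sigma> * s) *\<^sub>R (p - p$3 *\<^sub>R axis 3 1) + sin (\<sigma> * s) *\<^sub>R rotation p + p$3 *\<^sub>R axis 3 1"
  show "?c s \<in> cyl R I" for s
  proof -
    have "(cos (\<sigma> * s) * p$1 - sin (\<sigma> * s) * p$2)\<^sup>2 + (cos (\<sigma> * s) * p$2 + sin (\<sigma> * s) * p$1)\<^sup>2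
        = ((cos (\<sigma> * s))\<^sup>2 + (sin (\<sigma> * s))\<^sup>2) * ((p$1)\<^sup>2 + (p$2)\<^sup>2)"
      by (simp only: power2_eq_square algebra_simps)
    then have "cone_fun R (?c s) = cone_fun R p" by (simp add: cone_fun_def)
    then show ?thesis using assms(1) by (simp add: cyl_iff)
  qed
  show "(?c has_vector_derivative \<sigma> *\<^sub>R rotation p) (at 0)"
    by (auto intro!: derivative_eq_intros)
qed (auto simp: vec3_eq_iff)

lemma position_in_tangent_cone:
  assumes "p \<in> cyl R {0..}"
  shows "p \<in> tangent_cone (cyl R {0..}) p"
proof (rule tangent_cone_segmentI)
  show "p + s *\<^sub>R p \<in> cyl R {0..}" if "0 \<le> s" "s \<le> 1" for s
  proof -
    have "p + s *\<^sub>R p = (1 + s) *\<^sub>R p" by (simp add: algebra_simps)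
    moreover have "1 * 1 \<le> (1 + s) * p$3"
      using assms that by (intro mult_mono) (auto simp: cyl_nonneg_iff)
    ultimately show ?thesis using assms by (simp add: cyl_nonneg_iff cone_fun_scaleR)
  qed
qed simp

lemma tangent_cone_cyl_orthogonal:
  assumes "p \<in> cyl R {0..}" and "v \<in> tangent_cone (cyl R {0..}) p"
  shows "inward_normal R p \<bullet> v = 0"
proof -
  have "- 2 * r * c * (inward_normal R p \<bullet> v) = 0"
    by (rule tangent_cone_derivative_zero[OF assms(2) has_derivative_cone_fun])
       (use assms(1) in \<open>auto simp: cyl_nonneg_iff\<close>)
  then show ?thesis using r_pos c_pos by simp
qed

text \<open>The region lies in the negative cone of \<open>cone_fun\<close>, whose gradient is a negative multiple of
  \<open>inward_normal\<close>. This is what singles out the sign of the normal of the cylinder.\<close>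
lemma tangent_cone_region_inward:
  assumes "cone_fun R p = 0" and "v \<in> tangent_cone (closure (region_D R)) p"
  shows "inward_normal R p \<bullet> v \<ge> 0"
proof -
  have "0 \<le> - (- 2 * r * c * (inward_normal R p \<bullet> v))"
    by (rule tangent_cone_derivative_nonneg[OF assms(2) has_derivative_minus[OF has_derivative_cone_fun]])
       (use assms(1) in \<open>auto simp: closure_region_D_iff\<close>)
  then show ?thesis
    using r_pos c_pos mult_le_cancel_left_pos[of "2 * r * c" 0 "inward_normal R p \<bullet> v"] by simp
qed

text \<open>The region lies above the sphere. This is what singles out the sign of the normal of the cap.\<close>
lemma tangent_cone_region_upward:
  assumes "p \<bullet> p = c\<^sup>2" and "v \<in> tangent_cone (closure (region_D R)) p"
  shows "p \<bullet> v \<ge> 0"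
proof -
  have "0 \<le> 2 * (p \<bullet> v)"
    by (rule tangent_cone_derivative_nonneg[OF assms(2) has_derivative_inner_self])
       (use assms(1) in \<open>auto simp: closure_region_D_iff\<close>)
  then show ?thesis by simp
qed

lemma tangent_cone_sphere:
  fixes p :: "real^3"
  assumes "p \<bullet> p = c\<^sup>2" and "v \<in> tangent_cone M p" and "\<And>x. x \<in> M \<Longrightarrow> x \<bullet> x = c\<^sup>2"
  shows "p \<bullet> v = 0"
proof -
  have "2 * (p \<bullet> v) = 0"
    by (rule tangent_cone_derivative_zero[OF assms(2) has_derivative_inner_self])
       (use assms in auto)
  then show ?thesis by simp
qed

lemma cyl_0_inner_self: "p \<in> cyl R {0} \<Longrightarrow> p \<bullet> p = c\<^sup>2"
  by (simp add: cyl_0_iff inner_self_eq)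

lemma cone_fun_nonpos_iff:
  assumes "p$3 > 0"
  shows "cone_fun R p \<le> 0 \<longleftrightarrow> norm (p$1, p$2) \<le> r * p$3"
proof -
  have "norm (p$1, p$2) \<le> r * p$3 \<longleftrightarrow> (norm (p$1, p$2))\<^sup>2 \<le> (r * p$3)\<^sup>2"
    using r_pos assms by (simp add: abs_le_square_iff[symmetric])
  then show ?thesis
    by (simp add: norm_Pair cone_fun_def power_mult_distrib)
qed

text \<open>Radial projection to the sphere carries the ray from \<open>p\<close> in the direction of any vector \<open>q\<close> of
  the solid cone to a curve in the cap, since the cone is closed under addition. At boundary points
  of the cap this yields enough tangent vectors without distinguishing cases.\<close>
lemma tangent_cone_Omega_project:
  assumes p: "p \<in> Omega R" and q: "q$3 > 0" "cone_fun R q \<le> 0"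
  shows "q - (p \<bullet> q / c\<^sup>2) *\<^sub>R p \<in> tangent_cone (Omega R) p"
proof (rule tangent_coneI[where \<epsilon> = 1])
  let ?x = "\<lambda>s. p + s *\<^sub>R q"
  let ?m = "\<lambda>s. p \<bullet> p + 2 * s * (p \<bullet> q) + s\<^sup>2 * (q \<bullet> q)"
  let ?c = "\<lambda>s. (c / sqrt (?m s)) *\<^sub>R ?x s"
  have p': "p$3 > 0" "cone_fun R p \<le> 0" "p \<bullet> p = c\<^sup>2" using p by (simp_all add: Omega_iff)
  have m: "?m s = ?x s \<bullet> ?x s" for s
    by (simp add: inner_add_left inner_add_right power2_eq_square inner_commute algebra_simps)
  show "?c s \<in> Omega R" if s: "0 \<le> s" "s \<le> 1" for s
  proof -
    have x3: "?x s $ 3 > 0" using p' q s by (simp add: add_pos_nonneg)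
    have "norm (?x s $ 1, ?x s $ 2) \<le> norm (p$1, p$2) + s * norm (q$1, q$2)"
      using norm_triangle_ineq[of "(p$1, p$2)" "s *\<^sub>R (q$1, q$2)"] s by (simp only: norm_scaleR) simp
    also have "\<dots> \<le> r * p$3 + s * (r * q$3)"
      using p' q s cone_fun_nonpos_iff by (intro add_mono mult_left_mono) auto
    finally have "cone_fun R (?x s) \<le> 0"
      using x3 by (simp add: cone_fun_nonpos_iff algebra_simps)
    moreover have "?m s > 0" unfolding m using x3 by (metis inner_gt_zero_iff less_irrefl zero_index)
    ultimately show ?thesis
      using x3 c_pos by (simp add: Omega_iff cone_fun_scaleR mult_nonneg_nonpos flip: m)
        (simp add: power2_eq_square flip: m)
  qed
  have "((\<lambda>s. c / sqrt (?m s)) has_field_derivative - (p \<bullet> q) / c\<^sup>2) (at 0)"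
    using c_pos by (auto intro!: derivative_eq_intros simp: p'(3) field_simps power2_eq_square)
  moreover have "(?x has_vector_derivative q) (at 0)" by (auto intro!: derivative_eq_intros)
  ultimately have "(?c has_vector_derivative (c / sqrt (?m 0)) *\<^sub>R q + (- (p \<bullet> q) / c\<^sup>2) *\<^sub>R ?x 0) (at 0)"
    by (rule has_vector_derivative_scaleR)
  then show "(?c has_vector_derivative q - (p \<bullet> q / c\<^sup>2) *\<^sub>R p) (at 0)"
    using c_pos by (simp add: p'(3))
qed (use p in \<open>auto simp: Omega_iff\<close>)

section \<open>Normals, conormals and contact angle\<close>

lemma inward_normal_in_tangent_cone:
  assumes p: "p \<in> cyl R {0..}"
  shows "inward_normal R p \<in> tangent_cone (closure (region_D R)) p"
proof (rule tangent_cone_segmentI)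
  let ?N = "inward_normal R p"
  have p': "p$3 \<ge> 1" "cone_fun R p = 0" using p by (simp_all add: cyl_nonneg_iff)
  \<comment> \<open>Up to \<open>s = r\<close> the horizontal part of \<open>p\<close> is only shrunk, by the factor \<open>1 - s / (r c)\<close>, and not
    reversed.\<close>
  show "p + s *\<^sub>R ?N \<in> closure (region_D R)" if s: "0 \<le> s" "s \<le> r" for s
  proof -
    have "(p + s *\<^sub>R ?N) \<bullet> (p + s *\<^sub>R ?N) = p \<bullet> p + s\<^sup>2 * (p$3)\<^sup>2"
      using inward_normal_inner_self inward_normal_inner_position p'
      by (simp add: inner_add_left inner_add_right power2_eq_square inner_commute)
    moreover have "c\<^sup>2 * 1 \<le> c\<^sup>2 * (p$3)\<^sup>2" using p' by (intro mult_left_mono) auto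
    moreover have "p \<bullet> p = c\<^sup>2 * (p$3)\<^sup>2" "0 \<le> s\<^sup>2 * (p$3)\<^sup>2" using p' by (simp_all add: inner_self_eq)
    ultimately have 1: "(p + s *\<^sub>R ?N) \<bullet> (p + s *\<^sub>R ?N) \<ge> c\<^sup>2" by linarith
    have 2: "(p + s *\<^sub>R ?N)$3 > 0" using p' s r_pos c_pos by (simp add: add_pos_nonneg)
    have q: "(p$1)\<^sup>2 + (p$2)\<^sup>2 = r\<^sup>2 * (p$3)\<^sup>2" using p' by (simp add: cone_fun_def)
    let ?k = "1 - s / (r * c)"
    have "cone_fun R (p + s *\<^sub>R ?N) = ?k\<^sup>2 * ((p$1)\<^sup>2 + (p$2)\<^sup>2) - r\<^sup>2 * ((1 + s * r / c) * p$3)\<^sup>2"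
    proof -
      have "(p + s *\<^sub>R ?N)$1 = ?k * p$1" "(p + s *\<^sub>R ?N)$2 = ?k * p$2"
        "(p + s *\<^sub>R ?N)$3 = (1 + s * r / c) * p$3"
        by (simp_all add: algebra_simps)
      then show ?thesis unfolding cone_fun_def by (simp only: power_mult_distrib distrib_left)
    qed
    also have "\<dots> = (r * p$3)\<^sup>2 * (?k\<^sup>2 - (1 + s * r / c)\<^sup>2)"
      unfolding q by (simp add: right_diff_distrib power_mult_distrib)
    also have "\<dots> \<le> 0"
    proof -
      have "s / (r * c) \<le> 1" using s r_pos cosh_real_ge_1[of R]
        by (simp add: divide_le_eq) (smt (verit) mult_le_cancel_left1)
      moreover have "0 \<le> s / (r * c)" "0 \<le> s * r / c" using s r_pos c_pos by simp_all
      ultimately have "?k\<^sup>2 \<le> (1 + s * r / c)\<^sup>2"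
        by (intro power_mono) linarith+
      then show ?thesis by (simp add: mult_nonneg_nonpos)
    qed
    finally show ?thesis using 1 2 by (simp add: closure_region_D_iff)
  qed
qed (use r_pos in auto)

lemma normal_N_eq:
  assumes p: "p \<in> cyl R {0..}"
  shows "normal_N R p = inward_normal R p"
  unfolding normal_N_def
proof (rule the_equality)
  let ?N = "inward_normal R p" and ?M = "cyl R {0..}"
  have p': "p$3 \<ge> 1" "p$3 > 0" "cone_fun R p = 0" using p by (auto simp: cyl_nonneg_iff)
  show "is_unit_normal ?M p ?N \<and> ?N \<in> tangent_cone (closure (region_D R)) p"
    using inward_normal_in_tangent_cone[OF p] inward_normal_inner_self tangent_cone_cyl_orthogonal[OF p] p'
    by (simp add: is_unit_normal_def hyp_inner_def)
  show "n = ?N" if n: "is_unit_normal ?M p n \<and> n \<in> tangent_cone (closure (region_D R)) p" for n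
  proof -
    have "n \<bullet> v = 0" if "v \<in> tangent_cone ?M p" for v
      using n that p' by (simp add: is_unit_normal_def hyp_inner_def)
    moreover have "rotation p \<in> tangent_cone ?M p"
      using rotation_in_tangent_cone[OF p, of 1] by simp
    moreover have "n \<bullet> n = (p$3)\<^sup>2" using n p' by (simp add: is_unit_normal_def hyp_inner_def)
    ultimately have "n = ?N \<or> n = - ?N"
      using orthogonal_to_cylinder p' position_in_tangent_cone[OF p] by blast
    moreover have "?N \<bullet> n \<ge> 0" using tangent_cone_region_inward n p' by blast
    ultimately show ?thesis using inward_normal_inner_self p' by auto
  qed
qed

text \<open>Orthogonality to the projections of \<open>e\<^sub>3\<close>, \<open>e\<^sub>3 + r e\<^sub>1\<close> and \<open>e\<^sub>3 + r e\<^sub>2\<close> forces a normal to be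
  radial. These three vectors span the space and lie in the solid cone; unlike \<open>rotation p\<close>, they also
  serve at the pole of the cap.\<close>
lemma normal_Nbar_eq:
  assumes p: "p \<in> Omega R"
  shows "normal_Nbar R p = - (p$3 / c) *\<^sub>R p"
  unfolding normal_Nbar_def
proof (rule the_equality)
  let ?n = "- (p$3 / c) *\<^sub>R p"
  have p': "p$3 > 0" "cone_fun R p \<le> 0" "p \<bullet> p = c\<^sup>2" using p by (simp_all add: Omega_iff)
  have "is_unit_normal (Omega R) p ?n"
    using p' c_pos tangent_cone_sphere[OF p'(3), of _ "Omega R"]
    by (auto simp: is_unit_normal_def hyp_inner_def Omega_iff power2_eq_square)
  moreover have "- ?n \<in> tangent_cone (closure (region_D R)) p"
  proof (rule tangent_cone_segmentI)
    fix s :: real assume s: "0 \<le> s" "s \<le> 1"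
    define k where "k = 1 + s * (p$3 / c)"
    have "k \<ge> 1" using s p' c_pos by (simp add: k_def)
    then have "1 * c\<^sup>2 \<le> k\<^sup>2 * c\<^sup>2" by (intro mult_right_mono) auto
    moreover have "p + s *\<^sub>R - ?n = k *\<^sub>R p" by (simp add: k_def algebra_simps)
    ultimately show "p + s *\<^sub>R - ?n \<in> closure (region_D R)"
      using p' \<open>k \<ge> 1\<close> by (simp add: closure_region_D_iff cone_fun_scaleR mult_nonneg_nonpos power2_eq_square mult.assoc)
  qed simp
  ultimately show "is_unit_normal (Omega R) p ?n \<and> - ?n \<in> tangent_cone (closure (region_D R)) p" ..
  show "n = ?n" if n: "is_unit_normal (Omega R) p n \<and> - n \<in> tangent_cone (closure (region_D R)) p" for n
  proof -
    define k where "k = n \<bullet> p / c\<^sup>2"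
    have *: "n \<bullet> q = k * (p \<bullet> q)" if "q$3 > 0" "cone_fun R q \<le> 0" for q
    proof -
      have "n \<bullet> (q - (p \<bullet> q / c\<^sup>2) *\<^sub>R p) = 0"
        using n tangent_cone_Omega_project[OF p that] p' by (simp add: is_unit_normal_def hyp_inner_def)
      then show ?thesis by (simp add: inner_diff_right k_def)
    qed
    have "n \<bullet> axis 3 1 = k * (p \<bullet> axis 3 1)"
      by (rule *) (simp_all add: cone_fun_def)
    moreover have "n \<bullet> (axis 3 1 + r *\<^sub>R axis 1 1) = k * (p \<bullet> (axis 3 1 + r *\<^sub>R axis 1 1))"
      by (rule *) (simp_all add: cone_fun_def)
    moreover have "n \<bullet> (axis 3 1 + r *\<^sub>R axis 2 1) = k * (p \<bullet> (axis 3 1 + r *\<^sub>R axis 2 1))"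
      by (rule *) (simp_all add: cone_fun_def)
    ultimately have nk: "n = k *\<^sub>R p"
      using r_pos by (simp add: vec3_eq_iff inner_real3 algebra_simps)
    have "n \<bullet> n = (p$3)\<^sup>2" using n p' by (simp add: is_unit_normal_def hyp_inner_def)
    then have "(k * c)\<^sup>2 = (p$3)\<^sup>2" using p' by (simp add: nk power2_eq_square algebra_simps)
    then have "k * c = p$3 \<or> k * c = - p$3" by (simp add: power2_eq_iff)
    moreover have "0 \<le> p \<bullet> - n" using tangent_cone_region_upward[OF p'(3)] n by blast
    then have "k * c\<^sup>2 \<le> 0" using p' by (simp add: nk)
    then have "k * c \<le> 0" using c_pos by (simp add: power2_eq_square mult_le_0_iff)
    ultimately have "k = - (p$3 / c)" using p' c_pos by (auto simp: field_simps)
    then show ?thesis using nk by simp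
  qed
qed

lemma cyl_0_subset: "cyl R {0} \<subseteq> cyl R {0..}" "cyl R {0} \<subseteq> Omega R"
  by (auto simp: cyl_0_iff cyl_nonneg_iff Omega_iff inner_self_eq)

lemma exterior_conormal_candidates:
  assumes p: "p \<in> cyl R {0}" and len: "hyp_inner p n n = 1"
    and n: "\<forall>v\<in>tangent_cone (cyl R {0}) p. hyp_inner p n v = 0"
  shows "n \<bullet> n = 1" and "n \<bullet> rotation p = 0"
proof -
  have "p$3 = 1" using p by (simp add: cyl_0_iff)
  then show "n \<bullet> n = 1" using len by (simp add: hyp_inner_def)
  have "rotation p \<in> tangent_cone (cyl R {0}) p"
    using rotation_in_tangent_cone[OF p, of 1] by simp
  then show "n \<bullet> rotation p = 0" using n \<open>p$3 = 1\<close> by (auto simp: hyp_inner_def)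
qed

text \<open>At height 1 the vectors \<open>inward_normal R p\<close>, \<open>(1 / cosh R) p\<close> and \<open>rotation p\<close> form an orthogonal
  basis, in which the first two are unit vectors.\<close>
lemma orthogonal_to_normal_and_circle:
  assumes p: "p \<in> cyl R {0}" and n: "n \<bullet> inward_normal R p = 0" "n \<bullet> rotation p = 0" "n \<bullet> n = 1"
  shows "n = (1 / c) *\<^sub>R p \<or> n = - (1 / c) *\<^sub>R p"
proof -
  have p': "p$3 = 1" "cone_fun R p = 0" using p by (simp_all add: cyl_0_iff)
  have q: "(p$1)\<^sup>2 + (p$2)\<^sup>2 = r\<^sup>2" using p' by (simp add: cone_fun_def)
  have "inward_normal R p \<bullet> n = 0" using n by (simp add: inner_commute)
  then have eq: "p$1 * n$1 + p$2 * n$2 = r\<^sup>2 * n$3" "n$2 * p$1 = n$1 * p$2"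
    using n r_pos c_pos p' by (simp_all add: inner_inward_normal inner_real3[of n "rotation p"])
  have "n$1 * r\<^sup>2 = p$1 * n$3 * r\<^sup>2" "n$2 * r\<^sup>2 = p$2 * n$3 * r\<^sup>2"
    using eq q by algebra+
  then have nk: "n = n$3 *\<^sub>R p" using r_pos p' by (simp add: vec3_eq_iff)
  have "n \<bullet> n = (n$3)\<^sup>2 * c\<^sup>2"
    by (subst (1 2) nk) (simp add: cyl_0_inner_self[OF p] power2_eq_square)
  then have "(n$3 * c)\<^sup>2 = 1" using n by (simp add: power_mult_distrib)
  then have "n$3 * c = 1 \<or> n$3 * c = -1" by (simp add: power2_eq_1_iff)
  then have "n$3 = 1 / c \<or> n$3 = - (1 / c)" using c_pos by (auto simp: field_simps)
  then show ?thesis using nk by metis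
qed

text \<open>The half-cylinder lies above height 1, so of the two candidates the exterior one points down.\<close>
lemma nu_eq:
  assumes p: "p \<in> cyl R {0}"
  shows "nu R p = - (1 / c) *\<^sub>R p"
  unfolding nu_def exterior_conormal_def
proof (rule the_equality)
  let ?M = "cyl R {0..}" and ?n = "- (1 / c) *\<^sub>R p"
  have p0: "p \<in> ?M" using p cyl_0_subset by blast
  have p': "p$3 = 1" "cone_fun R p = 0" "p \<bullet> p = c\<^sup>2" using p cyl_0_inner_self by (simp_all add: cyl_0_iff)
  have "- ?n \<in> tangent_cone ?M p"
  proof (rule tangent_cone_segmentI)
    fix s :: real assume s: "0 \<le> s" "s \<le> 1"
    have "p + s *\<^sub>R - ?n = (1 + s / c) *\<^sub>R p" by (simp add: algebra_simps)
    then show "p + s *\<^sub>R - ?n \<in> ?M" using p' s c_pos by (simp add: cyl_nonneg_iff cone_fun_scaleR)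
  qed simp
  moreover have "\<forall>v\<in>tangent_cone (cyl R {0}) p. hyp_inner p ?n v = 0"
    using tangent_cone_sphere[OF p'(3), of _ "cyl R {0}"] cyl_0_inner_self by (simp add: hyp_inner_def)
  ultimately show "hyp_inner p ?n ?n = 1 \<and> - ?n \<in> tangent_cone ?M p \<and>
      (\<forall>v\<in>tangent_cone (cyl R {0}) p. hyp_inner p ?n v = 0)"
    using p' c_pos by (simp add: hyp_inner_def power2_eq_square)
  fix n assume n: "hyp_inner p n n = 1 \<and> - n \<in> tangent_cone ?M p \<and>
      (\<forall>v\<in>tangent_cone (cyl R {0}) p. hyp_inner p n v = 0)"
  have "n \<bullet> inward_normal R p = 0"
    using tangent_cone_cyl_orthogonal[OF p0, of "- n"] n by (simp add: inner_commute)
  then have "n = (1 / c) *\<^sub>R p \<or> n = ?n"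
    using orthogonal_to_normal_and_circle[OF p] exterior_conormal_candidates[OF p] n by blast
  moreover have "0 \<le> (- n)$3"
    by (rule tangent_cone_derivative_nonneg[OF _ has_derivative_vec_nth, of _ ?M p])
       (use n p' in \<open>auto simp: cyl_nonneg_iff\<close>)
  moreover have "1 / c > 0" using c_pos by simp
  moreover have "((1 / c) *\<^sub>R p) $ 3 = 1 / c" using p' by simp
  ultimately show "n = ?n" by (metis neg_0_le_iff_le not_le vector_uminus_component)
qed

text \<open>The inward normal of the cylinder is the projection of a vertical vector to the tangent plane of
  the sphere.\<close>
lemma inward_normal_in_tangent_cone_Omega:
  assumes p: "p \<in> cyl R {0}"
  shows "inward_normal R p \<in> tangent_cone (Omega R) p"
proof -
  have p': "p$3 = 1" "cone_fun R p = 0" "p \<in> Omega R" using p cyl_0_subset by (auto simp: cyl_0_iff)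
  let ?q = "(c / r) *\<^sub>R axis 3 1"
  have "?q - (p \<bullet> ?q / c\<^sup>2) *\<^sub>R p \<in> tangent_cone (Omega R) p"
    using tangent_cone_Omega_project[OF p'(3), of ?q] r_pos c_pos by (simp add: cone_fun_def)
  moreover have "?q - (p \<bullet> ?q / c\<^sup>2) *\<^sub>R p = inward_normal R p"
  proof -
    have "c * c = r * r + 1" using c_sq by (simp add: power2_eq_square)
    then have "c / r - 1 / (r * c) = r / c" using r_pos c_pos by (simp add: field_simps)
    then show ?thesis
      using r_pos c_pos p' by (simp add: vec3_eq_iff inner_real3 power2_eq_square mult.commute)
  qed
  ultimately show ?thesis by simp
qed

text \<open>Because of the right angle, the exterior conormal of the cap is the outward normal of the cylinder.
  The opposite sign is excluded because the cap lies in the closure of the region.\<close>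
lemma nubar_eq:
  assumes p: "p \<in> cyl R {0}"
  shows "nubar R p = - inward_normal R p"
  unfolding nubar_def exterior_conormal_def
proof (rule the_equality)
  let ?M = "Omega R" and ?N = "inward_normal R p"
  have p0: "p \<in> cyl R {0..}" using p cyl_0_subset by blast
  have p': "p$3 = 1" "cone_fun R p = 0" "p \<bullet> p = c\<^sup>2" using p cyl_0_inner_self by (simp_all add: cyl_0_iff)
  have "\<forall>v\<in>tangent_cone (cyl R {0}) p. hyp_inner p (- ?N) v = 0"
    using tangent_cone_cyl_orthogonal[OF p0] tangent_cone_mono[OF cyl_0_subset(1)]
    by (auto simp: hyp_inner_def)
  then show "hyp_inner p (- ?N) (- ?N) = 1 \<and> - (- ?N) \<in> tangent_cone ?M p \<and>
      (\<forall>v\<in>tangent_cone (cyl R {0}) p. hyp_inner p (- ?N) v = 0)"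
    using p' inward_normal_in_tangent_cone_Omega[OF p] inward_normal_inner_self by (simp add: hyp_inner_def)
  fix n assume n: "hyp_inner p n n = 1 \<and> - n \<in> tangent_cone ?M p \<and>
      (\<forall>v\<in>tangent_cone (cyl R {0}) p. hyp_inner p n v = 0)"
  have "p \<bullet> - n = 0"
    by (rule tangent_cone_sphere[OF p'(3)]) (use n in \<open>auto simp: Omega_iff\<close>)
  then have "n \<bullet> p = 0" by (simp add: inner_commute)
  then have "n = ?N \<or> n = - ?N"
    using orthogonal_to_cylinder[OF p'(2)] exterior_conormal_candidates[OF p] n p' by simp
  moreover have "Omega R \<subseteq> closure (region_D R)" by (auto simp: Omega_iff closure_region_D_iff)
  then have "0 \<le> ?N \<bullet> - n"
    using tangent_cone_region_inward[OF p'(2)] n tangent_cone_mono by blast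
  ultimately show "n = - ?N" using inward_normal_inner_self p' by auto
qed

lemma contact_angle_eq: "contact_angle R = pi / 2"
  unfolding contact_angle_def
proof (rule the_equality)
  have orth: "hyp_inner p (normal_N R p) (normal_Nbar R p) = 0" if "p \<in> cyl R {0}" for p
  proof -
    have "p \<in> cyl R {0..}" "p \<in> Omega R" "cone_fun R p = 0"
      using that cyl_0_subset by (auto simp: cyl_0_iff)
    then show ?thesis
      using inward_normal_inner_position by (simp add: normal_N_eq normal_Nbar_eq hyp_inner_def)
  qed
  then show "0 < pi / 2 \<and> pi / 2 < pi \<and>
      (\<forall>p\<in>cyl R {0}. cos (pi / 2) = hyp_inner p (normal_N R p) (normal_Nbar R p))" by simp
  fix \<gamma> :: real assume \<gamma>: "0 < \<gamma> \<and> \<gamma> < pi \<and>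
      (\<forall>p\<in>cyl R {0}. cos \<gamma> = hyp_inner p (normal_N R p) (normal_Nbar R p))"
  have "Psi R 0 \<in> cyl R {0}" using Psi_in_cyl[of 0 "{0}"] by simp
  then have "cos \<gamma> = cos (pi / 2)" using \<gamma> orth by (metis cos_pi_half)
  then show "\<gamma> = pi / 2" using \<gamma> cos_inj_pi[of \<gamma> "pi / 2"] by simp
qed

section \<open>Second fundamental forms\<close>

text \<open>The contact angle is a right angle, which removes the term of the cylinder, and the term of the
  support vanishes because the hemisphere is totally geodesic.\<close>
lemma qcoef_eq_0:
  assumes p: "p \<in> cyl R {0}"
  shows "qcoef R p = 0"
proof -
  let ?V = "\<lambda>x. - normal_Nbar R x" and ?X = "nubar R p"
  have p0: "p \<in> Omega R" using p cyl_0_subset by blast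
  have p': "p$3 = 1" "cone_fun R p = 0" using p by (simp_all add: cyl_0_iff)
  have "((\<lambda>x. (x$3 / c) *\<^sub>R x) has_derivative (\<lambda>v. (p$3 / c) *\<^sub>R v + (v$3 / c) *\<^sub>R p)) (at p within Omega R)"
    using c_pos by (auto intro!: derivative_eq_intros has_derivative_vec_nth simp: fun_eq_iff)
  then have "(?V has_derivative (\<lambda>v. (p$3 / c) *\<^sub>R v + (v$3 / c) *\<^sub>R p)) (at p within Omega R)"
    by (rule has_derivative_transform[OF p0, rotated]) (simp add: normal_Nbar_eq)
  moreover have "- ?X \<in> tangent_cone (Omega R) p"
    using inward_normal_in_tangent_cone_Omega[OF p] by (simp add: nubar_eq[OF p])
  ultimately have "deriv_along (Omega R) ?V p ?X = (p$3 / c) *\<^sub>R ?X + (?X$3 / c) *\<^sub>R p"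
    using deriv_along_eq[OF _ disjI2] by fast
  moreover have "?X \<bullet> ?V p = 0"
    using inward_normal_inner_position[OF p'(2)] by (simp add: nubar_eq[OF p] normal_Nbar_eq[OF p0])
  ultimately have "cov_deriv (Omega R) ?V p ?X = 0"
    using p' by (simp add: cov_deriv_H3 H3_def normal_Nbar_eq[OF p0])
  then show ?thesis
    by (simp add: qcoef_def contact_angle_eq form_Abar_def second_form_def hyp_inner_def cot_def)
qed

lemma form_A_eq:
  assumes p: "p \<in> cyl R {0..}" and X: "X = p \<or> X = rotation p"
  shows "form_A R p X Y = ((r / c) * (X \<bullet> Y) - inward_normal R X \<bullet> Y + (X$3 / p$3) * (inward_normal R p \<bullet> Y)) / (p$3)\<^sup>2"
proof -
  have p': "p$3 > 0" "cone_fun R p = 0" using p by (auto simp: cyl_nonneg_iff)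
  have "linear (inward_normal R)"
    by (rule linearI) (simp_all add: vec3_eq_iff distrib_left add_divide_distrib diff_divide_distrib)
  then have "(inward_normal R has_derivative inward_normal R) (at p within cyl R {0..})"
    by (simp add: bounded_linear_imp_has_derivative linear_linear)
  then have "(normal_N R has_derivative inward_normal R) (at p within cyl R {0..})"
    by (rule has_derivative_transform[OF p, rotated]) (simp add: normal_N_eq)
  moreover have "X \<in> tangent_cone (cyl R {0..}) p"
    using X position_in_tangent_cone[OF p] rotation_in_tangent_cone[OF p, of 1] by auto
  ultimately have "deriv_along (cyl R {0..}) (normal_N R) p X = inward_normal R X"
    using deriv_along_eq[OF _ disjI1] by fast
  moreover have "X \<bullet> inward_normal R p = 0"
    using X inward_normal_inner_position[OF p'(2)] inward_normal_inner_rotation by (auto simp: inner_commute)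
  ultimately have "cov_deriv (cyl R {0..}) (normal_N R) p X
      = inward_normal R X - (1 / p$3) *\<^sub>R ((r * p$3 / c) *\<^sub>R X + X$3 *\<^sub>R inward_normal R p)"
    using p' by (simp add: cov_deriv_H3 H3_def normal_N_eq[OF p])
  then show ?thesis
    using p' by (simp add: form_A_def second_form_def hyp_inner_def inner_diff_left inner_add_left
        add_divide_distrib diff_divide_distrib)
qed

lemma has_derivative_Psi:
  "(Psi R has_derivative (\<lambda>v. v$1 *\<^sub>R Psi R q + v$2 *\<^sub>R rotation (Psi R q))) (at q)"
proof -
  have eq: "Psi R q = exp (q$1) *\<^sub>R ((r * cos (q$2)) *\<^sub>R axis 1 1 + (r * sin (q$2)) *\<^sub>R axis 2 1 + axis 3 1)" for q
    by (simp add: vec3_eq_iff)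
  have "((\<lambda>q. exp (q$1) *\<^sub>R ((r * cos (q$2)) *\<^sub>R axis 1 1 + (r * sin (q$2)) *\<^sub>R axis 2 1 + axis 3 1))
      has_derivative (\<lambda>v. v$1 *\<^sub>R Psi R q + v$2 *\<^sub>R rotation (Psi R q))) (at q)"
    by (rule derivative_eq_intros has_derivative_vec_nth refl)+
       (simp add: fun_eq_iff vec3_eq_iff algebra_simps)
  then show ?thesis by (simp add: eq[abs_def])
qed

lemma pd_Psi:
  "pd UNIV 1 (Psi R) q = Psi R q" "pd UNIV 2 (Psi R) q = rotation (Psi R q)"
  by (simp_all add: pd_open[OF has_derivative_Psi open_UNIV] axis_def)

lemma first_form_eq:
  "first_form R q $ 1 $ 1 = c\<^sup>2" "first_form R q $ 2 $ 2 = r\<^sup>2"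
  "first_form R q $ 1 $ 2 = 0" "first_form R q $ 2 $ 1 = 0"
  using rotation_inner_self[OF cone_fun_Psi[of q]] inner_self_eq[of "Psi R q"]
    rotation_inner_position[of "Psi R q"] cone_fun_Psi[of q]
  by (simp_all add: first_form_def pd_Psi hyp_inner_def inner_commute power2_eq_square)

lemma inv_form_eq:
  "inv_form R q $ 1 $ 1 = 1 / c\<^sup>2" "inv_form R q $ 2 $ 2 = 1 / r\<^sup>2"
  "inv_form R q $ 1 $ 2 = 0" "inv_form R q $ 2 $ 1 = 0"
proof -
  have "matrix_inv (first_form R q) = vector [vector [1 / c\<^sup>2, 0], vector [0, 1 / r\<^sup>2]]"
    by (rule matrix_inv_eqI)
       (use r_pos c_pos in \<open>simp add: matrix_matrix_mult_def mat_def vec_eq_iff forall_2 sum_2 first_form_eq\<close>)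
  then show "inv_form R q $ 1 $ 1 = 1 / c\<^sup>2" "inv_form R q $ 2 $ 2 = 1 / r\<^sup>2"
    "inv_form R q $ 1 $ 2 = 0" "inv_form R q $ 2 $ 1 = 0"
    by (simp_all add: inv_form_def)
qed

lemma area_density_eq: "area_density R q = r * c"
  using r_pos c_pos by (simp add: area_density_def det_2 first_form_eq real_sqrt_mult mult.commute)

text \<open>The principal curvatures \<open>tanh R\<close> and \<open>coth R\<close> have product 1, so the left-hand side is the square of
  their difference.\<close>
lemma norm_A_sq_eq:
  assumes "q$1 \<ge> 0"
  shows "norm_A_sq R q - 2 = 1 / (r\<^sup>2 * c\<^sup>2)"
proof -
  let ?p = "Psi R q"
  have p: "?p \<in> cyl R {0..}" using Psi_in_cyl assms by simp
  have p': "?p$3 > 0" "cone_fun R ?p = 0" using cone_fun_Psi by simp_all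
  have rot: "inward_normal R (rotation ?p) = - (1 / (r * c)) *\<^sub>R rotation ?p"
    by (simp add: vec3_eq_iff)
  have pp: "?p \<bullet> ?p = c\<^sup>2 * (?p$3)\<^sup>2" using inner_self_eq[of ?p] p' by simp
  note in1 = inward_normal_inner_position[OF p'(2)] inward_normal_inner_rotation[of ?p]
    rotation_inner_position[of ?p] rotation_inner_self[OF p'(2)]
  have c2: "c * c = r * r + 1" using c_sq by (simp add: power2_eq_square)
  have tt: "form_A R ?p ?p ?p = r * c"
    unfolding form_A_eq[OF p disjI1[OF refl]] pp in1 using p'(1) c_pos by (simp add: power2_eq_square)
  have t\<theta>: "form_A R ?p ?p (rotation ?p) = 0"
    unfolding form_A_eq[OF p disjI1[OF refl]] in1 by (simp add: in1 inner_commute[of ?p])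
  have \<theta>t: "form_A R ?p (rotation ?p) ?p = 0"
    unfolding form_A_eq[OF p disjI2[OF refl]] in1 rot by (simp add: in1)
  have \<theta>\<theta>: "form_A R ?p (rotation ?p) (rotation ?p) = r * c"
  proof -
    have "form_A R ?p (rotation ?p) (rotation ?p) = r\<^sup>2 * (r / c + 1 / (r * c))"
      unfolding form_A_eq[OF p disjI2[OF refl]] rot inner_scaleR_left in1 inner_minus_left
      using p'(1) by (simp add: field_simps power2_eq_square)
    also have "r / c + 1 / (r * c) = c * c / (r * c)"
      unfolding c2 using r_pos c_pos by (simp add: field_simps)
    also have "r\<^sup>2 * (c * c / (r * c)) = r * c"
      using r_pos c_pos by (simp add: power2_eq_square)
    finally show ?thesis .
  qed
  have "norm_A_sq R q = (r * c)\<^sup>2 * (1 / c\<^sup>2)\<^sup>2 + (r * c)\<^sup>2 * (1 / r\<^sup>2)\<^sup>2"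
    unfolding norm_A_sq_def Let_def sum_2 inv_form_eq pd_Psi tt t\<theta> \<theta>t \<theta>\<theta>
    by (simp add: power2_eq_square)
  also have "\<dots> = (r\<^sup>2 * r\<^sup>2 + c\<^sup>2 * c\<^sup>2) / (r\<^sup>2 * c\<^sup>2)"
    using r_pos c_pos by (simp add: field_simps power2_eq_square)
  also have "r\<^sup>2 * r\<^sup>2 + c\<^sup>2 * c\<^sup>2 = 2 * (r\<^sup>2 * c\<^sup>2) + 1"
    unfolding c_sq by (simp add: algebra_simps)
  finally show ?thesis using r_pos c_pos by (simp add: add_divide_distrib)
qed

section \<open>Gradient and Jacobi operator in coordinates\<close>

context
  fixes I :: "real set" and u :: "real^3 \<Rightarrow> real" and U1 U2 :: "real \<Rightarrow> real \<Rightarrow> real"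
  assumes I_nonneg: "I \<subseteq> {0..}" and I_perfect: "\<And>t. t \<in> I \<Longrightarrow> t islimpt I"
    and U1: "\<And>t \<theta>. t \<in> I \<Longrightarrow>
      ((\<lambda>t. u (Psi R (vector [t, \<theta>]))) has_real_derivative U1 t \<theta>) (at t within I)"
    and U2: "\<And>t \<theta>. t \<in> I \<Longrightarrow>
      ((\<lambda>\<theta>. u (Psi R (vector [t, \<theta>]))) has_real_derivative U2 t \<theta>) (at \<theta>)"
begin

lemma pd_strip_comp_Psi:
  assumes "t \<in> I"
  shows "pd (strip I) 1 (u \<circ> Psi R) (vector [t, \<theta>]) = U1 t \<theta>"
    and "pd (strip I) 2 (u \<circ> Psi R) (vector [t, \<theta>]) = U2 t \<theta>"
proof -
  show "pd (strip I) 1 (u \<circ> Psi R) (vector [t, \<theta>]) = U1 t \<theta>"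
    by (rule pd_strip_1[OF assms I_perfect[OF assms]])
       (use U1[OF assms] in \<open>simp add: has_real_derivative_iff_has_vector_derivative\<close>)
  show "pd (strip I) 2 (u \<circ> Psi R) (vector [t, \<theta>]) = U2 t \<theta>"
    by (rule pd_strip_2[OF assms])
       (use U2[OF assms] in \<open>simp add: has_real_derivative_iff_has_vector_derivative\<close>)
qed

lemma grad_sq_eq:
  assumes "t \<in> I"
  shows "grad_sq R I u (vector [t, \<theta>]) = (U1 t \<theta>)\<^sup>2 / c\<^sup>2 + (U2 t \<theta>)\<^sup>2 / r\<^sup>2"
  using assms by (simp add: grad_sq_def sum_2 inv_form_eq pd_strip_comp_Psi power2_eq_square)

lemma jacobi_eq:
  assumes t: "t \<in> I"
    and U11: "((\<lambda>t. U1 t \<theta>) has_real_derivative a) (at t within I)"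
    and U22: "((\<lambda>\<theta>. U2 t \<theta>) has_real_derivative b) (at \<theta>)"
  shows "jacobi R I u (vector [t, \<theta>]) = a / c\<^sup>2 + b / r\<^sup>2 + u (Psi R (vector [t, \<theta>])) / (r\<^sup>2 * c\<^sup>2)"
proof -
  let ?G = "\<lambda>i x. area_density R x * (\<Sum>j\<in>UNIV. inv_form R x $ i $ j * pd (strip I) j (u \<circ> Psi R) x)"
  have G1: "?G 1 (vector [t', \<theta>]) = r * c * (U1 t' \<theta> / c\<^sup>2)" if "t' \<in> I" for t'
    using that by (simp add: sum_2 inv_form_eq area_density_eq pd_strip_comp_Psi)
  have G2: "?G 2 (vector [t, \<theta>']) = r * c * (U2 t \<theta>' / r\<^sup>2)" for \<theta>'
    using t by (simp add: sum_2 inv_form_eq area_density_eq pd_strip_comp_Psi)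
  have "((\<lambda>t. r * c * (U1 t \<theta> / c\<^sup>2)) has_vector_derivative r * c * (a / c\<^sup>2)) (at t within I)"
    unfolding has_real_derivative_iff_has_vector_derivative[symmetric]
    by (intro DERIV_cmult DERIV_cdivide U11)
  then have "((\<lambda>t. ?G 1 (vector [t, \<theta>])) has_vector_derivative r * c * (a / c\<^sup>2)) (at t within I)"
    by (rule has_vector_derivative_transform[OF t, rotated]) (use G1 in auto)
  then have 1: "pd (strip I) 1 (?G 1) (vector [t, \<theta>]) = r * c * (a / c\<^sup>2)"
    by (rule pd_strip_1[OF t I_perfect[OF t]])
  have "((\<lambda>\<theta>. r * c * (U2 t \<theta> / r\<^sup>2)) has_vector_derivative r * c * (b / r\<^sup>2)) (at \<theta>)"
    unfolding has_real_derivative_iff_has_vector_derivative[symmetric]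
    by (intro DERIV_cmult DERIV_cdivide U22)
  then have "((\<lambda>\<theta>. ?G 2 (vector [t, \<theta>])) has_vector_derivative r * c * (b / r\<^sup>2)) (at \<theta>)"
    by (simp only: G2)
  then have 2: "pd (strip I) 2 (?G 2) (vector [t, \<theta>]) = r * c * (b / r\<^sup>2)"
    by (rule pd_strip_2[OF t])
  have "laplacian R I u (vector [t, \<theta>]) = a / c\<^sup>2 + b / r\<^sup>2"
  proof -
    have "(\<Sum>i\<in>UNIV. pd (strip I) i (?G i) (vector [t, \<theta>])) = r * c * (a / c\<^sup>2) + r * c * (b / r\<^sup>2)"
      unfolding sum_2[of "\<lambda>i. pd (strip I) i (?G i) (vector [t, \<theta>])"] 1 2 ..
    then show ?thesis
      unfolding laplacian_def area_density_eq using r_pos c_pos by (simp add: field_simps)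
  qed
  moreover have "norm_A_sq R (vector [t, \<theta>]) - 2 = 1 / (r\<^sup>2 * c\<^sup>2)"
    by (rule norm_A_sq_eq) (use t I_nonneg in auto)
  ultimately show ?thesis by (simp add: jacobi_def)
qed

end

section \<open>Regularity in coordinates\<close>

lemma Psi_vector_derivatives:
  "((\<lambda>t. Psi R (vector [t, \<theta>])) has_vector_derivative Psi R (vector [t, \<theta>])) (at t within I)"
  "((\<lambda>\<theta>. Psi R (vector [t, \<theta>])) has_vector_derivative rotation (Psi R (vector [t, \<theta>]))) (at \<theta> within I)"
proof -
  have 1: "((\<lambda>t. vector [t, \<theta>] :: real^2) has_vector_derivative axis 1 1) (at t within I)"
  proof -
    have "(\<lambda>t. vector [t, \<theta>] :: real^2) = (\<lambda>t. t *\<^sub>R axis 1 1 + \<theta> *\<^sub>R axis 2 1)"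
      by (simp add: fun_eq_iff vec_eq_iff forall_2 axis_def)
    then show ?thesis by (auto intro!: derivative_eq_intros)
  qed
  have 2: "((\<lambda>\<theta>. vector [t, \<theta>] :: real^2) has_vector_derivative axis 2 1) (at \<theta> within I)"
  proof -
    have "(\<lambda>\<theta>. vector [t, \<theta>] :: real^2) = (\<lambda>\<theta>. t *\<^sub>R axis 1 1 + \<theta> *\<^sub>R axis 2 1)"
      by (simp add: fun_eq_iff vec_eq_iff forall_2 axis_def)
    then show ?thesis by (auto intro!: derivative_eq_intros)
  qed
  show "((\<lambda>t. Psi R (vector [t, \<theta>])) has_vector_derivative Psi R (vector [t, \<theta>])) (at t within I)"
    using vector_derivative_diff_chain_within[OF 1 has_derivative_at_withinI[OF has_derivative_Psi]]
    by (simp add: o_def axis_def)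
  show "((\<lambda>\<theta>. Psi R (vector [t, \<theta>])) has_vector_derivative rotation (Psi R (vector [t, \<theta>]))) (at \<theta> within I)"
    using vector_derivative_diff_chain_within[OF 2 has_derivative_at_withinI[OF has_derivative_Psi]]
    by (simp add: o_def axis_def)
qed

lemma comp_Psi_derivatives:
  fixes g :: "real^3 \<Rightarrow> real"
  assumes "g differentiable (at (Psi R (vector [t, \<theta>])))"
  shows "((\<lambda>t. g (Psi R (vector [t, \<theta>]))) has_real_derivative
          frechet_derivative g (at (Psi R (vector [t, \<theta>]))) (Psi R (vector [t, \<theta>]))) (at t within I)"
    and "((\<lambda>\<theta>. g (Psi R (vector [t, \<theta>]))) has_real_derivative
          frechet_derivative g (at (Psi R (vector [t, \<theta>]))) (rotation (Psi R (vector [t, \<theta>])))) (at \<theta> within I)"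
  using vector_derivative_diff_chain_within[OF Psi_vector_derivatives(1)
      has_derivative_at_withinI[OF assms[unfolded frechet_derivative_works]]]
    vector_derivative_diff_chain_within[OF Psi_vector_derivatives(2)
      has_derivative_at_withinI[OF assms[unfolded frechet_derivative_works]]]
  unfolding has_real_derivative_iff_has_vector_derivative o_def by blast+

lemma position_in_tangent_cone_truncated:
  assumes p: "p \<in> cyl R {0}" and "T > 0"
  shows "(1 / c) *\<^sub>R p \<in> tangent_cone (cyl R {0..T}) p"
proof (rule tangent_cone_segmentI)
  show "c * (exp T - 1) > 0" using \<open>T > 0\<close> by simp
  fix s assume s: "0 \<le> s" "s \<le> c * (exp T - 1)"
  have "p + s *\<^sub>R (1 / c) *\<^sub>R p = (1 + s / c) *\<^sub>R p" by (simp add: algebra_simps)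
  moreover have "s / c \<le> exp T - 1" "0 \<le> s / c" using s by (simp_all add: divide_le_eq mult.commute)
  then have "1 + s / c \<le> exp T" "1 + s / c \<ge> 1" by linarith+
  then have "ln (1 + s / c) \<le> ln (exp T)" "1 + s / c > 0" "ln (1 + s / c) \<ge> 0"
    by (simp_all del: ln_exp)
  moreover have "p$3 = 1" "cone_fun R p = 0" using p by (simp_all add: cyl_0_iff)
  ultimately show "p + s *\<^sub>R (1 / c) *\<^sub>R p \<in> cyl R {0..T}"
    by (simp add: cyl_iff cone_fun_scaleR)
qed

text \<open>The derivatives are one-sided in \<open>t\<close> and two-sided in \<open>\<theta>\<close>. The last clause translates the conormal
  derivative: the exterior conormal is \<open>- 1 / c\<close> times the velocity of the curve \<open>t \<mapsto> \<Psi>(t, \<theta>)\<close>.\<close>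
lemma smooth_in_coordinates:
  assumes u: "smooth_on_set (cyl R {0..T}) u" and "T > 0"
  obtains U1 U2 U11 U22 :: "real \<Rightarrow> real \<Rightarrow> real"
  where "\<And>t \<theta>. t \<in> {0..T} \<Longrightarrow> ((\<lambda>t. u (Psi R (vector [t, \<theta>]))) has_real_derivative U1 t \<theta>) (at t within {0..T})"
    and "\<And>t \<theta>. t \<in> {0..T} \<Longrightarrow> ((\<lambda>\<theta>. u (Psi R (vector [t, \<theta>]))) has_real_derivative U2 t \<theta>) (at \<theta>)"
    and "\<And>t \<theta>. t \<in> {0..T} \<Longrightarrow> ((\<lambda>t. U1 t \<theta>) has_real_derivative U11 t \<theta>) (at t within {0..T})"
    and "\<And>t \<theta>. t \<in> {0..T} \<Longrightarrow> ((\<lambda>\<theta>. U2 t \<theta>) has_real_derivative U22 t \<theta>) (at \<theta>)"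
    and "continuous_on ({0..T} \<times> UNIV) (\<lambda>(t, \<theta>). u (Psi R (vector [t, \<theta>])))"
    and "\<And>\<theta>. deriv_along (cyl R {0..T}) u (Psi R (vector [0, \<theta>])) (nu R (Psi R (vector [0, \<theta>]))) = - U1 0 \<theta> / c"
proof -
  obtain X f where X: "open X" "cyl R {0..T} \<subseteq> X" and f: "\<forall>k. Ck_on k X f"
    and fu: "\<forall>p\<in>cyl R {0..T}. f p = u p"
    using u unfolding smooth_on_set_def by blast
  define P where "P t \<theta> = Psi R (vector [t, \<theta>])" for t \<theta>
  define f1 where "f1 p = frechet_derivative f (at p) p" for p
  define f2 where "f2 p = frechet_derivative f (at p) (rotation p)" for p
  have PC: "P t \<theta> \<in> cyl R {0..T}" if "t \<in> {0..T}" for t \<theta>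
    using that by (simp add: P_def Psi_in_cyl)
  then have PX: "P t \<theta> \<in> X" if "t \<in> {0..T}" for t \<theta> using that X by blast
  have uP: "f (P t \<theta>) = u (P t \<theta>)" if "t \<in> {0..T}" for t \<theta> using that PC fu by blast
  have df: "f differentiable (at p)" if "p \<in> X" for p
    using f[rule_format, of "Suc 0"] that
    by (simp add: differentiable_on_eq_differentiable_at[OF X(1)])
  have "linear (\<lambda>p::real^3. p)" by (simp add: linear_id[unfolded id_def])
  from has_derivative_linear_field[OF f X(1) this]
  have df1: "f1 differentiable (at p)" if "p \<in> X" for p
    using that unfolding differentiable_on_eq_differentiable_at[OF X(1)] f1_def[abs_def] by blast
  have "linear rotation" by (rule linearI) (simp_all add: vec3_eq_iff)
  from has_derivative_linear_field[OF f X(1) this]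
  have df2: "f2 differentiable (at p)" if "p \<in> X" for p
    using that unfolding differentiable_on_eq_differentiable_at[OF X(1)] f2_def[abs_def] by blast
  show ?thesis
  proof (rule that)
    fix t \<theta> assume t: "t \<in> {0..T}"
    show "((\<lambda>t. u (Psi R (vector [t, \<theta>]))) has_real_derivative f1 (P t \<theta>)) (at t within {0..T})"
      unfolding f1_def P_def
      by (rule has_field_derivative_transform_within[OF
            comp_Psi_derivatives(1)[OF df[OF PX[OF t, unfolded P_def]]] zero_less_one t])
         (rule uP[unfolded P_def])
    show "((\<lambda>\<theta>. u (Psi R (vector [t, \<theta>]))) has_real_derivative f2 (P t \<theta>)) (at \<theta>)"
      using comp_Psi_derivatives(2)[OF df[OF PX[OF t, unfolded P_def]]]
      unfolding f2_def P_def uP[OF t, unfolded P_def] .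
    show "((\<lambda>t. f1 (P t \<theta>)) has_real_derivative frechet_derivative f1 (at (P t \<theta>)) (P t \<theta>)) (at t within {0..T})"
      using comp_Psi_derivatives(1)[OF df1[OF PX[OF t, unfolded P_def]]] unfolding P_def .
    show "((\<lambda>\<theta>. f2 (P t \<theta>)) has_real_derivative frechet_derivative f2 (at (P t \<theta>)) (rotation (P t \<theta>))) (at \<theta>)"
      using comp_Psi_derivatives(2)[OF df2[OF PX[OF t, unfolded P_def]]] unfolding P_def .
  next
    have "continuous_on X f"
      using df by (intro continuous_at_imp_continuous_on ballI differentiable_imp_continuous_within)
    then have "continuous_on ({0..T} \<times> UNIV) (\<lambda>x. f (P (fst x) (snd x)))"
    proof (rule continuous_on_compose2)
      have "P t \<theta> = exp t *\<^sub>R ((r * cos \<theta>) *\<^sub>R axis 1 1 + (r * sin \<theta>) *\<^sub>R axis 2 1 + axis 3 1)" for t \<theta>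
        by (simp add: P_def vec3_eq_iff)
      then show "continuous_on ({0..T} \<times> UNIV) (\<lambda>x. P (fst x) (snd x))"
        by (simp only:) (intro continuous_intros)
      show "(\<lambda>x. P (fst x) (snd x)) ` ({0..T} \<times> UNIV) \<subseteq> X"
        using PX by auto
    qed
    then show "continuous_on ({0..T} \<times> UNIV) (\<lambda>(t, \<theta>). u (Psi R (vector [t, \<theta>])))"
    proof (rule continuous_on_eq)
      fix x :: "real \<times> real" assume "x \<in> {0..T} \<times> UNIV"
      then have "fst x \<in> {0..T}" by (simp add: mem_Times_iff)
      then show "f (P (fst x) (snd x)) = (case x of (t, \<theta>) \<Rightarrow> u (Psi R (vector [t, \<theta>])))"
        using uP by (simp add: P_def case_prod_beta)
    qed
  next
    fix \<theta>
    let ?p = "P 0 \<theta>" and ?D = "frechet_derivative f (at (P 0 \<theta>))"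
    have p: "?p \<in> cyl R {0..T}" "?p \<in> cyl R {0}" "?p \<in> X"
      using PC PX \<open>T > 0\<close> by (auto simp: P_def Psi_in_cyl)
    have D: "(f has_derivative ?D) (at ?p)" using df[OF p(3)] by (simp add: frechet_derivative_works)
    have "(u has_derivative ?D) (at ?p within cyl R {0..T})"
      by (rule has_derivative_transform[OF p(1) _ has_derivative_at_withinI[OF D]]) (use fu in auto)
    moreover have "- nu R ?p \<in> tangent_cone (cyl R {0..T}) ?p"
      using position_in_tangent_cone_truncated[OF p(2) \<open>T > 0\<close>] by (simp add: nu_eq[OF p(2)])
    ultimately have "deriv_along (cyl R {0..T}) u ?p (nu R ?p) = ?D (nu R ?p)"
      by (intro deriv_along_eq disjI2)
    also have "\<dots> = - (1 / c) * ?D ?p"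
      using linear_scale[OF has_derivative_linear[OF D]] by (simp only: nu_eq[OF p(2)]) simp
    finally show "deriv_along (cyl R {0..T}) u (Psi R (vector [0, \<theta>])) (nu R (Psi R (vector [0, \<theta>]))) = - f1 (P 0 \<theta>) / c"
      unfolding f1_def P_def by simp
  qed
qed

section \<open>Eigenfunctions and index\<close>

lemma cyl_subset_H3: "cyl R I \<subseteq> H3"
  by (auto simp: cyl_iff H3_def)

lemma cylE:
  assumes "p \<in> cyl R I"
  obtains t \<theta> where "t \<in> I" "\<theta> \<in> {0..2 * pi}" "p = Psi R (vector [t, \<theta>])"
  using assms unfolding cyl_def strip_def by (auto simp: vec2_eta)

context
  fixes T :: real
  assumes T_pos: "T > 0"
begin

lemma cos_frequency_T: "cos (frequency T m * T) = 0"
proof -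
  have "frequency T m * T = real (2 * m + 1) * (pi / 2)"
    using T_pos by (simp add: frequency_def field_simps)
  moreover have "odd (2 * m + 1)" by simp
  ultimately show ?thesis using cos_zero_iff by blast
qed

lemma mode_Psi:
  assumes "t \<in> {0..T}"
  shows "mode R T m (Psi R (vector [t, \<theta>])) = cos (frequency T m * t)"
  using assms Psi_in_cyl[of "vector [t, \<theta>]" "{0..T}"] by (simp add: mode_def)

lemma mode_in_eigenspace: "mode R T m \<in> eigenspace R T (mode_value R T m)"
proof -
  let ?u = "mode R T m" and ?\<mu> = "frequency T m"
  have smooth: "smooth_on_set (cyl R {0..T}) ?u"
    by (rule smooth_on_set_height[where G = "\<lambda>n x. cos (x + real n * (pi / 2))" and \<alpha> = 0 and \<mu> = ?\<mu>,
          OF cos_derivatives cyl_subset_H3])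
       (simp add: mode_def)
  have D1: "((\<lambda>t. ?u (Psi R (vector [t, \<theta>]))) has_real_derivative - ?\<mu> * sin (?\<mu> * t)) (at t within {0..T})"
    if t: "t \<in> {0..T}" for t \<theta>
  proof -
    have "((\<lambda>t. cos (?\<mu> * t)) has_real_derivative - ?\<mu> * sin (?\<mu> * t)) (at t within {0..T})"
      by (auto intro!: derivative_eq_intros)
    then show ?thesis
      by (rule has_field_derivative_transform_within[OF _ zero_less_one t]) (simp only: mode_Psi)
  qed
  have D2: "((\<lambda>\<theta>. ?u (Psi R (vector [t, \<theta>]))) has_real_derivative 0) (at \<theta>)" if "t \<in> {0..T}" for t \<theta>
    by (simp only: mode_Psi[OF that] DERIV_const)
  have jac: "jacobi R {0..T} ?u (vector [t, \<theta>]) + mode_value R T m * ?u (Psi R (vector [t, \<theta>])) = 0"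
    if t: "t \<in> {0..T}" for t \<theta>
  proof -
    have D11: "((\<lambda>t. - ?\<mu> * sin (?\<mu> * t)) has_real_derivative - ?\<mu>\<^sup>2 * cos (?\<mu> * t)) (at t within {0..T})"
      by (auto intro!: derivative_eq_intros simp: power2_eq_square)
    have "jacobi R {0..T} ?u (vector [t, \<theta>])
        = - ?\<mu>\<^sup>2 * cos (?\<mu> * t) / c\<^sup>2 + 0 / r\<^sup>2 + ?u (Psi R (vector [t, \<theta>])) / (r\<^sup>2 * c\<^sup>2)"
      by (rule jacobi_eq[OF _ islimpt_closed_interval[OF T_pos] D1 D2 t D11 DERIV_const]) auto
    then show ?thesis
      using r_pos c_pos by (simp add: mode_Psi[OF t] mode_value_def field_simps)
  qed
  have neu: "deriv_along (cyl R {0..T}) ?u p (nu R p) - qcoef R p * ?u p = 0" if p: "p \<in> cyl R {0}" for p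
  proof -
    obtain \<theta> where \<theta>: "p = Psi R (vector [0, \<theta>])" using p by (elim cylE) auto
    obtain U1 where U1: "\<And>t \<theta>. t \<in> {0..T} \<Longrightarrow>
          ((\<lambda>t. ?u (Psi R (vector [t, \<theta>]))) has_real_derivative U1 t \<theta>) (at t within {0..T})"
        "\<And>\<theta>. deriv_along (cyl R {0..T}) ?u (Psi R (vector [0, \<theta>])) (nu R (Psi R (vector [0, \<theta>]))) = - U1 0 \<theta> / c"
      by (rule smooth_in_coordinates[OF smooth T_pos]) (rule that)
    have "0 \<in> {0..T}" using T_pos by simp
    then have "at 0 within {0..T} \<noteq> bot"
      using islimpt_closed_interval[OF T_pos] by (simp add: trivial_limit_within)
    then have "U1 0 \<theta> = - ?\<mu> * sin (?\<mu> * 0)"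
      using vector_derivative_unique_within U1(1)[OF \<open>0 \<in> {0..T}\<close>] D1[OF \<open>0 \<in> {0..T}\<close>]
      unfolding has_real_derivative_iff_has_vector_derivative by blast
    then show ?thesis using U1(2)[of \<theta>] qcoef_eq_0[OF p] \<theta> by simp
  qed
  have dir: "?u p = 0" if p: "p \<in> cyl R {T}" for p
  proof -
    obtain \<theta> where \<theta>: "p = Psi R (vector [T, \<theta>])" using p by (elim cylE) auto
    have "T \<in> {0..T}" using T_pos by simp
    from mode_Psi[OF this] show ?thesis by (simp only: \<theta> cos_frequency_T)
  qed
  have "jacobi R {0..T} ?u q + mode_value R T m * ?u (Psi R q) = 0" if "q \<in> strip {0..T}" for q
    using jac[of "q$1" "q$2"] that by (simp add: vec2_eta strip_def)
  then show ?thesis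
    unfolding eigenspace_def using smooth neu dir by (simp add: mode_def)
qed

text \<open>The comparison function of the maximum principle has frequency \<open>1 / cosh R\<close> in \<open>\<theta>\<close>: its second
  derivative then cancels the potential, and the eigenvalue alone decides the sign.\<close>
lemma eigenfunction_negative:
  assumes u: "u \<in> eigenspace R T ev" and "ev < 0"
  shows "u = 0 \<or> (\<exists>m a. ev = mode_value R T m \<and> u = fun_scale a (mode R T m))"
proof -
  let ?U = "\<lambda>t \<theta>. u (Psi R (vector [t, \<theta>]))"
  note E = u[unfolded eigenspace_def mem_Collect_eq]
  have out: "u p = 0" if "p \<notin> cyl R {0..T}" for p
    using E that by blast
  have smooth: "smooth_on_set (cyl R {0..T}) u"
    using E by blast
  have jac: "jacobi R {0..T} u q + ev * u (Psi R q) = 0" if "q \<in> strip {0..T}" for q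
    using E that by blast
  have neu: "deriv_along (cyl R {0..T}) u p (nu R p) - qcoef R p * u p = 0" if "p \<in> cyl R {0}" for p
    using E that by blast
  have dir: "u p = 0" if "p \<in> cyl R {T}" for p
    using E that by blast
  obtain U1 U2 U11 U22 where
      U1: "\<And>t \<theta>. t \<in> {0..T} \<Longrightarrow> ((\<lambda>t. ?U t \<theta>) has_real_derivative U1 t \<theta>) (at t within {0..T})"
    and U2: "\<And>t \<theta>. t \<in> {0..T} \<Longrightarrow> (?U t has_real_derivative U2 t \<theta>) (at \<theta>)"
    and U11: "\<And>t \<theta>. t \<in> {0..T} \<Longrightarrow> ((\<lambda>t. U1 t \<theta>) has_real_derivative U11 t \<theta>) (at t within {0..T})"
    and U22: "\<And>t \<theta>. t \<in> {0..T} \<Longrightarrow> (U2 t has_real_derivative U22 t \<theta>) (at \<theta>)"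
    and cont: "continuous_on ({0..T} \<times> UNIV) (\<lambda>(t, \<theta>). ?U t \<theta>)"
    and nu: "\<And>\<theta>. deriv_along (cyl R {0..T}) u (Psi R (vector [0, \<theta>])) (nu R (Psi R (vector [0, \<theta>]))) = - U1 0 \<theta> / c"
    by (rule smooth_in_coordinates[OF smooth T_pos]) (rule that)
  define \<kappa> where "\<kappa> = 1 / (r\<^sup>2 * c\<^sup>2) + ev"
  have eq: "1 / c\<^sup>2 * U11 t \<theta> + 1 / r\<^sup>2 * U22 t \<theta> + \<kappa> * ?U t \<theta> = 0" if t: "t \<in> {0..T}" for t \<theta>
  proof -
    have "jacobi R {0..T} u (vector [t, \<theta>]) = U11 t \<theta> / c\<^sup>2 + U22 t \<theta> / r\<^sup>2 + ?U t \<theta> / (r\<^sup>2 * c\<^sup>2)"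
      by (rule jacobi_eq[OF _ islimpt_closed_interval[OF T_pos] U1 U2 t U11[OF t] U22[OF t]]) auto
    moreover have "vector [t, \<theta>] \<in> strip {0..T}" using t by (simp add: strip_def)
    ultimately show ?thesis using jac[of "vector [t, \<theta>]"] by (simp add: \<kappa>_def algebra_simps)
  qed
  have neumann: "U1 0 \<theta> = 0" for \<theta>
  proof -
    have p: "Psi R (vector [0, \<theta>]) \<in> cyl R {0}" by (rule Psi_in_cyl) simp
    show ?thesis using neu[OF p] nu[of \<theta>] qcoef_eq_0[OF p] by simp
  qed
  have dirichlet: "?U T \<theta> = 0" for \<theta>
    by (rule dir[OF Psi_in_cyl]) simp
  have periodic: "?U t (\<theta> + 2 * pi) = ?U t \<theta>" for t \<theta>
  proof -
    have "Psi R (vector [t, \<theta> + 2 * pi]) = Psi R (vector [t, \<theta>])" by (simp add: vec3_eq_iff)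
    then show ?thesis by simp
  qed
  have c1: "c > 1" using R_pos cosh_real_strict_mono[of 0 R] by simp
  have AB: "1 / c\<^sup>2 > 0" "1 / r\<^sup>2 > 0" using r_pos by simp_all
  have k: "0 < 1 / c" "1 / c < 1" "\<kappa> < 1 / r\<^sup>2 * (1 / c)\<^sup>2"
    using c1 \<open>ev < 0\<close> by (simp_all add: \<kappa>_def power_divide)
  have inv: "?U t \<theta> = ?U t 0" if "t \<in> {0..T}" "\<theta> \<in> {0..2 * pi}" for t \<theta>
    by (rule rotationally_invariant_solution[where U = ?U and ?U1.0 = U1 and ?U11.0 = U11
          and ?U2.0 = U2 and ?U22.0 = U22 and \<kappa> = \<kappa> and T = T,
          OF AB k cont U1 U11 U2 U22 eq neumann dirichlet periodic that])
  have U22_pi: "U22 t pi = 0" if t: "t \<in> {0..T}" for t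
  proof -
    have U2_0: "U2 t \<theta> = 0" if "\<theta> \<in> {0<..<2 * pi}" for \<theta>
    proof -
      have "(?U t has_real_derivative 0) (at \<theta>)"
      proof (rule has_field_derivative_transform_within_open[OF DERIV_const open_greaterThanLessThan that])
        show "?U t 0 = ?U t y" if "y \<in> {0<..<2 * pi}" for y
          by (rule inv[OF t, symmetric]) (use that in simp)
      qed
      then show ?thesis by (rule DERIV_unique[OF U2[OF t]])
    qed
    have "(U2 t has_real_derivative 0) (at pi)"
    proof (rule has_field_derivative_transform_within_open[OF DERIV_const open_greaterThanLessThan])
      show "pi \<in> {0<..<2 * pi}" by simp
      show "0 = U2 t \<theta>" if "\<theta> \<in> {0<..<2 * pi}" for \<theta> using U2_0[OF that] by simp
    qed
    then show ?thesis by (rule DERIV_unique[OF U22[OF t]])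
  qed
  define w where "w = c\<^sup>2 * \<kappa>"
  have U11_pi: "U11 t pi = - w * ?U t pi" if "t \<in> {0..T}" for t
    using eq[OF that, of pi] U22_pi[OF that] c_pos by (simp add: w_def field_simps)
  have "(\<forall>t\<in>{0..T}. ?U t pi = 0) \<or> (w > 0 \<and> cos (sqrt w * T) = 0 \<and>
      (\<forall>t\<in>{0..T}. ?U t pi = ?U 0 pi * cos (sqrt w * t)))"
  proof (rule neumann_dirichlet_solution[OF T_pos U1])
    show "((\<lambda>t. U1 t pi) has_real_derivative - w * ?U t pi) (at t within {0..T})" if "t \<in> {0..T}" for t
      unfolding U11_pi[OF that, symmetric] by (rule U11[OF that])
  qed (use neumann dirichlet in auto)
  moreover have eqI: "u = v" if v: "\<And>p. p \<notin> cyl R {0..T} \<Longrightarrow> v p = 0"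
      "\<And>t \<theta>. t \<in> {0..T} \<Longrightarrow> ?U t pi = v (Psi R (vector [t, \<theta>]))" for v
  proof
    fix p
    show "u p = v p"
    proof (cases "p \<in> cyl R {0..T}")
      case False then show ?thesis using out v(1) by simp
    next
      case True
      then obtain t \<theta> where "t \<in> {0..T}" "\<theta> \<in> {0..2 * pi}" "p = Psi R (vector [t, \<theta>])" by (rule cylE)
      moreover have "?U t pi = ?U t 0" using inv[OF \<open>t \<in> {0..T}\<close>, of pi] by simp
      ultimately show ?thesis using inv[of t \<theta>] v(2)[of t \<theta>] by simp
    qed
  qed
  ultimately show ?thesis
  proof (elim disjE conjE)
    assume "\<forall>t\<in>{0..T}. ?U t pi = 0"
    then have "u = 0" by (intro eqI) simp_all
    then show ?thesis ..
  next
    assume w: "w > 0" "cos (sqrt w * T) = 0" and sol: "\<forall>t\<in>{0..T}. ?U t pi = ?U 0 pi * cos (sqrt w * t)"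
    obtain n :: nat where n: "odd n" "sqrt w * T = real n * (pi / 2)"
      using cos_zero_lemma[of "sqrt w * T"] w T_pos by auto
    obtain m where "n = 2 * m + 1" using n(1) by (rule oddE)
    then have freq: "sqrt w = frequency T m" using n(2) T_pos by (simp add: frequency_def field_simps)
    then have "(frequency T m)\<^sup>2 = w" using w(1) by (simp flip: freq)
    then have "ev = mode_value R T m"
      using r_pos c_pos by (simp add: mode_value_def w_def \<kappa>_def field_simps)
    moreover have "u = fun_scale (?U 0 pi) (mode R T m)"
    proof (rule eqI)
      fix t \<theta> assume t: "t \<in> {0..T}"
      show "?U t pi = fun_scale (?U 0 pi) (mode R T m) (Psi R (vector [t, \<theta>]))"
        using bspec[OF sol t] by (simp only: freq fun_scale_def mode_Psi[OF t])
    qed (simp add: fun_scale_def mode_def)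
    ultimately show ?thesis by blast
  qed
qed

text \<open>The set whose maximum is \<open>eta\<close> contains \<open>m + 1\<close> iff \<open>2m + 1 < 2T / (\<pi> r)\<close>, that is, iff the frequency of
  the mode \<open>m\<close> is less than \<open>1 / r\<close>; and it is an initial segment of the natural numbers.\<close>
lemma mode_value_neg_iff: "mode_value R T m < 0 \<longleftrightarrow> m < eta R T"
proof -
  let ?x = "2 * T / (pi * r)"
  let ?S = "{m::nat. 2 * real m - 1 < ?x}"
  have "?S \<subseteq> {..nat \<lceil>?x + 1\<rceil>}"
  proof
    fix m assume "m \<in> ?S"
    then have "real m \<le> ?x + 1" by simp
    then show "m \<in> {..nat \<lceil>?x + 1\<rceil>}" by simp linarith
  qed
  then have fin: "finite ?S" by (rule finite_subset) simp
  have x: "?x > 0" using T_pos r_pos by simp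
  then have "0 \<in> ?S" by simp
  then have max: "eta R T \<in> ?S" "\<And>m. m \<in> ?S \<Longrightarrow> m \<le> eta R T"
    unfolding eta_def using Max_in[OF fin] Max_ge[OF fin] by blast+
  have "m < eta R T \<longleftrightarrow> 2 * real m + 1 < ?x"
  proof
    assume "m < eta R T"
    then have "real m + 1 \<le> real (eta R T)" by simp
    then show "2 * real m + 1 < ?x" using max(1) by simp
  next
    assume "2 * real m + 1 < ?x"
    then have "Suc m \<in> ?S" by simp
    then show "m < eta R T" using max(2) by fastforce
  qed
  also have "\<dots> \<longleftrightarrow> frequency T m < 1 / r"
    using T_pos r_pos by (simp add: frequency_def field_simps)
  also have "\<dots> \<longleftrightarrow> (frequency T m)\<^sup>2 < (1 / r)\<^sup>2"
  proof -
    have "0 \<le> frequency T m" "0 \<le> 1 / r" using T_pos r_pos by (simp_all add: frequency_def)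
    then show ?thesis by (metis power2_less_imp_less power_strict_mono pos2)
  qed
  also have "\<dots> \<longleftrightarrow> mode_value R T m < 0"
    using c_pos by (simp add: mode_value_def divide_less_0_iff power_divide)
  finally show ?thesis ..
qed

lemma inj_mode_value: "inj (mode_value R T)"
proof (rule injI)
  fix m n assume "mode_value R T m = mode_value R T n"
  then have "(frequency T m)\<^sup>2 = (frequency T n)\<^sup>2" using c_pos by (simp add: mode_value_def)
  then have "frequency T m = frequency T n"
    using T_pos by (subst (asm) power2_eq_iff_nonneg) (simp_all add: frequency_def)
  then show "m = n" using T_pos by (simp add: frequency_def)
qed

lemma mode_nonzero: "mode R T m (Psi R (vector [0, 0])) = 1"
  using T_pos by (simp add: mode_Psi)

lemma has_index_eta: "has_index R T (eta R T)"
proof -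
  let ?E = "\<lambda>m. eigenspace R T (mode_value R T m)"
  have neg: "negative_eigenvalues R T = mode_value R T ` {..<eta R T}"
  proof (intro equalityI subsetI)
    fix ev assume "ev \<in> negative_eigenvalues R T"
    then obtain u p where "ev < 0" "u \<in> eigenspace R T ev" "u p \<noteq> 0"
      unfolding negative_eigenvalues_def by blast
    moreover have "u \<noteq> 0" using \<open>u p \<noteq> 0\<close> by auto
    ultimately obtain m where "ev = mode_value R T m" using eigenfunction_negative by metis
    then show "ev \<in> mode_value R T ` {..<eta R T}" using \<open>ev < 0\<close> mode_value_neg_iff by auto
  next
    fix ev assume "ev \<in> mode_value R T ` {..<eta R T}"
    then obtain m where "ev = mode_value R T m" "ev < 0" using mode_value_neg_iff by auto
    then show "ev \<in> negative_eigenvalues R T"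
      unfolding negative_eigenvalues_def using mode_in_eigenspace[of m] mode_nonzero[of m]
      by (metis (mono_tags, lifting) mem_Collect_eq zero_neq_one)
  qed
  have span: "?E m \<subseteq> fun_vs.span {mode R T m}" if "m < eta R T" for m
  proof
    fix u assume "u \<in> ?E m"
    moreover have "mode_value R T m < 0" using that mode_value_neg_iff by simp
    ultimately consider "u = 0" | n a where "mode_value R T m = mode_value R T n" "u = fun_scale a (mode R T n)"
      using eigenfunction_negative by metis
    then show "u \<in> fun_vs.span {mode R T m}"
    proof cases
      case 1 then show ?thesis by (simp add: fun_vs.span_zero)
    next
      case 2
      then have "n = m" using inj_mode_value by (simp add: inj_eq)
      then show ?thesis using 2 by (simp add: fun_vs.span_scale fun_vs.span_base)
    qed
  qed
  have dim: "fun_vs.dim (?E m) = 1" if "m < eta R T" for m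
  proof (rule fun_vs.dim_unique)
    show "{mode R T m} \<subseteq> ?E m" using mode_in_eigenspace by simp
    show "?E m \<subseteq> fun_vs.span {mode R T m}" by (rule span[OF that])
    have "mode R T m \<noteq> 0" using mode_nonzero[of m] by auto
    then show "fun_vs.independent {mode R T m}" by (simp add: fun_vs.dependent_single)
  qed simp
  have "(\<Sum>ev\<in>negative_eigenvalues R T. fun_vs.dim (eigenspace R T ev)) = (\<Sum>m<eta R T. fun_vs.dim (?E m))"
    unfolding neg by (rule sum.reindex_cong[OF inj_on_subset[OF inj_mode_value]]) auto
  also have "\<dots> = eta R T" using dim by simp
  finally have "eta R T = (\<Sum>ev\<in>negative_eigenvalues R T. fun_vs.dim (eigenspace R T ev))" ..
  moreover have "\<exists>B. finite B \<and> eigenspace R T ev \<subseteq> fun_vs.span B" if "ev \<in> negative_eigenvalues R T" for ev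
    using that span unfolding neg by (metis finite.emptyI finite.insertI imageE lessThan_iff)
  ultimately show ?thesis unfolding has_index_def using neg by simp
qed

end

section \<open>The quadratic form of a function of the height\<close>

lemma surface_integral_height:
  assumes "\<And>t \<theta>. t \<in> I \<Longrightarrow> f (vector [t, \<theta>]) = g t"
  shows "surface_integral R I f = 2 * pi * r * c * integral I g"
proof -
  have "surface_integral R I f = integral I (\<lambda>t. 2 * pi * r * c * g t)"
    unfolding surface_integral_def
    by (rule integral_cong) (simp add: assms area_density_eq)
  then show ?thesis by simp
qed

lemma form_Q_height:
  assumes I: "I \<subseteq> {0..}" "\<And>t. t \<in> I \<Longrightarrow> t islimpt I"
    and h: "\<And>t. (h has_real_derivative h' t) (at t)"
  shows "form_Q R I (\<lambda>p. h (ln (p$3))) = 2 * pi * (r / c) * integral I (\<lambda>t. (h' t)\<^sup>2 - (h t)\<^sup>2 / r\<^sup>2)"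
proof -
  let ?u = "\<lambda>p::real^3. h (ln (p$3))"
  have grad: "grad_sq R I ?u (vector [t, \<theta>]) = (h' t)\<^sup>2 / c\<^sup>2 + 0\<^sup>2 / r\<^sup>2" if "t \<in> I" for t \<theta>
    by (rule grad_sq_eq[OF I(1) I(2) _ _ that])
       (simp_all add: has_field_derivative_at_within[OF h])
  have "boundary_integral R (\<lambda>q. qcoef R (Psi R q) * (?u (Psi R q))\<^sup>2) = 0"
  proof -
    have "qcoef R (Psi R (vector [0, \<theta>])) = 0" for \<theta>
      by (rule qcoef_eq_0[OF Psi_in_cyl]) simp
    then show ?thesis by (simp add: boundary_integral_def)
  qed
  moreover have "surface_integral R I (\<lambda>q. grad_sq R I ?u q - (norm_A_sq R q - 2) * (?u (Psi R q))\<^sup>2)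
      = 2 * pi * r * c * integral I (\<lambda>t. 1 / c\<^sup>2 * ((h' t)\<^sup>2 - (h t)\<^sup>2 / r\<^sup>2))"
  proof (rule surface_integral_height)
    fix t \<theta> assume t: "t \<in> I"
    have A: "norm_A_sq R (vector [t, \<theta>]) - 2 = 1 / (r\<^sup>2 * c\<^sup>2)"
      by (rule norm_A_sq_eq) (use t I in auto)
    show "grad_sq R I ?u (vector [t, \<theta>]) - (norm_A_sq R (vector [t, \<theta>]) - 2) * (?u (Psi R (vector [t, \<theta>])))\<^sup>2
        = 1 / c\<^sup>2 * ((h' t)\<^sup>2 - (h t)\<^sup>2 / r\<^sup>2)"
      unfolding grad[OF t] A by (simp add: right_diff_distrib mult.commute)
  qed
  ultimately show ?thesis
    using r_pos c_pos by (simp add: form_Q_def power2_eq_square)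
qed

section \<open>Instability of the compact pieces\<close>

text \<open>The bound on \<open>T\<close> says that the higher frequency \<open>3 \<mu>\<close> is less than \<open>1 / r\<close>.\<close>
lemma not_stable_compact:
  assumes "T > 0" and T: "T > 3 * pi * r / 2"
  shows "\<not> stable_compact R T"
proof
  assume stable: "stable_compact R T"
  define \<mu> where "\<mu> = pi / (2 * T)"
  define h where "h t = cos (\<mu> * t) + 3 * cos (3 * \<mu> * t)" for t
  define h' where "h' t = - \<mu> * sin (\<mu> * t) - 9 * \<mu> * sin (3 * \<mu> * t)" for t
  let ?u = "\<lambda>p::real^3. h (ln (p$3))"
  have hd: "(h has_real_derivative h' t) (at t)" for t
    unfolding h_def h'_def by (auto intro!: derivative_eq_intros)
  have smooth: "smooth_on_set (cyl R {0..T}) ?u"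
  proof (rule smooth_on_set_height[where \<alpha> = 0 and \<mu> = \<mu> and
        G = "\<lambda>n x. cos (x + real n * (pi / 2)) + 3 * 3 ^ n * cos (3 * x + real n * (pi / 2))"])
    fix n :: nat and x :: real
    have "((\<lambda>x. cos (3 * x + real n * (pi / 2))) has_real_derivative
        cos (3 * x + real (Suc n) * (pi / 2)) * 3) (at x)"
      by (rule DERIV_chain2[OF cos_derivatives]) (auto intro!: derivative_eq_intros)
    from DERIV_add[OF cos_derivatives DERIV_cmult[OF this, of "3 * 3 ^ n"]]
    show "((\<lambda>x. cos (x + real n * (pi / 2)) + 3 * 3 ^ n * cos (3 * x + real n * (pi / 2))) has_real_derivative
        cos (x + real (Suc n) * (pi / 2)) + 3 * 3 ^ Suc n * cos (3 * x + real (Suc n) * (pi / 2))) (at x)"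
      by (rule DERIV_cong) simp
  qed (auto simp: h_def cyl_subset_H3 mult.assoc)
  have dir: "?u p = 0" if p: "p \<in> cyl R {T}" for p
  proof -
    have "ln (p$3) = T" using p by (simp add: cyl_iff)
    moreover have "\<mu> * T = pi / 2" "3 * \<mu> * T = 3 / 2 * pi" using \<open>T > 0\<close> by (simp_all add: \<mu>_def)
    ultimately show ?thesis by (simp only: h_def cos_3over2_pi) simp
  qed
  have "surface_integral R {0..T} (?u \<circ> Psi R) = 2 * pi * r * c * integral {0..T} h"
    by (rule surface_integral_height) simp
  also have "integral {0..T} h = 0"
    using test_function_integral[OF \<open>T > 0\<close> \<mu>_def] unfolding h_def by (rule integral_unique)
  finally have mean: "surface_integral R {0..T} (?u \<circ> Psi R) = 0" by (simp only: mult_zero_right)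
  have "form_Q R {0..T} ?u = 2 * pi * (r / c) * integral {0..T} (\<lambda>t. (h' t)\<^sup>2 - (h t)\<^sup>2 / r\<^sup>2)"
    by (rule form_Q_height[OF _ islimpt_closed_interval[OF \<open>T > 0\<close>] hd]) auto
  also have "integral {0..T} (\<lambda>t. (h' t)\<^sup>2 - (h t)\<^sup>2 / r\<^sup>2) = (T / 2) * (82 * \<mu>\<^sup>2 - 10 * (1 / r\<^sup>2))"
    using test_function_energy[OF \<open>T > 0\<close> \<mu>_def, of "1 / r\<^sup>2"] unfolding h_def h'_def
    by (intro integral_unique) simp
  finally have Q: "form_Q R {0..T} ?u = 2 * pi * (r / c) * ((T / 2) * (82 * \<mu>\<^sup>2 - 10 * (1 / r\<^sup>2)))" .
  have "3 * \<mu> < 1 / r" using T r_pos \<open>T > 0\<close> by (simp add: \<mu>_def field_simps)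
  moreover have "0 \<le> 3 * \<mu>" using \<open>T > 0\<close> by (simp add: \<mu>_def)
  ultimately have "(3 * \<mu>)\<^sup>2 < (1 / r)\<^sup>2" by (intro power_strict_mono) auto
  then have "9 * \<mu>\<^sup>2 < 1 / r\<^sup>2" by (simp add: power_mult_distrib power_divide)
  then have "82 * \<mu>\<^sup>2 - 10 * (1 / r\<^sup>2) < 0" using zero_le_power2[of \<mu>] by linarith
  moreover have "0 < 2 * pi * (r / c)" "0 < T / 2" using r_pos c_pos \<open>T > 0\<close> by simp_all
  ultimately have "form_Q R {0..T} ?u < 0" unfolding Q by (intro mult_pos_neg)
  moreover have "form_Q R {0..T} ?u \<ge> 0"
    by (rule stable[unfolded stable_compact_def, rule_format]) (intro conjI ballI smooth dir mean)
  ultimately show False by simp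
qed

section \<open>Instability of the half-cylinder\<close>

lemma compact_cyl: "compact (cyl R {0..L})"
proof -
  let ?P = "\<lambda>x. exp (fst x) *\<^sub>R ((r * cos (snd x)) *\<^sub>R axis 1 1 + (r * sin (snd x)) *\<^sub>R axis 2 1 + axis 3 1) :: real^3"
  have P: "Psi R (vector [t, \<theta>]) = ?P (t, \<theta>)" for t \<theta>
    by (simp add: vec3_eq_iff)
  have "cyl R {0..L} = ?P ` ({0..L} \<times> {0..2 * pi})"
  proof (intro equalityI subsetI)
    fix p assume "p \<in> cyl R {0..L}"
    then obtain t \<theta> where "t \<in> {0..L}" "\<theta> \<in> {0..2 * pi}" "p = Psi R (vector [t, \<theta>])" by (rule cylE)
    then show "p \<in> ?P ` ({0..L} \<times> {0..2 * pi})" by (intro image_eqI[of _ _ "(t, \<theta>)"]) (simp_all only: P mem_Times_iff fst_conv snd_conv)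
  next
    fix p assume "p \<in> ?P ` ({0..L} \<times> {0..2 * pi})"
    then obtain t \<theta> where "t \<in> {0..L}" "p = Psi R (vector [t, \<theta>])" using P by auto
    then show "p \<in> cyl R {0..L}" using Psi_in_cyl by simp
  qed
  moreover have "compact (?P ` ({0..L} \<times> {0..2 * pi}))"
    by (intro compact_continuous_image compact_Times compact_Icc continuous_intros)
  ultimately show ?thesis by simp
qed

text \<open>Stretching by \<open>L\<close> divides the Dirichlet integral by \<open>L\<close> and multiplies the integral of the
  square by \<open>L\<close>, so the zeroth-order term wins for large \<open>L\<close>.\<close>
lemma not_stable_noncompact: "\<not> stable_noncompact R"
proof
  assume stable: "stable_noncompact R"
  define a where "a = integral {0..1} (\<lambda>x. (bump 1 x)\<^sup>2)"
  define b where "b = integral {0..1} (\<lambda>x. (bump 0 x)\<^sup>2)"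
  have a: "((\<lambda>x. (bump 1 x)\<^sup>2) has_integral a) {0..1}" and b: "((\<lambda>x. (bump 0 x)\<^sup>2) has_integral b) {0..1}"
    unfolding a_def b_def
    by (intro integrable_integral integrable_continuous_real continuous_intros continuous_on_bump)+
  have "b \<noteq> 0"
  proof
    assume "b = 0"
    then have "\<forall>x\<in>{0..1}. (bump 0 x)\<^sup>2 = 0"
      unfolding b_def by (subst (asm) integral_eq_0_iff) (auto intro!: continuous_intros continuous_on_bump)
    then have "(bump 0 1)\<^sup>2 = 0" by (rule bspec) simp
    then show False using bump_1 by simp
  qed
  moreover have "b \<ge> 0" using b by (rule has_integral_nonneg) simp
  ultimately have "b > 0" by simp
  \<comment> \<open>Chosen so that \<open>a / L\<^sup>2 < b / r\<^sup>2\<close>.\<close>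
  define L where "L = sqrt (a * r\<^sup>2 / b + 1)"
  have "a \<ge> 0" using a by (rule has_integral_nonneg) simp
  then have arb: "0 \<le> a * r\<^sup>2 / b" using \<open>b > 0\<close> by simp
  then have L: "L > 0" "L\<^sup>2 = a * r\<^sup>2 / b + 1" by (simp_all add: L_def add_nonneg_pos)
  define h where "h t = bump 0 (1 - t / L)" for t
  define h' where "h' t = - bump 1 (1 - t / L) / L" for t
  let ?u = "\<lambda>p::real^3. h (ln (p$3))"
  have hd: "(h has_real_derivative h' t) (at t)" for t
  proof -
    have "((\<lambda>t. 1 - t / L) has_real_derivative - (1 / L)) (at t)"
      using L by (auto intro!: derivative_eq_intros)
    from DERIV_chain2[OF bump_derivative this] show ?thesis by (simp add: h_def[abs_def] h'_def)
  qed
  have smooth: "smooth_on_set (cyl R {0..}) ?u"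
    by (rule smooth_on_set_height[where G = bump and \<alpha> = 1 and \<mu> = "- (1 / L)", OF bump_derivative cyl_subset_H3])
       (simp add: h_def)
  have supp: "\<exists>K. compact K \<and> K \<subseteq> cyl R {0..} \<and> (\<forall>p\<in>cyl R {0..} - K. ?u p = 0)"
  proof (intro exI conjI ballI)
    show "cyl R {0..L} \<subseteq> cyl R {0..}" by (auto simp: cyl_iff)
    fix p assume "p \<in> cyl R {0..} - cyl R {0..L}"
    then have "ln (p$3) > L" by (auto simp: cyl_iff)
    then have "1 - ln (p$3) / L \<le> 0" using L by (simp add: le_divide_eq)
    then show "?u p = 0" by (simp only: h_def bump_nonpos)
  qed (rule compact_cyl)
  have "surface_integral R {0..} (?u \<circ> Psi R) = 2 * pi * r * c * integral {0..} h"
    by (rule surface_integral_height) simp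
  also have "integral {0..} h = L * 0"
    unfolding h_def[abs_def] by (rule integral_stretched_profile[OF L(1) bump_has_integral_0 bump_nonpos])
  finally have mean: "surface_integral R {0..} (?u \<circ> Psi R) = 0" by (simp only: mult_zero_right)
  let ?g = "\<lambda>x. (bump 1 x)\<^sup>2 / L\<^sup>2 - (bump 0 x)\<^sup>2 / r\<^sup>2"
  have "form_Q R {0..} ?u = 2 * pi * (r / c) * integral {0..} (\<lambda>t. (h' t)\<^sup>2 - (h t)\<^sup>2 / r\<^sup>2)"
  proof (rule form_Q_height[OF _ _ hd])
    fix t :: real assume "t \<in> {0..}"
    moreover have "\<nexists>x. {0::real..} = {x}" using infinite_Ici[of "0::real"] by (metis finite.simps)
    ultimately show "t islimpt {0..}" by (intro connected_imp_perfect) auto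
  qed simp
  also have "(\<lambda>t. (h' t)\<^sup>2 - (h t)\<^sup>2 / r\<^sup>2) = (\<lambda>t. ?g (1 - t / L))"
    by (simp add: fun_eq_iff h_def h'_def power_divide)
  also have "integral {0..} (\<lambda>t. ?g (1 - t / L)) = L * (a / L\<^sup>2 - b / r\<^sup>2)"
  proof (rule integral_stretched_profile[OF L(1)])
    show "(?g has_integral a / L\<^sup>2 - b / r\<^sup>2) {0..1}"
      by (intro has_integral_diff has_integral_divide a b)
  qed (simp add: bump_nonpos)
  finally have Q: "form_Q R {0..} ?u = 2 * pi * (r / c) * (L * (a / L\<^sup>2 - b / r\<^sup>2))" .
  have "a * r\<^sup>2 < L\<^sup>2 * b" using L(2) \<open>b > 0\<close> by (simp add: field_simps)
  then have "a / L\<^sup>2 < b / r\<^sup>2" using L(1) r_pos by (simp add: field_simps)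
  then have "L * (a / L\<^sup>2 - b / r\<^sup>2) < 0" using L(1) by (intro mult_pos_neg) simp_all
  moreover have "0 < 2 * pi * (r / c)" using r_pos c_pos by simp
  ultimately have "form_Q R {0..} ?u < 0" unfolding Q by (rule mult_pos_neg[rotated])
  moreover have "form_Q R {0..} ?u \<ge> 0"
    by (rule stable[unfolded stable_noncompact_def, rule_format]) (intro conjI smooth supp mean)
  ultimately show False by simp
qed
end

theorem theorem6p2:
  fixes R T :: real
  assumes "R > 0" and "T > 0"
  shows "has_index R T (eta R T)
       \<and> (T > 3 * pi * sinh R / 2 \<longrightarrow> \<not> stable_compact R T)
       \<and> \<not> stable_noncompact R"
  using has_index_eta[OF assms] not_stable_compact[OF assms] not_stable_noncompact[OF assms(1)] by blast

end
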